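(* Let $Q$, $A$, $B$, $C_Q$, $\mathrm{Aut}^+(Q,\mathbb{Z}^2)$ and $\Phi_m^{c_1,c_2}$ be as in the context. Let $c\in C_Q$ and suppose $\{(m_j,\gamma_j)\}$ is a finite collection where each $m_j$ is a periodic function on $\mathbb{Z}^2$ such that $Q(\nu)\neq 0$ for all $\nu$ in the support of $m_j$, and each $\gamma_j\in\mathrm{Aut}^+(Q,\mathbb{Z}^2)$, such that \begin{equation*} \sum_{j} (m_j -m_j\circ \gamma_j) =0. \end{equation*} Then $F=\sum_j \Phi_{m_j}^{c,\gamma_j c}$ is a weight $0$ Maass form (on some subgroup of $\mathrm{SL}_2(\mathbb{Z})$, with some multiplier system) with eigenvalue $1/4$ of the Laplace operator $\Delta_0=-y^2\left(\frac{\partial^2}{\partial x^2}+\frac{\partial^2}{\partial y^2}\right)$; i.e.\ $\Delta_0F=\frac14F$ and there are a subgroup $\Gamma\subseteq\mathrm{SL}_2(\mathbb{Z})$ and a map $v$ on $\Gamma$ with $F\!\left(\frac{a\tau+b}{c\tau+d}\right)=v\!\begin{pmatrix}a&b\\c&d\end{pmatrix}F(\tau)$ for all $\begin{pmatrix}a&b\\c&d\end{pmatrix}\in\Gamma$. Moreover, $\sum_j \Phi_{m_j}^{c,\gamma_j c}$ is independent of the choice of $c\in C_Q$.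
   Context: $A$ is a symmetric $2\times 2$ integer matrix such that $Q(\nu)=\frac12\nu^tA\nu$ on $\mathbb{R}^2$ has signature $(1,1)$; $B(\nu,\mu)=\nu^tA\mu$. $C_Q$ is a fixed one of the two components of $\{c\in\mathbb{R}^2:Q(c)=-1\}$. Choose $P\in\mathrm{GL}_2(\mathbb{R})$ with $A=P^t\begin{pmatrix}0&1\\1&0\end{pmatrix}P$ and $P^{-1}\binom{1}{-1}\in C_Q$; set $c(t)=P^{-1}\binom{e^t}{-e^{-t}}$, $c^\perp(t)=P^{-1}\binom{e^t}{e^{-t}}$. For $c_i\in C_Q$, $t_i$ is defined by $c(t_i)=c_i$ and $c_i^\perp:=c^\perp(t_i)$. $\mathrm{Aut}^+(Q,\mathbb{Z}^2)$ is the group of $\gamma\in\mathrm{GL}_2(\mathbb{R})$ with $Q\circ\gamma=Q$, $\gamma\mathbb{Z}^2=\mathbb{Z}^2$, $\gamma C_Q=C_Q$ and $\det\gamma=1$. A function $m:\mathbb{Z}^2\to\mathbb{C}$ is periodic if there is $L\in\mathbb{Z}$ with $m(\nu+\mu)=m(\nu)$ for all $\nu\in\mathbb{Z}^2$, $\mu\in L\mathbb{Z}^2$. $K_0$ is the modified Bessel function of the second kind, $\mathrm{sgn}(0)=0$, $\tau=x+iy\in\mathbb{H}$. For $c_1,c_2\in C_Q$ and periodic $m$, \begin{equation*} \begin{split} \Phi_m^{c_1,c_2} (\tau) &= \mathrm{sgn}(t_2-t_1)\ y^{1/2} \sum_{\nu\in \mathbb{Z}^2} \tfrac{1}{2}\bigl[1-\mathrm{sgn}(B(\nu,c_1)B(\nu,c_2))\bigr]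 m(\nu) e^{2\pi iQ(\nu)x} K_0(2\pi Q(\nu) y)\\ &\ + \mathrm{sgn}(t_2-t_1)\ y^{1/2} \sum_{\nu\in\mathbb{Z}^2} \tfrac{1}{2}\bigl[1-\mathrm{sgn}(B(\nu,c_1^\perp)B(\nu,c_2^\perp))\bigr] m(\nu) e^{2\pi iQ(\nu)x} K_0(-2\pi Q(\nu) y). \end{split} \end{equation*} *)

theory Defs
  imports "HOL-Analysis.Analysis" "HOL-Algebra.Coset"
begin

definition bil :: "real^2^2 \<Rightarrow> real^2 \<Rightarrow> real^2 \<Rightarrow> real" where
  "bil A \<nu> \<mu> = \<nu> \<bullet> (A *v \<mu>)"

definition quad :: "real^2^2 \<Rightarrow> real^2 \<Rightarrow> real" where
  "quad A \<nu> = (1/2) * (\<nu> \<bullet> (A *v \<nu>))"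

(* p positive and q negative coefficients after diagonalising by a real change of basis;
   well defined by Sylvester's law of inertia. *)
definition has_signature :: "real^'n^'n \<Rightarrow> nat \<Rightarrow> nat \<Rightarrow> bool" where
  "has_signature A p q \<longleftrightarrow>
     (\<exists>(S :: real^'n^'n) (d :: 'n \<Rightarrow> real). invertible S \<and>
        transpose S ** A ** S = (\<chi> i j. if i = j then d i else 0) \<and>
        card {i. d i > 0} = p \<and> card {i. d i < 0} = q)"

definition lattice_Z2 :: "(real^2) set" where
  "lattice_Z2 = {\<nu>. \<forall>i. \<nu> $ i \<in> \<int>}"

definition hyp_J :: "real^2^2" where
  "hyp_J = vector [vector [0, 1], vector [1, 0]]"

definition c_curve :: "real^2^2 \<Rightarrow> real \<Rightarrow> real^2" where
  "c_curve P t = matrix_inv P *v vector [exp t, - exp (- t)]"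

definition c_perp_curve :: "real^2^2 \<Rightarrow> real \<Rightarrow> real^2" where
  "c_perp_curve P t = matrix_inv P *v vector [exp t, exp (- t)]"

definition t_param :: "real^2^2 \<Rightarrow> real^2 \<Rightarrow> real" where
  "t_param P c = (THE t. c_curve P t = c)"

definition perp :: "real^2^2 \<Rightarrow> real^2 \<Rightarrow> real^2" where
  "perp P c = c_perp_curve P (t_param P c)"

definition Aut_plus :: "real^2^2 \<Rightarrow> (real^2) set \<Rightarrow> (real^2^2) set" where
  "Aut_plus A C = {\<gamma>. invertible \<gamma> \<and> (\<forall>\<nu>. quad A (\<gamma> *v \<nu>) = quad A \<nu>) \<and>
     (\<lambda>\<nu>. \<gamma> *v \<nu>) ` lattice_Z2 = lattice_Z2 \<and>
     (\<lambda>\<nu>. \<gamma> *v \<nu>) ` C = C \<and> det \<gamma> = 1}"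

(* Functions on the lattice are total functions on R^2 whose values off the lattice are ignored.
   The period L must be nonzero: L = 0 would make every function periodic. *)
definition periodic_Z2 :: "(real^2 \<Rightarrow> complex) \<Rightarrow> bool" where
  "periodic_Z2 m \<longleftrightarrow> (\<exists>L::int. L \<noteq> 0 \<and>
     (\<forall>\<nu>\<in>lattice_Z2. \<forall>\<mu>\<in>lattice_Z2. m (\<nu> + of_int L *\<^sub>R \<mu>) = m \<nu>))"

(* Integral representation of the modified Bessel function of the second kind of order 0, valid for
   x > 0. In Phi below the coefficient of every term with argument <= 0 vanishes: either the sign
   factor is 0, or Q(\<nu>) = 0 and m(\<nu>) = 0. *)
definition bessel_K0 :: "real \<Rightarrow> real" where
  "bessel_K0 x = integral {0..} (\<lambda>t. exp (- x * cosh t))"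

definition Phi ::
  "real^2^2 \<Rightarrow> real^2^2 \<Rightarrow> (real^2 \<Rightarrow> complex) \<Rightarrow> real^2 \<Rightarrow> real^2 \<Rightarrow> complex \<Rightarrow> complex" where
  "Phi A P m c1 c2 \<tau> =
     of_real (sgn (t_param P c2 - t_param P c1) * sqrt (Im \<tau>)) *
       (\<Sum>\<^sub>\<infinity>\<nu>\<in>lattice_Z2. of_real ((1/2) * (1 - sgn (bil A \<nu> c1 * bil A \<nu> c2))) * m \<nu> *
          exp (2 * of_real pi * \<i> * of_real (quad A \<nu>) * of_real (Re \<tau>)) *
          of_real (bessel_K0 (2 * pi * quad A \<nu> * Im \<tau>))) +
     of_real (sgn (t_param P c2 - t_param P c1) * sqrt (Im \<tau>)) *
       (\<Sum>\<^sub>\<infinity>\<nu>\<in>lattice_Z2.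
          of_real ((1/2) * (1 - sgn (bil A \<nu> (perp P c1) * bil A \<nu> (perp P c2)))) * m \<nu> *
          exp (2 * of_real pi * \<i> * of_real (quad A \<nu>) * of_real (Re \<tau>)) *
          of_real (bessel_K0 (- 2 * pi * quad A \<nu> * Im \<tau>)))"

definition upper_half_plane :: "complex set" where
  "upper_half_plane = {\<tau>. Im \<tau> > 0}"

definition partial_x :: "(complex \<Rightarrow> complex) \<Rightarrow> complex \<Rightarrow> complex" where
  "partial_x F \<tau> = vector_derivative (\<lambda>s. F (\<tau> + of_real s)) (at 0)"

definition partial_y :: "(complex \<Rightarrow> complex) \<Rightarrow> complex \<Rightarrow> complex" where
  "partial_y F \<tau> = vector_derivative (\<lambda>s. F (\<tau> + \<i> * of_real s)) (at 0)"

(* k times continuously differentiable on the upper half-plane, in the real sense. *)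
fun Ck_upper :: "nat \<Rightarrow> (complex \<Rightarrow> complex) \<Rightarrow> bool" where
  "Ck_upper 0 F \<longleftrightarrow> continuous_on upper_half_plane F"
| "Ck_upper (Suc k) F \<longleftrightarrow> F differentiable_on upper_half_plane \<and>
     Ck_upper k (partial_x F) \<and> Ck_upper k (partial_y F)"

definition laplace0 :: "(complex \<Rightarrow> complex) \<Rightarrow> complex \<Rightarrow> complex" where
  "laplace0 F \<tau> =
     - of_real ((Im \<tau>)\<^sup>2) * (partial_x (partial_x F) \<tau> + partial_y (partial_y F) \<tau>)"

definition SL2Z :: "(int^2^2) monoid" where
  "SL2Z = \<lparr>carrier = {M. det M = 1}, mult = (**), one = mat 1\<rparr>"

lemma group_SL2Z: "group SL2Z"
proof (rule groupI)
  fix M assume "M \<in> carrier SL2Z"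
  then have d: "M$1$1 * M$2$2 - M$1$2 * M$2$1 = 1"
    by (simp add: SL2Z_def det_2)
  define N :: "int^2^2" where "N = vector [vector [M$2$2, - M$1$2], vector [- M$2$1, M$1$1]]"
  have "det N = 1" "N ** M = mat 1"
    using d by (simp_all add: N_def det_2 vec_eq_iff forall_2 matrix_matrix_mult_def mat_def sum_2
        algebra_simps)
  then show "\<exists>N\<in>carrier SL2Z. N \<otimes>\<^bsub>SL2Z\<^esub> M = \<one>\<^bsub>SL2Z\<^esub>"
    by (auto simp: SL2Z_def)
qed (auto simp: SL2Z_def det_mul matrix_mul_assoc)

definition moebius :: "int^2^2 \<Rightarrow> complex \<Rightarrow> complex" where
  "moebius M \<tau> = (of_int (M$1$1) * \<tau> + of_int (M$1$2)) / (of_int (M$2$1) * \<tau> + of_int (M$2$2))"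

(* Twice continuous differentiability is what gives the eigenvalue equation its meaning. *)
definition maass_form_wt0 ::
  "(int^2^2) set \<Rightarrow> (int^2^2 \<Rightarrow> complex) \<Rightarrow> complex \<Rightarrow> (complex \<Rightarrow> complex) \<Rightarrow> bool" where
  "maass_form_wt0 \<Gamma> v ev F \<longleftrightarrow> Ck_upper 2 F \<and>
     (\<forall>\<tau>\<in>upper_half_plane. laplace0 F \<tau> = ev * F \<tau>) \<and>
     (\<forall>M\<in>\<Gamma>. \<forall>\<tau>\<in>upper_half_plane. F (moebius M \<tau>) = v M * F \<tau>)"

end

theory Submission
  imports Defs "HOL-Probability.Probability" "HOL-Complex_Analysis.Conformal_Mappings"
begin

text \<open>
  In coordinates with \<open>Q = \<alpha>\<beta>\<close> the curve \<open>C\<close> is \<open>c(t)\<close>, and \<open>\<gamma> \<in> Aut_plus\<close> acts as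
  \<open>(\<alpha>, \<beta>) \<mapsto> (e\<^sup>s \<alpha>, e\<^sup>-\<^sup>s \<beta>)\<close>, so that \<open>\<gamma> c(t) = c(t + s)\<close>. The sign factors select the \<open>\<nu>\<close> whose parameter
  \<open>t\<^sub>\<nu>\<close> lies between \<open>t\<^sub>1\<close> and \<open>t\<^sub>2\<close>, and \<open>K\<^sub>0(2\<pi>|Q(\<nu>)|y)\<close> is the integral over all \<open>u\<close> of
  \<open>exp(-2\<pi>y Q\<^sub>u(\<nu>))\<close>, where \<open>Q\<^sub>u\<close> is the majorant of \<open>Q\<close> at \<open>c(u)\<close>. Hence \<open>\<Phi>\<close> is \<open>\<surd>y\<close> times the integral of the
  Siegel theta function over \<open>[t\<^sub>1, t\<^sub>2]\<close>, up to an error \<open>\<phi>(t\<^sub>2) - \<phi>(t\<^sub>1)\<close> that is equivariant under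
  automorphisms; the hypothesis on \<open>\<Sum>(m\<^sub>j - m\<^sub>j \<circ> \<gamma>\<^sub>j)\<close> makes the errors cancel in \<open>F\<close>. The theta function of
  signature \<open>(1,1)\<close> has weight 0, and on a principal congruence subgroup Poisson summation reduces its
  transformation to a Gauss sum that does not depend on \<open>u\<close> or \<open>m\<close>. The eigenvalue equation is checked
  on the individual Bessel terms of \<open>\<Phi>\<close>.
\<close>

subsection \<open>Oscillating Laplace integrals\<close>

text \<open>Two descriptions of \<open>F\<close> are needed because each hides one half of the
  result: the Bessel series is termwise an eigenfunction, but its sign factors jump; the theta
  integral transforms as a whole, but equals \<open>\<Phi>\<close> only up to the errors. The other
  obstacle is convergence. \<open>K\<^sub>0(2\<pi>|Q(\<nu>)|y)\<close> does not decay along lattice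
  vectors with bounded \<open>Q\<close>, so the Bessel series has no obvious majorant. The errors
  and the theta integral do have Gaussian bounds, and the convergence of the Bessel series is
  deduced from them. Support in \<open>Q \<noteq> 0\<close> enters through integrality: there
  \<open>|Q| \<ge> 1/2\<close>. Theta picks up the factor \<open>|c\<tau> + d|\<close> under a
  substitution, and \<open>\<surd>y\<close> removes it, whence weight 0. The level is
  \<open>4 L\<^sup>2 det A\<close>. Here \<open>L\<close> is a common period of all
  \<open>m\<^sub>j\<close>, so that one multiplier serves the whole sum;
  \<open>L\<^sup>2 det A\<close> makes \<open>(c / L) A\<^sup>-\<^sup>1\<close> integral with
  entries divisible by \<open>L\<close>; the factor 4 takes care of the half-integral values of
  \<open>Q\<close>.\<close>

text \<open>Used with Lebesgue measure for complex Gaussian integrals, and with the product of counting and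
  Lebesgue measure for Bessel series.\<close>
definition osc_laplace ::
  "'a measure \<Rightarrow> ('a \<Rightarrow> real) \<Rightarrow> ('a \<Rightarrow> real) \<Rightarrow> ('a \<Rightarrow> complex) \<Rightarrow> complex \<Rightarrow> complex" where
  "osc_laplace M a c w \<tau> =
     (LINT u|M. w u * exp (\<i> * of_real (a u * Re \<tau>) - of_real (c u * Im \<tau>)))"

locale osc_laplace_exponents =
  fixes M :: "'a measure" and a c :: "'a \<Rightarrow> real"
  assumes a_meas [measurable]: "a \<in> borel_measurable M"
    and c_meas [measurable]: "c \<in> borel_measurable M"
    and abs_a_le: "\<bar>a u\<bar> \<le> c u"
begin

text \<open>Integrability is asked for at every height, not at one, because each differentiation
  brings down a factor of size \<open>c u\<close> that has to be absorbed by giving up part of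
  \<open>y\<close>.\<close>

definition admissible :: "('a \<Rightarrow> complex) \<Rightarrow> bool" where
  "admissible w \<longleftrightarrow> w \<in> borel_measurable M \<and>
     (\<forall>y>0. integrable M (\<lambda>u. w u * of_real (exp (- c u * y))))"

lemma admissibleD:
  "admissible w \<Longrightarrow> y > 0 \<Longrightarrow> integrable M (\<lambda>u. w u * of_real (exp (- c u * y)))"
  by (simp add: admissible_def)

lemma c_nonneg: "0 \<le> c u"
  using abs_a_le[of u] by linarith

lemma admissible_integrable:
  assumes "admissible w" "Im \<tau> > 0"
  shows "integrable M (\<lambda>u. w u * exp (\<i> * of_real (a u * Re \<tau>) - of_real (c u * Im \<tau>)))"
proof (rule Bochner_Integration.integrable_bound)
  have [measurable]: "w \<in> borel_measurable M" using assms by (simp add: admissible_def)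
  show "integrable M (\<lambda>u. w u * of_real (exp (- c u * Im \<tau>)))"
    using assms by (simp add: admissible_def)
  show "(\<lambda>u. w u * exp (\<i> * of_real (a u * Re \<tau>) - of_real (c u * Im \<tau>))) \<in> borel_measurable M"
    by measurable
  show "AE u in M. norm (w u * exp (\<i> * of_real (a u * Re \<tau>) - of_real (c u * Im \<tau>)))
      \<le> norm (w u * of_real (exp (- c u * Im \<tau>)))"
    by (auto simp: norm_mult)
qed

text \<open>From \<open>c exp (- c y) \<le> (2 / y) exp (- c y / 2)\<close>: a factor bounded by
  \<open>c\<close> costs half of the height. Hence the class is stable under both partial
  derivatives and can be differentiated any number of times.\<close>

lemma admissible_mult_of_le:
  assumes w: "admissible w" and [measurable]: "f \<in> borel_measurable M"
    and f: "\<And>u. norm (f u :: complex) \<le> c u"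
  shows "admissible (\<lambda>u. f u * w u)"
  unfolding admissible_def
proof (intro conjI allI impI)
  have [measurable]: "w \<in> borel_measurable M" using w by (simp add: admissible_def)
  show "(\<lambda>u. f u * w u) \<in> borel_measurable M" by measurable
  fix y :: real assume y: "y > 0"
  show "integrable M (\<lambda>u. f u * w u * of_real (exp (- c u * y)))"
  proof (rule Bochner_Integration.integrable_bound)
    show "integrable M (\<lambda>u. of_real (2 / y) * (w u * of_real (exp (- c u * (y / 2)))))"
      by (intro integrable_mult_right admissibleD[OF w half_gt_zero[OF y]])
    have *: "norm (f u * w u * of_real (exp (- c u * y)))
        \<le> norm (of_real (2 / y) * (w u * of_real (exp (- c u * (y / 2)))))" for u
    proof -
      have "1 + c u * (y / 2) \<le> exp (c u * (y / 2))" by (rule exp_ge_add_one_self)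
      hence "c u * (y / 2) \<le> exp (c u * (y / 2))" by linarith
      hence "c u \<le> (2 / y) * exp (c u * (y / 2))"
        using y by (simp add: field_simps)
      hence "norm (f u) \<le> (2 / y) * exp (c u * (y / 2))"
        using f[of u] by linarith
      hence "norm (f u) * exp (- c u * y) \<le> (2 / y) * exp (c u * (y / 2)) * exp (- c u * y)"
        by (intro mult_right_mono) auto
      also have "\<dots> = (2 / y) * exp (- c u * (y / 2))"
        by (simp add: exp_add [symmetric] mult.assoc)
      finally have "norm (w u) * (norm (f u) * exp (- c u * y))
          \<le> norm (w u) * ((2 / y) * exp (- c u * (y / 2)))"
        by (rule mult_left_mono) simp
      thus ?thesis using y by (simp add: norm_mult norm_divide algebra_simps)
    qed
    show "AE u in M. norm (f u * w u * of_real (exp (- c u * y)))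
        \<le> norm (of_real (2 / y) * (w u * of_real (exp (- c u * (y / 2)))))"
      by (rule AE_I2) (rule *)
  qed measurable
qed

lemma admissible_a: "admissible w \<Longrightarrow> admissible (\<lambda>u. \<i> * of_real (a u) * w u)"
  by (rule admissible_mult_of_le) (auto simp: norm_mult abs_a_le)

lemma admissible_c: "admissible w \<Longrightarrow> admissible (\<lambda>u. - of_real (c u) * w u)"
  by (rule admissible_mult_of_le) (auto simp: norm_mult c_nonneg)

text \<open>A second-order Taylor estimate of the exponential, integrated over \<open>u\<close>,
  gives a remainder quadratic in \<open>h\<close>. The total derivative in both real variables comes
  out at once, without passing through continuity of partial derivatives.\<close>

lemma osc_laplace_has_derivative:
  assumes w: "admissible w" and \<tau>: "Im \<tau> > 0"
  shows "(osc_laplace M a c w has_derivative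
    (\<lambda>h. of_real (Re h) * osc_laplace M a c (\<lambda>u. \<i> * of_real (a u) * w u) \<tau>
       + of_real (Im h) * osc_laplace M a c (\<lambda>u. - of_real (c u) * w u) \<tau>)) (at \<tau>)"
    (is "(?G has_derivative ?D) _")
proof -
  define y where "y = Im \<tau>"
  have y: "y > 0" using \<tau> by (simp add: y_def)
  define E where "E = (\<lambda>\<tau> u. exp (\<i> * of_real (a u * Re \<tau>) - of_real (c u * Im \<tau>)))"
  \<comment> \<open>Second moment of \<open>c\<close> at height \<open>y / 2\<close>. The other half
    of the height pays for the factor \<open>exp \<bar>Re \<zeta>\<bar>\<close> in the Taylor
    remainder.\<close>
  define B where "B = (LINT u|M. norm (of_real (c u) * (of_real (c u) * w u) * of_real (exp (- c u * (y / 2)))))"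
  have [measurable]: "w \<in> borel_measurable M" using w by (simp add: admissible_def)
  have ad2: "admissible (\<lambda>u. of_real (c u) * (of_real (c u) * w u))"
    by (intro admissible_mult_of_le w) (auto simp: c_nonneg)
  have intB: "integrable M (\<lambda>u. norm (of_real (c u) * (of_real (c u) * w u) * of_real (exp (- c u * (y / 2)))))"
    by (intro integrable_norm admissibleD[OF ad2 half_gt_zero[OF y]])
  have B0: "B \<ge> 0" unfolding B_def by (rule integral_nonneg_AE) auto
  have bound: "norm (?G (\<tau> + h) - ?G \<tau> - ?D h) \<le> 4 * B * (norm h)\<^sup>2" if h: "norm h \<le> y / 4" for h
  proof -
    have Imh: "\<bar>Im h\<bar> \<le> y / 4" using h abs_Im_le_cmod[of h] by linarith
    have im: "Im (\<tau> + h) > 0" using Imh y by (auto simp: y_def)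
    let ?f1 = "\<lambda>u. w u * E (\<tau> + h) u" and ?f2 = "\<lambda>u. w u * E \<tau> u"
    let ?f3 = "\<lambda>u. of_real (Re h) * (\<i> * of_real (a u) * w u * E \<tau> u)"
    let ?f4 = "\<lambda>u. of_real (Im h) * (- of_real (c u) * w u * E \<tau> u)"
    have i1: "integrable M ?f1" using admissible_integrable[OF w im] by (simp add: E_def)
    have i2: "integrable M ?f2" using admissible_integrable[OF w \<tau>] by (simp add: E_def)
    have i3: "integrable M ?f3"
      using admissible_integrable[OF admissible_a[OF w] \<tau>] unfolding E_def
      by (intro integrable_mult_right) 
    have i4: "integrable M ?f4"
      using admissible_integrable[OF admissible_c[OF w] \<tau>] unfolding E_def
      by (intro integrable_mult_right) 
    have "?D h = (LINT u|M. ?f3 u) + (LINT u|M. ?f4 u)"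
      unfolding osc_laplace_def E_def by (subst (1 2) integral_mult_right_zero) (rule refl)
    hence diff: "?G (\<tau> + h) - ?G \<tau> - ?D h = (LINT u|M. ?f1 u - ?f2 u - (?f3 u + ?f4 u))"
      using i1 i2 i3 i4 by (simp add: osc_laplace_def E_def)
    have "norm (?G (\<tau> + h) - ?G \<tau> - ?D h) \<le> (LINT u|M. norm (?f1 u - ?f2 u - (?f3 u + ?f4 u)))"
      unfolding diff by (rule integral_norm_bound)
    also have "\<dots> \<le> (LINT u|M. (4 * (norm h)\<^sup>2) * norm (of_real (c u) * (of_real (c u) * w u) * of_real (exp (- c u * (y / 2)))))"
    proof (rule integral_mono)
      show "integrable M (\<lambda>u. norm (?f1 u - ?f2 u - (?f3 u + ?f4 u)))"
        by (rule integrable_norm Bochner_Integration.integrable_diff Bochner_Integration.integrable_add i1 i2 i3 i4)+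
      show "integrable M (\<lambda>u. (4 * (norm h)\<^sup>2) * norm (of_real (c u) * (of_real (c u) * w u) * of_real (exp (- c u * (y / 2)))))"
        using intB by (rule integrable_mult_right)
      fix u assume "u \<in> space M"
      \<comment> \<open>The increment of the exponent when \<open>\<tau>\<close> moves by
        \<open>h\<close>; the integrand of the remainder is
        \<open>w u * E \<tau> u * (exp \<zeta> - 1 - \<zeta>)\<close>.\<close>
      define \<zeta> where "\<zeta> = \<i> * of_real (a u * Re h) - of_real (c u * Im h)"
      have "?f1 u = ?f2 u * exp \<zeta>"
        unfolding E_def \<zeta>_def by (simp add: exp_add[symmetric] algebra_simps)
      moreover have "?f3 u + ?f4 u = ?f2 u * \<zeta>"
        unfolding \<zeta>_def by (simp add: algebra_simps)
      ultimately have eq: "?f1 u - ?f2 u - (?f3 u + ?f4 u) = ?f2 u * (exp \<zeta> - (1 + \<zeta>))"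
        by (simp add: algebra_simps)
      have n\<zeta>: "norm \<zeta> \<le> 2 * c u * norm h"
      proof -
        have "norm \<zeta> \<le> norm (\<i> * of_real (a u * Re h)) + norm (of_real (c u * Im h) :: complex)"
          unfolding \<zeta>_def by (rule norm_triangle_ineq4)
        also have "\<dots> = \<bar>a u\<bar> * \<bar>Re h\<bar> + c u * \<bar>Im h\<bar>"
          using c_nonneg[of u] by (simp only: norm_mult norm_of_real norm_ii abs_mult)
        also have "\<dots> \<le> c u * norm h + c u * norm h"
          by (intro add_mono mult_mono abs_a_le abs_Re_le_cmod abs_Im_le_cmod) (auto simp: c_nonneg)
        finally show ?thesis by (simp add: mult_ac)
      qed
      have re: "\<bar>Re \<zeta>\<bar> \<le> c u * (y / 2)"
      proof -
        have "\<bar>Re \<zeta>\<bar> = c u * \<bar>Im h\<bar>" using c_nonneg[of u] by (simp add: \<zeta>_def abs_mult)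
        also have "\<dots> \<le> c u * (y / 2)" using Imh y by (intro mult_left_mono c_nonneg) auto
        finally show ?thesis .
      qed
      have "norm (exp \<zeta> - (\<Sum>k\<le>1. \<zeta> ^ k / fact k)) \<le> exp \<bar>Re \<zeta>\<bar> * norm \<zeta> ^ Suc 1 / fact 1"
        by (rule Taylor_exp)
      hence "norm (exp \<zeta> - (1 + \<zeta>)) \<le> exp \<bar>Re \<zeta>\<bar> * (norm \<zeta>)\<^sup>2"
        by (simp add: power2_eq_square)
      also have "\<dots> \<le> exp (c u * (y / 2)) * (2 * c u * norm h)\<^sup>2"
        using re n\<zeta> by (intro mult_mono power_mono) auto
      finally have rem: "norm (exp \<zeta> - (1 + \<zeta>)) \<le> exp (c u * (y / 2)) * (2 * c u * norm h)\<^sup>2" .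
      have "norm (?f2 u) = norm (w u) * exp (- c u * y)"
        by (simp add: E_def norm_mult y_def)
      hence "norm (?f2 u * (exp \<zeta> - (1 + \<zeta>))) \<le>
          (norm (w u) * exp (- c u * y)) * (exp (c u * (y / 2)) * (2 * c u * norm h)\<^sup>2)"
        using rem by (simp only: norm_mult) (intro mult_left_mono, auto)
      also have "\<dots> = norm (w u) * (exp (- c u * y) * exp (c u * (y / 2))) * (2 * c u * norm h)\<^sup>2"
        by (simp add: algebra_simps)
      also have "exp (- c u * y) * exp (c u * (y / 2)) = exp (- c u * (y / 2))"
        by (simp add: exp_add [symmetric])
      finally show "norm (?f1 u - ?f2 u - (?f3 u + ?f4 u)) \<le>
          (4 * (norm h)\<^sup>2) * norm (of_real (c u) * (of_real (c u) * w u) * of_real (exp (- c u * (y / 2))))"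
        unfolding eq using c_nonneg[of u]
        by (simp add: norm_mult power2_eq_square algebra_simps)
    qed
    also have "\<dots> = 4 * B * (norm h)\<^sup>2"
      by (simp add: B_def)
    finally show ?thesis .
  qed
  have lin: "bounded_linear ?D"
    by (intro bounded_linear_intros bounded_linear_compose[OF bounded_linear_of_real bounded_linear_Re]
        bounded_linear_compose[OF bounded_linear_of_real bounded_linear_Im])
  show ?thesis
    unfolding has_derivative_at_alt
  proof (intro conjI allI impI lin)
    fix e :: real assume e: "e > 0"
    define d where "d = min (y / 4) (e / (4 * B + 1))"
    have d: "d > 0" using y e B0 by (auto simp: d_def)
    show "\<exists>d>0. \<forall>z. norm (z - \<tau>) < d \<longrightarrow> norm (?G z - ?G \<tau> - ?D (z - \<tau>)) \<le> e * norm (z - \<tau>)"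
    proof (intro exI[of _ d] conjI allI impI d)
      fix z assume z: "norm (z - \<tau>) < d"
      have "norm (?G z - ?G \<tau> - ?D (z - \<tau>)) \<le> 4 * B * (norm (z - \<tau>))\<^sup>2"
        using bound[of "z - \<tau>"] z by (auto simp: d_def)
      also have "\<dots> \<le> (4 * B + 1) * norm (z - \<tau>) * norm (z - \<tau>)"
        by (simp add: power2_eq_square algebra_simps)
      also have "\<dots> \<le> e * norm (z - \<tau>)"
      proof (rule mult_right_mono)
        have "norm (z - \<tau>) \<le> e / (4 * B + 1)" using z by (auto simp: d_def)
        thus "(4 * B + 1) * norm (z - \<tau>) \<le> e" using B0 by (simp add: field_simps)
      qed auto
      finally show "norm (?G z - ?G \<tau> - ?D (z - \<tau>)) \<le> e * norm (z - \<tau>)" .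
    qed
  qed
qed

end

text \<open>This is the characteristic function of the standard normal law after the substitution
  \<open>t + s * x\<close>. Completing the square turns the real part of \<open>\<beta>\<close> into
  the shift \<open>t\<close>, while the imaginary part becomes the frequency
  \<open>u\<close>.\<close>

lemma gaussian_integral_real:
  fixes z :: real and \<beta> :: complex
  assumes z: "z > 0"
  shows "has_bochner_integral lborel (\<lambda>x. exp (- of_real (pi * z * x\<^sup>2) + 2 * of_real pi * \<beta> * of_real x))
           (exp (of_real pi * \<beta>\<^sup>2 / of_real z) / of_real (sqrt z))"
proof -
  define s where "s = sqrt (2 * pi * z)"
  have s: "s > 0" "s\<^sup>2 = 2 * pi * z" using z by (auto simp: s_def)
  define u where "u = 2 * pi * Im \<beta> / s"
  define t where "t = - s * Re \<beta> / z"
  let ?e = "exp (of_real (pi * (Re \<beta>)\<^sup>2 / z) + \<i> * of_real (2 * pi * Re \<beta> * Im \<beta> / z))"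
  let ?f = "\<lambda>x. std_normal_density x *\<^sub>R exp (\<i> * of_real (u * x))"
  have int: "integrable lborel ?f"
  proof (rule Bochner_Integration.integrable_bound)
    show "integrable lborel std_normal_density"
      using integrable_std_normal_moment[of 0] by simp
    show "AE x in lborel. norm (?f x) \<le> norm (std_normal_density x)"
      by (auto simp: norm_mult)
  qed measurable
  have "char std_normal_distribution u = (LINT x|lborel. ?f x)"
    unfolding char_def by (subst integral_density) (auto simp: mult_ac)
  hence "has_bochner_integral lborel ?f (of_real (exp (- u\<^sup>2 / 2)))"
    using int by (simp add: has_bochner_integral_iff char_std_normal_distribution)
  hence "has_bochner_integral lborel (\<lambda>x. ?f (t + s * x)) (of_real (exp (- u\<^sup>2 / 2)) /\<^sub>R \<bar>s\<bar>)"
    using s lborel_has_bochner_integral_real_affine_iff[of s ?f _ t] by auto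
  hence H: "has_bochner_integral lborel
        (\<lambda>x. (of_real (sqrt (2 * pi)) * ?e)
             * ?f (t + s * x))
       ((of_real (sqrt (2 * pi)) * ?e)
           * (of_real (exp (- u\<^sup>2 / 2)) /\<^sub>R \<bar>s\<bar>))"
    by (rule has_bochner_integral_mult_right)
  have us: "u * s = 2 * pi * Im \<beta>" using s by (simp add: u_def)
  have ut: "u * t = - 2 * pi * Re \<beta> * Im \<beta> / z" using s by (simp add: u_def t_def)
  have st: "s * t = - 2 * pi * Re \<beta>" 
  proof -
    have "s * t = - s\<^sup>2 * Re \<beta> / z" by (simp add: t_def power2_eq_square)
    thus ?thesis using z by (simp add: s)
  qed
  have tt: "t\<^sup>2 = 2 * pi * (Re \<beta>)\<^sup>2 / z"
    using s z by (simp add: t_def power_divide power_mult_distrib) (simp add: power2_eq_square)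
  have uu: "u\<^sup>2 / 2 = pi * (Im \<beta>)\<^sup>2 / z"
    using s z by (simp add: u_def power_divide power_mult_distrib) (simp add: power2_eq_square)
  have fun_eq: "(of_real (sqrt (2 * pi)) * ?e)
             * ?f (t + s * x) = exp (- of_real (pi * z * x\<^sup>2) + 2 * of_real pi * \<beta> * of_real x)" for x
  proof -
    have e1: "(t + s * x)\<^sup>2 / 2 = pi * (Re \<beta>)\<^sup>2 / z - 2 * pi * Re \<beta> * x + pi * z * x\<^sup>2"
    proof -
      have "(t + s * x)\<^sup>2 = t\<^sup>2 + 2 * (s * t) * x + s\<^sup>2 * x\<^sup>2"
        by (simp add: power2_eq_square algebra_simps)
      thus ?thesis by (simp add: st tt s add_divide_distrib)
    qed
    have e2: "u * (t + s * x) = - 2 * pi * Re \<beta> * Im \<beta> / z + 2 * pi * Im \<beta> * x"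
      using us ut by (simp add: distrib_left mult.assoc[symmetric])
    have "std_normal_density (t + s * x) = exp (- ((t + s * x)\<^sup>2 / 2)) / sqrt (2 * pi)"
      by (simp add: std_normal_density_def)
    hence "?f (t + s * x) = exp (of_real (- ((t + s * x)\<^sup>2 / 2)) + \<i> * of_real (u * (t + s * x))) / of_real (sqrt (2 * pi))"
      unfolding exp_add by (simp add: scaleR_conv_of_real exp_of_real[symmetric])
    hence "(of_real (sqrt (2 * pi)) * ?e)
             * ?f (t + s * x) = ?e
             * exp (of_real (- ((t + s * x)\<^sup>2 / 2)) + \<i> * of_real (u * (t + s * x)))"
      by simp
    also have "\<dots> = exp (of_real (pi * (Re \<beta>)\<^sup>2 / z) + \<i> * of_real (2 * pi * Re \<beta> * Im \<beta> / z)
             + (of_real (- ((t + s * x)\<^sup>2 / 2)) + \<i> * of_real (u * (t + s * x))))"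
      by (simp add: exp_add)
    also have "\<dots> = exp (- of_real (pi * z * x\<^sup>2) + 2 * of_real pi * \<beta> * of_real x)"
      unfolding e1 e2 by (rule arg_cong[where f = exp]) (simp add: complex_eq_iff)
    finally show ?thesis .
  qed
  have val: "(of_real (sqrt (2 * pi)) * ?e)
           * (of_real (exp (- u\<^sup>2 / 2)) /\<^sub>R \<bar>s\<bar>) = exp (of_real pi * \<beta>\<^sup>2 / of_real z) / of_real (sqrt z)"
  proof -
    have "s = sqrt (2 * pi) * sqrt z" by (simp add: s_def real_sqrt_mult)
    hence A: "of_real (sqrt (2 * pi)) * (X * (Y /\<^sub>R \<bar>s\<bar>)) = X * Y / of_real (sqrt z)" for X Y :: complex
      using s(1) by (simp add: scaleR_conv_of_real divide_simps)
    have B: "?e * of_real (exp (- u\<^sup>2 / 2))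
       = exp (of_real pi * \<beta>\<^sup>2 / of_real z)"
    proof -
      have "?e * of_real (exp (- u\<^sup>2 / 2))
        = exp (of_real (pi * (Re \<beta>)\<^sup>2 / z) + \<i> * of_real (2 * pi * Re \<beta> * Im \<beta> / z) + of_real (- (u\<^sup>2 / 2)))"
        unfolding exp_add by (simp add: exp_of_real[symmetric])
      also have "of_real (pi * (Re \<beta>)\<^sup>2 / z) + \<i> * of_real (2 * pi * Re \<beta> * Im \<beta> / z) + of_real (- (u\<^sup>2 / 2))
          = of_real pi * \<beta>\<^sup>2 / of_real z"
        unfolding uu by (simp add: complex_eq_iff power2_eq_square diff_divide_distrib[symmetric] add_divide_distrib[symmetric] algebra_simps)
      finally show ?thesis .
    qed
    show ?thesis by (subst mult.assoc, subst A, subst B, rule refl)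
  qed
  show ?thesis using H unfolding fun_eq val .
qed

lemma integrable_complex_gaussian:
  assumes "Re z > 0"
  shows "integrable lborel (\<lambda>x. exp (- of_real pi * z * of_real (x\<^sup>2) + 2 * of_real pi * \<beta> * of_real x))"
proof (rule Bochner_Integration.integrable_bound)
  show "integrable lborel (\<lambda>x. exp (- of_real (pi * Re z * x\<^sup>2) + 2 * of_real pi * \<beta> * of_real x))"
    by (rule gaussian_integral_real[OF assms, of \<beta>, unfolded has_bochner_integral_iff, THEN conjunct1])
  show "AE x in lborel. norm (exp (- of_real pi * z * of_real (x\<^sup>2) + 2 * of_real pi * \<beta> * of_real x))
      \<le> norm (exp (- of_real (pi * Re z * x\<^sup>2) + 2 * of_real pi * \<beta> * of_real x))"
    by (auto simp: Re_power2)
qed measurable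

text \<open>Both sides are holomorphic in the right half-plane and agree on the positive axis. The
  integral is \<open>osc_laplace\<close> at \<open>\<i> * z\<close> with both exponents equal to
  \<open>pi * x^2\<close>; equality of the exponents makes its real derivative complex
  linear.\<close>

lemma gaussian_integral_complex:
  assumes "Re z > 0"
  shows "(LINT x|lborel. exp (- of_real pi * z * of_real (x\<^sup>2) + 2 * of_real pi * \<beta> * of_real x))
       = exp (of_real pi * \<beta>\<^sup>2 / z) / csqrt z"
proof -
  define w where "w = (\<lambda>x::real. exp (2 * of_real pi * \<beta> * of_real x))"
  define cc where "cc = (\<lambda>x::real. pi * x\<^sup>2)"
  interpret osc_laplace_exponents lborel cc cc
    by standard (auto simp: cc_def)
  have ad: "admissible w"
    unfolding admissible_def
  proof (intro conjI allI impI)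
    show "w \<in> borel_measurable lborel" unfolding w_def by measurable
    fix y :: real assume "y > 0"
    hence y: "Re (of_real y) > 0" by simp
    have eq: "w u * of_real (exp (- cc u * y))
        = exp (- of_real pi * of_real y * of_real (u\<^sup>2) + 2 * of_real pi * \<beta> * of_real u)" for u
      unfolding w_def cc_def exp_of_real[symmetric] exp_add[symmetric]
      by (rule arg_cong[where f = exp]) simp
    show "integrable lborel (\<lambda>u. w u * of_real (exp (- cc u * y)))"
      unfolding eq by (rule integrable_complex_gaussian[OF y])
  qed
  define G where "G = (\<lambda>z. osc_laplace lborel cc cc w (\<i> * z))"
  have G_eq: "G z = (LINT x|lborel. exp (- of_real pi * z * of_real (x\<^sup>2) + 2 * of_real pi * \<beta> * of_real x))" for z
    unfolding G_def osc_laplace_def w_def cc_def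
    by (rule Bochner_Integration.integral_cong[OF refl], unfold exp_add[symmetric], rule arg_cong[where f = exp]) (simp add: complex_eq_iff)
  define S where "S = {z. Re z > 0}"
  have S: "open S" "connected S" unfolding S_def
    by (auto simp: open_halfspace_Re_gt convex_halfspace_Re_gt intro!: convex_connected)
  have holG: "G holomorphic_on S"
  proof (rule holomorphic_onI)
    fix z assume "z \<in> S"
    hence im: "Im (\<i> * z) > 0" by (simp add: S_def)
    define D where "D = osc_laplace lborel cc cc (\<lambda>u. of_real (cc u) * w u) (\<i> * z)"
    have a: "osc_laplace lborel cc cc (\<lambda>u. \<i> * of_real (cc u) * w u) (\<i> * z) = \<i> * D"
      unfolding D_def osc_laplace_def mult.assoc by (rule integral_mult_right_zero)
    have c: "osc_laplace lborel cc cc (\<lambda>u. - of_real (cc u) * w u) (\<i> * z) = - D"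
      unfolding D_def osc_laplace_def by simp
    have eq: "(\<lambda>h. of_real (Re h) * osc_laplace lborel cc cc (\<lambda>u. \<i> * of_real (cc u) * w u) (\<i> * z)
       + of_real (Im h) * osc_laplace lborel cc cc (\<lambda>u. - of_real (cc u) * w u) (\<i> * z)) = (*) (\<i> * D)"
      unfolding a c by (rule ext) (simp add: complex_eq_iff algebra_simps)
    have "(osc_laplace lborel cc cc w has_field_derivative (\<i> * D)) (at (\<i> * z))"
      using osc_laplace_has_derivative[OF ad im] unfolding eq has_field_derivative_def .
    moreover have "((*) \<i> has_field_derivative \<i>) (at z)"
      by (metis DERIV_cmult_Id)
    ultimately have "(G has_field_derivative (\<i> * D) * \<i>) (at z)"
      unfolding G_def by (rule DERIV_chain2)
    thus "G field_differentiable at z within S"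
      using field_differentiable_at_within field_differentiable_def by blast
  qed
  define H where "H = (\<lambda>z. exp (of_real pi * \<beta>\<^sup>2 / z) / csqrt z)"
  have holH: "H holomorphic_on S"
    unfolding H_def
  proof (rule holomorphic_on_divide)
    show "(\<lambda>z. exp (of_real pi * \<beta>\<^sup>2 / z)) holomorphic_on S"
      by (intro holomorphic_intros) (auto simp: S_def)
    show "csqrt holomorphic_on S"
      by (rule holomorphic_on_csqrt') (auto simp: S_def complex_nonpos_Reals_iff intro!: holomorphic_intros)
  qed (auto simp: S_def)
  have real: "G (of_real x) = H (of_real x)" if "x > 0" for x
    using gaussian_integral_real[OF that, of \<beta>] that
    unfolding G_eq H_def has_bochner_integral_iff by (simp add: mult.assoc)
  have "G z - H z = 0"
  proof (rule analytic_continuation[of "\<lambda>z. G z - H z" S "of_real ` {0<..}" 1])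
    show "(\<lambda>z. G z - H z) holomorphic_on S" using holG holH by (intro holomorphic_intros)
    show "(1::complex) islimpt of_real ` {0<..}"
    proof -
      have "(\<lambda>n. of_real (1 + inverse (real (Suc n))) :: complex) \<longlonglongrightarrow> of_real (1 + 0)"
        by (intro tendsto_intros LIMSEQ_inverse_real_of_nat)
      thus ?thesis
        unfolding islimpt_sequential
      proof (intro exI[of _ "\<lambda>n. of_real (1 + inverse (real (Suc n))) :: complex"] conjI allI)
        fix n
        have "1 + inverse (real (Suc n)) > 0" by (intro add_pos_pos) auto
        hence "of_real (1 + inverse (real (Suc n))) \<in> complex_of_real ` {0<..}"
          by (intro imageI) simp
        moreover have "inverse (real (Suc n)) \<noteq> 0" by simp
        hence "of_real (1 + inverse (real (Suc n))) \<noteq> complex_of_real 1"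
          unfolding of_real_eq_iff by linarith
        ultimately show "of_real (1 + inverse (real (Suc n))) \<in> complex_of_real ` {0<..} - {1}"
          by simp
      qed simp_all
    qed
    show "\<And>z. z \<in> of_real ` {0<..} \<Longrightarrow> G z - H z = 0" using real by auto
    show "complex_of_real ` {0<..} \<subseteq> S" by (auto simp: S_def)
    show "1 \<in> S" "z \<in> S" using assms by (simp_all add: S_def)
  qed (fact S)+
  thus ?thesis by (simp add: G_eq H_def)
qed

subsection \<open>Poisson summation for Gaussians\<close>

text \<open>The property to be established for the difference between a periodised Gaussian and its
  expected Fourier series. Together with equal end values it forces the function to vanish.\<close>

definition fourier_null :: "(real \<Rightarrow> complex) \<Rightarrow> bool" where
  "fourier_null h \<longleftrightarrow> continuous_on {0..1} h \<and>
     (\<forall>k::int. integral {0..1} (\<lambda>s. h s * cis (2 * pi * of_int k * s)) = 0)"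

lemma fourier_null_add:
  assumes "fourier_null f" "fourier_null g"
  shows "fourier_null (\<lambda>s. f s + g s)"
proof -
  have "integral {0..1} (\<lambda>s. (f s + g s) * cis (2 * pi * of_int k * s)) = 0" for k
  proof -
    have "(\<lambda>s. f s * cis (2 * pi * of_int k * s)) integrable_on {0..1}"
      "(\<lambda>s. g s * cis (2 * pi * of_int k * s)) integrable_on {0..1}"
      using assms unfolding fourier_null_def
      by (auto intro!: integrable_continuous_real continuous_intros)
    from Henstock_Kurzweil_Integration.integral_add[OF this] show ?thesis
      using assms by (simp add: fourier_null_def distrib_right)
  qed
  thus ?thesis using assms unfolding fourier_null_def by (auto intro!: continuous_intros)
qed

lemma fourier_null_cmult:
  assumes "fourier_null f"
  shows "fourier_null (\<lambda>s. c * f s)"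
  using assms unfolding fourier_null_def
  by (auto intro!: continuous_intros simp: mult.assoc)

lemma fourier_null_shift:
  assumes "fourier_null f"
  shows "fourier_null (\<lambda>s. cis (2 * pi * of_int l * s) * f s)"
proof -
  have "integral {0..1} (\<lambda>s. (cis (2 * pi * of_int l * s) * f s) * cis (2 * pi * of_int k * s)) = 0" for k
  proof -
    have "(\<lambda>s. (cis (2 * pi * of_int l * s) * f s) * cis (2 * pi * of_int k * s)) =
      (\<lambda>s. f s * cis (2 * pi * of_int (l + k) * s))"
      by (rule ext) (simp add: cis_mult[symmetric] distrib_left distrib_right mult_ac)
    thus ?thesis using assms unfolding fourier_null_def by (simp del: of_int_add)
  qed
  thus ?thesis using assms unfolding fourier_null_def by (auto intro!: continuous_intros)
qed

text \<open>Keeping \<open>f\<close> arbitrary makes the product case of the induction a composition.\<close>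
lemma fourier_null_real_polynomial:
  assumes "real_polynomial_function p" "fourier_null f"
  shows "fourier_null (\<lambda>s. of_real (p (cis (2 * pi * s))) * f s)"
  using assms
proof (induction arbitrary: f)
  case (linear p)
  interpret bounded_linear p by fact
  have p: "p z = Re z * p 1 + Im z * p \<i>" for z
  proof -
    have "z = Re z *\<^sub>R 1 + Im z *\<^sub>R \<i>" by (simp add: complex_eq_iff)
    hence "p z = p (Re z *\<^sub>R 1 + Im z *\<^sub>R \<i>)" by simp
    thus ?thesis by (simp only: add scaleR) simp
  qed
  \<comment> \<open>A real-linear \<open>p\<close> is a complex combination of \<open>z\<close> and
    its conjugate, and these are the characters of index 1 and -1 on the circle.\<close>
  have "fourier_null (\<lambda>s. ((of_real (p 1) - \<i> * of_real (p \<i>)) / 2) * (cis (2 * pi * of_int 1 * s) * f s)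
     + ((of_real (p 1) + \<i> * of_real (p \<i>)) / 2) * (cis (2 * pi * of_int (- 1) * s) * f s))"
    by (intro fourier_null_add fourier_null_cmult fourier_null_shift linear.prems)
  moreover have "((of_real (p 1) - \<i> * of_real (p \<i>)) / 2) * (cis (2 * pi * of_int 1 * s) * f s)
     + ((of_real (p 1) + \<i> * of_real (p \<i>)) / 2) * (cis (2 * pi * of_int (- 1) * s) * f s)
     = of_real (p (cis (2 * pi * s))) * f s" for s
  proof -
    have "((of_real (p 1) - \<i> * of_real (p \<i>)) / 2) * cis (2 * pi * s)
     + ((of_real (p 1) + \<i> * of_real (p \<i>)) / 2) * cis (- (2 * pi * s)) = of_real (p (cis (2 * pi * s)))"
      unfolding p[of "cis (2 * pi * s)"] by (simp add: complex_eq_iff field_simps)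
    from this[symmetric] show ?thesis by (simp add: ring_distribs mult.assoc)
  qed
  ultimately show ?case by simp
next
  case (const c)
  then show ?case using fourier_null_cmult[of f "of_real c"] by simp
next
  case (add p q)
  then show ?case using fourier_null_add[OF add.IH(1) add.IH(2), of f f] by (simp add: distrib_right)
next
  case (mult p q)
  then show ?case using mult.IH(1)[OF mult.IH(2)[OF mult.prems]] by (simp add: mult.assoc)
qed

text \<open>By Stone-Weierstrass the conjugate of \<open>h\<close>, seen as a function on the
  circle, is a uniform limit of polynomials in the coordinates. Each of these integrates to zero
  against \<open>h\<close>, hence so does the conjugate itself, and the integral of
  \<open>\<bar>h\<bar>^2\<close> vanishes.\<close>

lemma fourier_null_imp_zero:
  assumes h: "fourier_null h" and per: "h 0 = h 1" and s: "s \<in> {0..1}"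
  shows "h s = 0"
proof -
  have cont: "continuous_on {0..1} h" using h by (simp add: fourier_null_def)
  \<comment> \<open>The homotopy of the loop with itself carries no content; it is the route to
    continuity of the loop transported to the circle by \<open>Arg2pi\<close>.\<close>
  have "homotopic_loops UNIV (\<lambda>s. cnj (h s)) (\<lambda>s. cnj (h s))"
    unfolding homotopic_loops_refl using per cont
    by (auto simp: path_def pathfinish_def pathstart_def intro!: continuous_intros)
  from homotopic_loops_imp_homotopic_circlemaps[OF this]
  have contH: "continuous_on (sphere 0 1) (\<lambda>z. cnj (h (Arg2pi z / (2 * pi))))"
    using homotopic_with_imp_continuous by (fastforce simp: o_def)
  have "bounded (h ` {0..1})"
    by (intro compact_imp_bounded compact_continuous_image cont compact_Icc)
  then obtain B where "\<forall>x\<in>h ` {0..1}. norm x \<le> B"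
    unfolding bounded_iff by blast
  hence B: "\<And>s. s \<in> {0..1} \<Longrightarrow> norm (h s) \<le> B" by auto
  have B0: "B \<ge> 0" using B[of 0] norm_ge_zero[of "h 0"] by (auto simp del: norm_ge_zero)
  have "norm (integral {0..1} (\<lambda>s. h s * cnj (h s))) \<le> e" if e: "e > 0" for e
  proof -
    define d where "d = e / (B + 1)"
    have d: "d > 0" using e B0 by (auto simp: d_def)
    from Stone_Weierstrass_polynomial_function[OF compact_sphere contH d]
    obtain g where g: "polynomial_function g"
      and gd: "\<And>z. z \<in> sphere 0 1 \<Longrightarrow> norm (cnj (h (Arg2pi z / (2 * pi))) - g z) < d" by blast
    have gs: "norm (cnj (h s) - g (cis (2 * pi * s))) \<le> d" if "s \<in> {0..1}" for s
    proof (cases "s = 1")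
      \<comment> \<open>At \<open>s = 1\<close> the argument jumps back to 0, so the approximation
        concerns \<open>h 0\<close>; the equal end values close the gap.\<close>
      case True
      have "Arg2pi 1 = 0" by (intro Arg2pi_unique[of 1]) auto
      thus ?thesis using gd[of 1] per True by auto
    next
      case False
      hence "Arg2pi (cis (2 * pi * s)) = 2 * pi * s"
        using that by (intro Arg2pi_unique[of 1]) (auto simp: cis_conv_exp)
      thus ?thesis using gd[of "cis (2 * pi * s)"] by auto
    qed
    have "real_polynomial_function (\<lambda>z. Re (g z))" "real_polynomial_function (\<lambda>z. Im (g z))"
      using g bounded_linear_Re bounded_linear_Im unfolding polynomial_function_def o_def by blast+
    hence "fourier_null (\<lambda>s. of_real (Re (g (cis (2 * pi * s)))) * h s)"
       "fourier_null (\<lambda>s. of_real (Im (g (cis (2 * pi * s)))) * h s)"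
      by (auto intro: fourier_null_real_polynomial[OF _ h])
    hence "fourier_null (\<lambda>s. of_real (Re (g (cis (2 * pi * s)))) * h s + \<i> * (of_real (Im (g (cis (2 * pi * s)))) * h s))"
      by (intro fourier_null_add fourier_null_cmult)
    moreover have "(\<lambda>s. of_real (Re (g (cis (2 * pi * s)))) * h s + \<i> * (of_real (Im (g (cis (2 * pi * s)))) * h s))
      = (\<lambda>s. h s * g (cis (2 * pi * s)))"
      by (rule ext) (simp add: complex_eq_iff)
    ultimately have gn: "fourier_null (\<lambda>s. h s * g (cis (2 * pi * s)))" by simp
    hence g0: "integral {0..1} (\<lambda>s. h s * g (cis (2 * pi * s))) = 0"
      and gc: "continuous_on {0..1} (\<lambda>s. h s * g (cis (2 * pi * s)))"
      unfolding fourier_null_def by (auto dest: spec[of _ 0])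
    have "integral {0..1} (\<lambda>s. h s * cnj (h s)) =
        integral {0..1} (\<lambda>s. h s * cnj (h s)) - integral {0..1} (\<lambda>s. h s * g (cis (2 * pi * s)))"
      by (simp add: g0)
    also have "\<dots> = integral {0..1} (\<lambda>s. h s * cnj (h s) - h s * g (cis (2 * pi * s)))"
      by (rule Henstock_Kurzweil_Integration.integral_diff[symmetric])
         (auto intro!: integrable_continuous_real gc continuous_intros cont)
    finally have eq: "integral {0..1} (\<lambda>s. h s * cnj (h s)) =
        integral {0..1} (\<lambda>s. h s * cnj (h s) - h s * g (cis (2 * pi * s)))" .
    have "norm (integral {0..1} (\<lambda>s. h s * cnj (h s) - h s * g (cis (2 * pi * s)))) \<le> B * d * (1 - 0)"
    proof (rule integral_bound)
      show "continuous_on {0..1} (\<lambda>s. h s * cnj (h s) - h s * g (cis (2 * pi * s)))"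
        by (intro continuous_intros gc cont)
      fix s :: real assume s: "s \<in> {0..1}"
      have "norm (h s * cnj (h s) - h s * g (cis (2 * pi * s))) = norm (h s) * norm (cnj (h s) - g (cis (2 * pi * s)))"
        by (simp add: right_diff_distrib[symmetric] norm_mult)
      also have "\<dots> \<le> B * d" using B[OF s] gs[OF s] B0 by (intro mult_mono) auto
      finally show "norm (h s * cnj (h s) - h s * g (cis (2 * pi * s))) \<le> B * d" .
    qed auto
    also have "B * d * (1 - 0) \<le> e" using e B0 unfolding d_def by (simp add: field_simps)
    finally show ?thesis unfolding eq .
  qed
  hence "norm (integral {0..1} (\<lambda>s. h s * cnj (h s))) \<le> 0"
    by (rule field_le_epsilon[where y = 0, simplified])
  hence "integral {0..1} (\<lambda>s. of_real ((norm (h s))\<^sup>2)) = (0 :: complex)"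
    by (simp only: complex_norm_square norm_le_zero_iff)
  moreover have hi: "((\<lambda>s. (norm (h s))\<^sup>2) has_integral integral {0..1} (\<lambda>s. (norm (h s))\<^sup>2)) {0..1}"
    by (intro integrable_integral integrable_continuous_real continuous_intros cont)
  hence "((\<lambda>s. complex_of_real ((norm (h s))\<^sup>2)) has_integral of_real (integral {0..1} (\<lambda>s. (norm (h s))\<^sup>2))) {0..1}"
    by (rule has_integral_of_real)
  ultimately have "integral {0..1} (\<lambda>s. (norm (h s))\<^sup>2) = 0"
    by (metis integral_unique of_real_eq_0_iff)
  hence "((\<lambda>s. (norm (h s))\<^sup>2) has_integral 0) (cbox 0 1)"
    using hi by simp
  hence "(norm (h s))\<^sup>2 = 0"
    using s cont by (intro has_integral_0_cbox_imp_0[of 0 1 "\<lambda>s. (norm (h s))\<^sup>2"]) (auto intro!: continuous_intros)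
  thus ?thesis by simp
qed

text \<open>The Weierstrass test along the filter of finite subsets, so that index sets such as
  pairs of integers need no enumeration.\<close>

lemma integral_infsum_uniform:
  fixes f :: "'i \<Rightarrow> real \<Rightarrow> complex"
  assumes cont: "\<And>i. i \<in> I \<Longrightarrow> continuous_on {a..b} (f i)"
    and bound: "\<And>i s. i \<in> I \<Longrightarrow> s \<in> {a..b} \<Longrightarrow> norm (f i s) \<le> M i"
    and M: "M summable_on I"
  shows continuous_on_infsum_uniform: "continuous_on {a..b} (\<lambda>s. \<Sum>\<^sub>\<infinity>i\<in>I. f i s)"
    and has_sum_integral_uniform:
      "((\<lambda>i. integral {a..b} (f i)) has_sum integral {a..b} (\<lambda>s. \<Sum>\<^sub>\<infinity>i\<in>I. f i s)) I"
proof -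
  have ul: "uniform_limit {a..b} (\<lambda>X s. \<Sum>i\<in>X. f i s) (\<lambda>s. \<Sum>\<^sub>\<infinity>i\<in>I. f i s) (finite_subsets_at_top I)"
    using bound M by (rule Weierstrass_m_test_general)
  have ev: "\<forall>\<^sub>F X in finite_subsets_at_top I. continuous_on {a..b} (\<lambda>s. \<Sum>i\<in>X. f i s)"
    using cont by (intro eventually_finite_subsets_at_top_weakI continuous_intros) auto
  show "continuous_on {a..b} (\<lambda>s. \<Sum>\<^sub>\<infinity>i\<in>I. f i s)"
    using ev ul by (rule uniform_limit_theorem) simp
  \<comment> \<open>Intersecting with \<open>I\<close> makes the partial sums continuous for every
    \<open>X\<close> and not only eventually, the form in which
    \<open>uniform_limit_integral\<close> is applied.\<close>
  define F where "F = (\<lambda>X s. \<Sum>i\<in>X \<inter> I. f i s)"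
  have "uniform_limit {a..b} F (\<lambda>s. \<Sum>\<^sub>\<infinity>i\<in>I. f i s) (finite_subsets_at_top I)"
    using ul
  proof (rule uniform_limit_cong[THEN iffD1, rotated 2])
    show "\<forall>\<^sub>F X in finite_subsets_at_top I. \<forall>s\<in>{a..b}. (\<Sum>i\<in>X. f i s) = F X s"
      by (intro eventually_finite_subsets_at_top_weakI) (auto simp: F_def Int_absorb2)
  qed simp
  moreover have "continuous_on {a..b} (F X)" for X
    unfolding F_def using cont by (intro continuous_intros) auto
  ultimately obtain K J where KJ: "\<And>X. (F X has_integral K X) {a..b}"
      "((\<lambda>s. \<Sum>\<^sub>\<infinity>i\<in>I. f i s) has_integral J) {a..b}" "(K \<longlongrightarrow> J) (finite_subsets_at_top I)"
    by (rule uniform_limit_integral) auto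
  have "\<forall>\<^sub>F X in finite_subsets_at_top I. K X = (\<Sum>i\<in>X. integral {a..b} (f i))"
  proof (intro eventually_finite_subsets_at_top_weakI)
    fix X assume X: "finite X" "X \<subseteq> I"
    have "K X = integral {a..b} (F X)" using KJ(1)[of X] by (simp add: integral_unique)
    also have "\<dots> = integral {a..b} (\<lambda>s. \<Sum>i\<in>X. f i s)"
      using X by (simp add: F_def Int_absorb2)
    also have "\<dots> = (\<Sum>i\<in>X. integral {a..b} (f i))"
      using X cont by (intro Henstock_Kurzweil_Integration.integral_sum integrable_continuous_real) auto
    finally show "K X = (\<Sum>i\<in>X. integral {a..b} (f i))" .
  qed
  hence "((\<lambda>X. \<Sum>i\<in>X. integral {a..b} (f i)) \<longlongrightarrow> J) (finite_subsets_at_top I)"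
    using KJ(3) by (rule Lim_transform_eventually[rotated])
  thus "((\<lambda>i. integral {a..b} (f i)) has_sum integral {a..b} (\<lambda>s. \<Sum>\<^sub>\<infinity>i\<in>I. f i s)) I"
    using KJ(2) by (simp add: has_sum_def integral_unique)
qed

text \<open>Passage from the Lebesgue integral over the line to gauge integrals over compact
  intervals, where tiling and the fundamental theorem of calculus are available.\<close>

lemma integral_symmetric_tendsto_lborel:
  fixes g :: "real \<Rightarrow> complex"
  assumes int: "integrable lborel g"
  shows "(\<lambda>N. integral {- real N..real N} g) \<longlonglongrightarrow> (LINT x|lborel. g x)"
proof -
  have [measurable]: "g \<in> borel_measurable lborel" using int by auto
  have "(\<lambda>N. LINT x|lborel. indicator {- real N..real N} x *\<^sub>R g x) \<longlonglongrightarrow> (LINT x|lborel. g x)"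
  proof (rule integral_dominated_convergence[where w = "\<lambda>x. norm (g x)"])
    show "AE x in lborel. (\<lambda>N. indicator {- real N..real N} x *\<^sub>R g x) \<longlonglongrightarrow> g x"
    proof (rule AE_I2)
      fix x :: real
      obtain N where N: "\<bar>x\<bar> \<le> real N" using real_arch_simple by blast
      have "\<forall>\<^sub>F n in sequentially. indicator {- real n..real n} x *\<^sub>R g x = g x"
        using eventually_ge_at_top[of N]
      proof eventually_elim
        case (elim n)
        hence "real N \<le> real n" by simp
        hence "x \<in> {- real n..real n}" using N by (simp add: abs_le_iff)
        thus ?case by simp
      qed
      thus "(\<lambda>N. indicator {- real N..real N} x *\<^sub>R g x) \<longlonglongrightarrow> g x"
        by (rule tendsto_eventually)
    qed
  qed (use int in \<open>auto split: split_indicator\<close>)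
  moreover have "(LINT x|lborel. indicator {- real N..real N} x *\<^sub>R g x) = integral {- real N..real N} g" for N
  proof -
    have "set_integrable lborel {- real N..real N} g"
      unfolding set_integrable_def by (rule integrable_mult_indicator[OF _ int]) simp
    from set_borel_integral_eq_integral(2)[OF this] show ?thesis
      by (simp add: set_lebesgue_integral_def)
  qed
  ultimately show ?thesis by simp
qed

text \<open>The unit intervals starting at the integers in \<open>{- N..<N}\<close> tile
  \<open>{- N..N}\<close>, and an unordered sum may be evaluated along this particular chain of
  finite sets.\<close>

lemma integral_periodization:
  fixes g :: "real \<Rightarrow> complex"
  assumes cont: "continuous_on UNIV g" and int: "integrable lborel g"
    and bd: "\<And>n s. s \<in> {0..1} \<Longrightarrow> norm (g (of_int n + s)) \<le> M n"
    and M: "M summable_on (UNIV :: int set)"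
  shows "integral {0..1} (\<lambda>s. \<Sum>\<^sub>\<infinity>n. g (of_int n + s)) = (LINT x|lborel. g x)"
proof -
  have cg: "continuous_on S g" for S using cont continuous_on_subset by blast
  have ig: "g integrable_on {a..b}" for a b by (intro integrable_continuous_real cg)
  have hs: "((\<lambda>n. integral {0..1} (\<lambda>s. g (of_int n + s))) has_sum
      integral {0..1} (\<lambda>s. \<Sum>\<^sub>\<infinity>n. g (of_int n + s))) (UNIV :: int set)"
    by (rule has_sum_integral_uniform[where M = M])
       (use bd M in \<open>auto intro!: continuous_intros continuous_on_compose2[OF cont]\<close>)
  have fl: "filterlim (\<lambda>N. {- int N..<int N}) (finite_subsets_at_top UNIV) sequentially"
    unfolding filterlim_finite_subsets_at_top
  proof (intro allI impI)
    fix X :: "int set" assume "finite X \<and> X \<subseteq> UNIV"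
    hence X: "finite X" by simp
    define N where "N = nat (Max (insert 0 (abs ` X))) + 1"
    have "\<bar>x\<bar> < int N" if "x \<in> X" for x
    proof -
      have "\<bar>x\<bar> \<le> Max (insert 0 (abs ` X))" using X that by (intro Max_ge) auto
      thus ?thesis unfolding N_def by linarith
    qed
    hence XN: "X \<subseteq> {- int N..<int N}" by fastforce
    show "\<forall>\<^sub>F n in sequentially. finite {- int n..<int n} \<and> X \<subseteq> {- int n..<int n} \<and> {- int n..<int n} \<subseteq> UNIV"
      using eventually_ge_at_top[of N] by eventually_elim (use XN in auto)
  qed
  have "(\<lambda>N. \<Sum>n\<in>{- int N..<int N}. integral {0..1} (\<lambda>s. g (of_int n + s)))
      \<longlonglongrightarrow> integral {0..1} (\<lambda>s. \<Sum>\<^sub>\<infinity>n. g (of_int n + s))"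
    using hs unfolding has_sum_def by (rule filterlim_compose[OF _ fl])
  moreover have "(\<Sum>n\<in>{- int N..<int N}. integral {0..1} (\<lambda>s. g (of_int n + s))) = integral {- real N..real N} g" for N
  proof (induction N)
    case (Suc N)
    have shift: "integral {0..1} (\<lambda>s. g (of_int n + s)) = integral {of_int n..of_int n + 1} g" for n :: int
    proof -
      have "((\<lambda>x. g x) has_integral integral {of_int n..of_int n + 1} g) (cbox (of_int n) (of_int n + 1))"
        using ig by (simp add: integrable_integral)
      from has_integral_affinity'[OF this, of 1 "of_int n"] show ?thesis
        by (simp add: add.commute integral_unique)
    qed
    have "{- int (Suc N)..<int (Suc N)} = insert (int N) (insert (- int N - 1) {- int N..<int N})" by auto
    hence "(\<Sum>n\<in>{- int (Suc N)..<int (Suc N)}. integral {0..1} (\<lambda>s. g (of_int n + s)))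
      = integral {real N..real N + 1} g + (integral {- real N - 1..- real N} g + integral {- real N..real N} g)"
      using Suc by (simp add: shift)
    also have "integral {- real N - 1..- real N} g + integral {- real N..real N} g = integral {- real N - 1..real N} g"
      by (rule Henstock_Kurzweil_Integration.integral_combine) (auto intro: ig)
    also have "integral {real N..real N + 1} g + integral {- real N - 1..real N} g = integral {- real N - 1..real N + 1} g"
      by (subst add.commute, rule Henstock_Kurzweil_Integration.integral_combine) (auto intro: ig)
    also have "{- real N - 1..real N + 1} = {- real (Suc N)..real (Suc N)}" by (simp add: algebra_simps)
    finally show ?case .
  qed simp
  ultimately show ?thesis
    using integral_symmetric_tendsto_lborel[OF int] LIMSEQ_unique by simp
qed

section \<open>Gaussian bounds and convergence over the integers\<close>

lemma summable_on_int_split: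
  fixes f :: "int \<Rightarrow> 'a :: banach"
  assumes "(\<lambda>n. f (int n)) summable_on UNIV" "(\<lambda>n. f (- 1 - int n)) summable_on UNIV"
  shows "f summable_on UNIV"
proof -
  have "f summable_on range int"
    using assms(1) by (subst summable_on_reindex) (auto simp: o_def inj_on_def)
  moreover have "f summable_on range (\<lambda>n. - 1 - int n)"
    using assms(2) by (subst summable_on_reindex) (auto simp: o_def inj_on_def)
  ultimately have "f summable_on (range int \<union> range (\<lambda>n. - 1 - int n))"
    by (rule summable_on_Un_disjoint) auto
  moreover have "x \<in> range int \<union> range (\<lambda>n. - 1 - int n)" for x
  proof (cases "x \<ge> 0")
    case True
    thus ?thesis by (intro UnI1 image_eqI[of _ _ "nat x"]) auto
  next
    case False
    thus ?thesis by (intro UnI2 image_eqI[of _ _ "nat (- 1 - x)"]) auto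
  qed
  hence "range int \<union> range (\<lambda>n. - 1 - int n) = UNIV" by blast
  ultimately show ?thesis by simp
qed

text \<open>Comparison with a geometric series on each half line, since both \<open>n^2\<close> and
  \<open>(- 1 - n)^2\<close> are at least \<open>n\<close> for natural \<open>n\<close>.\<close>

lemma summable_gaussian_int:
  assumes d: "\<delta> > (0::real)"
  shows "(\<lambda>n::int. exp (- \<delta> * (of_int n)\<^sup>2)) summable_on UNIV"
proof (rule summable_on_int_split)
  have g: "(\<lambda>n. exp (- \<delta>) ^ n) summable_on UNIV"
    using d by (subst summable_on_UNIV_nonneg_real_iff) (auto intro!: summable_geometric)
  have le: "exp (- \<delta> * x\<^sup>2) \<le> exp (- \<delta>) ^ n" if "x\<^sup>2 \<ge> real n" for x n
  proof -
    have "exp (- \<delta>) ^ n = exp (- \<delta> * real n)" by (rule exp_of_nat2_mult[symmetric])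
    thus ?thesis using that d by simp
  qed
  have sq: "real n \<le> (real n)\<^sup>2" for n
    by (cases n) (auto simp: power2_eq_square)
  have le': "exp (- \<delta> * (of_int (int n))\<^sup>2) \<le> exp (- \<delta>) ^ n" for n
    using sq[of n] by (intro le) simp
  show "(\<lambda>n. exp (- \<delta> * (of_int (int n))\<^sup>2)) summable_on UNIV"
    by (rule summable_on_comparison_test[OF g]) (use le' in auto)
  show "(\<lambda>n. exp (- \<delta> * (of_int (- 1 - int n))\<^sup>2)) summable_on UNIV"
  proof (rule summable_on_comparison_test[OF g])
    fix n
    have "(real_of_int (- 1 - int n))\<^sup>2 = (real n)\<^sup>2 + 2 * real n + 1"
      by (simp add: power2_eq_square algebra_simps)
    hence "real n \<le> (real_of_int (- 1 - int n))\<^sup>2" using sq[of n] by linarith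
    thus "exp (- \<delta> * (of_int (- 1 - int n))\<^sup>2) \<le> exp (- \<delta>) ^ n" by (rule le)
  qed auto
qed

text \<open>Half of the quadratic term absorbs the linear one. The constant sees only bounds for
  \<open>q\<close> and \<open>r\<close>, so the estimate is uniform in parameters that enter through
  the lower-order coefficients.\<close>

lemma exp_quadratic_le:
  fixes p q r x :: real
  assumes "p > 0" "\<bar>q\<bar> \<le> q0" "r \<ge> - r0"
  shows "exp (- (p * x\<^sup>2 + q * x + r)) \<le> exp (q0\<^sup>2 / (2 * p) + r0) * exp (- (p / 2) * x\<^sup>2)"
proof -
  have "0 \<le> (p / 2) * (x + q / p)\<^sup>2" using assms by simp
  also have "\<dots> = (p / 2) * x\<^sup>2 + q * x + q\<^sup>2 / (2 * p)"
    using assms by (simp add: power2_eq_square field_simps)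
  finally have "- (p * x\<^sup>2 + q * x + r) \<le> q\<^sup>2 / (2 * p) + r0 + - (p / 2) * x\<^sup>2" using assms by simp
  moreover have "q\<^sup>2 \<le> q0\<^sup>2" using assms(2) by (metis abs_ge_zero power2_abs power_mono)
  hence "q\<^sup>2 / (2 * p) \<le> q0\<^sup>2 / (2 * p)" using assms by (simp add: divide_right_mono)
  ultimately show ?thesis by (simp add: exp_add[symmetric])
qed

text \<open>Uniformity in the shift \<open>\<beta>\<close> is what the Weierstrass test for the
  periodised Gaussian on the unit interval asks for.\<close>

lemma norm_complex_gaussian_le:
  assumes z: "Re z > 0" and \<beta>: "norm \<beta> \<le> R"
  shows "norm (exp (- of_real pi * z * (of_real x + \<beta>)\<^sup>2))
     \<le> exp ((2 * pi * norm z * R)\<^sup>2 / (2 * (pi * Re z)) + pi * norm z * R\<^sup>2) * exp (- (pi * Re z / 2) * x\<^sup>2)"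
proof -
  have re: "Re (- of_real pi * z * (of_real x + \<beta>)\<^sup>2) =
     - (pi * Re z * x\<^sup>2 + (2 * pi * Re (z * \<beta>)) * x + pi * Re (z * \<beta>\<^sup>2))"
    by (simp add: power2_eq_square algebra_simps)
  have R0: "R \<ge> 0" using \<beta> norm_ge_zero[of \<beta>] by linarith
  have "\<bar>Re (z * \<beta>)\<bar> \<le> norm z * norm \<beta>" using abs_Re_le_cmod[of "z * \<beta>"] by (simp add: norm_mult)
  also have "\<dots> \<le> norm z * R" using \<beta> by (intro mult_left_mono) auto
  finally have q: "\<bar>2 * pi * Re (z * \<beta>)\<bar> \<le> 2 * pi * norm z * R" by (simp add: abs_mult)
  have "\<bar>Re (z * \<beta>\<^sup>2)\<bar> \<le> norm z * (norm \<beta>)\<^sup>2" using abs_Re_le_cmod[of "z * \<beta>\<^sup>2"] by (simp add: norm_mult norm_power)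
  also have "\<dots> \<le> norm z * R\<^sup>2" using \<beta> by (intro mult_left_mono power_mono) auto
  finally have "- (norm z * R\<^sup>2) \<le> Re (z * \<beta>\<^sup>2)" by linarith
  hence "pi * - (norm z * R\<^sup>2) \<le> pi * Re (z * \<beta>\<^sup>2)" by (intro mult_left_mono) auto
  hence r: "pi * Re (z * \<beta>\<^sup>2) \<ge> - (pi * norm z * R\<^sup>2)" by simp
  show ?thesis
    unfolding norm_exp_eq_Re re by (rule exp_quadratic_le[OF _ q r]) (use z in auto)
qed

lemma Re_inverse_pos: "Re z > 0 \<Longrightarrow> Re (1 / z) > 0"
  by (simp add: Re_divide) (metis add_pos_nonneg divide_pos_pos zero_le_power2 zero_less_power)

text \<open>Completing the square: the terms of the dual series are, up to a constant, again terms
  of a Gaussian series, now with parameter \<open>1 / z\<close> and a complex shift. Its convergence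
  therefore needs no separate argument.\<close>

lemma dual_gaussian_eq:
  assumes "z \<noteq> 0"
  shows "exp (- of_real pi * of_real (x\<^sup>2) / z + 2 * of_real pi * \<i> * of_real x * w)
     = exp (- of_real pi * z * w\<^sup>2) * exp (- of_real pi * (1 / z) * (of_real x + (- \<i> * z * w))\<^sup>2)"
proof -
  have "- of_real pi * of_real (x\<^sup>2) / z + 2 * of_real pi * \<i> * of_real x * w
     = - of_real pi * z * w\<^sup>2 + - of_real pi * (1 / z) * (of_real x + (- \<i> * z * w))\<^sup>2"
    using assms by (simp add: power2_eq_square field_simps)
  thus ?thesis by (simp only: exp_add)
qed

lemma summable_complex_gaussian:
  assumes "Re z > 0"
  shows "(\<lambda>n::int. norm (exp (- of_real pi * z * (of_int n + w)\<^sup>2))) summable_on UNIV"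
proof (rule summable_on_comparison_test)
  show "(\<lambda>n::int. exp ((2 * pi * norm z * norm w)\<^sup>2 / (2 * (pi * Re z)) + pi * norm z * (norm w)\<^sup>2)
      * exp (- (pi * Re z / 2) * (of_int n)\<^sup>2)) summable_on UNIV"
    using assms by (intro summable_on_cmult_right summable_gaussian_int) auto
  show "norm (exp (- of_real pi * z * (of_int n + w)\<^sup>2))
     \<le> exp ((2 * pi * norm z * norm w)\<^sup>2 / (2 * (pi * Re z)) + pi * norm z * (norm w)\<^sup>2)
      * exp (- (pi * Re z / 2) * (of_int n)\<^sup>2)" for n :: int
    using norm_complex_gaussian_le[OF assms order_refl, of "of_int n" w] by simp
qed auto

lemma summable_dual_gaussian:
  assumes "Re z > 0"
  shows "(\<lambda>k::int. norm (exp (- of_real pi * of_int k ^ 2 / z + 2 * of_real pi * \<i> * of_int k * w))) summable_on UNIV"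
proof -
  have z0: "z \<noteq> 0" using assms by auto
  have "(\<lambda>k::int. norm (exp (- of_real pi * (1 / z) * (of_int k + (- \<i> * z * w))\<^sup>2))) summable_on UNIV"
    by (rule summable_complex_gaussian[OF Re_inverse_pos[OF assms]])
  hence "(\<lambda>k::int. norm (exp (- of_real pi * z * w\<^sup>2)) * norm (exp (- of_real pi * (1 / z) * (of_int k + (- \<i> * z * w))\<^sup>2))) summable_on UNIV"
    by (rule summable_on_cmult_right)
  thus ?thesis
    using dual_gaussian_eq[OF z0, of "of_int k" w for k :: int] by (simp add: norm_mult)
qed

lemma gaussian_fourier_integral:
  assumes z: "Re z > 0"
  shows "integrable lborel (\<lambda>x. exp (- of_real pi * z * (of_real x + w)\<^sup>2) * cis (2 * pi * of_int k * x))"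
    and "(LINT x|lborel. exp (- of_real pi * z * (of_real x + w)\<^sup>2) * cis (2 * pi * of_int k * x))
      = exp (- of_real pi * of_int k ^ 2 / z - 2 * of_real pi * \<i> * of_int k * w) / csqrt z"
proof -
  have z0: "z \<noteq> 0" using z by auto
  \<comment> \<open>Collects the frequency and the linear term \<open>- 2 * pi * z * w * x\<close>
    from the expanded square into one linear coefficient.\<close>
  define \<beta> where "\<beta> = \<i> * of_int k - z * w"
  define E where "E = (\<lambda>x::real. exp (- of_real pi * z * of_real (x\<^sup>2) + 2 * of_real pi * \<beta> * of_real x))"
  have eq: "exp (- of_real pi * z * (of_real x + w)\<^sup>2) * cis (2 * pi * of_int k * x) =
      exp (- of_real pi * z * w\<^sup>2) * E x" for x
    unfolding E_def cis_conv_exp exp_add[symmetric] \<beta>_def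
    by (rule arg_cong[where f = exp]) (simp add: power2_eq_square algebra_simps)
  have int: "integrable lborel E" unfolding E_def by (rule integrable_complex_gaussian[OF z])
  show "integrable lborel (\<lambda>x. exp (- of_real pi * z * (of_real x + w)\<^sup>2) * cis (2 * pi * of_int k * x))"
    unfolding eq using int by (rule integrable_mult_right)
  have "(LINT x|lborel. exp (- of_real pi * z * w\<^sup>2) * E x) = exp (- of_real pi * z * w\<^sup>2) * (exp (of_real pi * \<beta>\<^sup>2 / z) / csqrt z)"
    unfolding integral_mult_right_zero unfolding E_def gaussian_integral_complex[OF z] ..
  also have "\<dots> = exp (- of_real pi * z * w\<^sup>2 + of_real pi * \<beta>\<^sup>2 / z) / csqrt z"
    by (simp only: exp_add times_divide_eq_right)
  also have "- of_real pi * z * w\<^sup>2 + of_real pi * \<beta>\<^sup>2 / z = - of_real pi * of_int k ^ 2 / z - 2 * of_real pi * \<i> * of_int k * w"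
    using z0 by (simp add: \<beta>_def power2_eq_square field_simps)
  finally show "(LINT x|lborel. exp (- of_real pi * z * (of_real x + w)\<^sup>2) * cis (2 * pi * of_int k * x))
      = exp (- of_real pi * of_int k ^ 2 / z - 2 * of_real pi * \<i> * of_int k * w) / csqrt z"
    unfolding eq .
qed

lemma integral_cis_int:
  "integral {0..1} (\<lambda>s. cis (2 * pi * of_int k * s)) = (if k = 0 then 1 else 0)"
proof (cases "k = 0")
  case False
  define c where "c = 2 * pi * \<i> * of_int k"
  have c: "c \<noteq> 0" using False by (simp add: c_def)
  have "((\<lambda>s. exp (c * of_real s)) has_integral exp (c * of_real 1) / c - exp (c * of_real 0) / c) {0..1}"
    using c by (intro fundamental_theorem_of_calculus)
       (auto intro!: derivative_eq_intros has_vector_derivative_real_field simp: field_simps)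
  moreover have "exp c = 1"
    unfolding exp_eq_1 by (auto simp: c_def intro!: exI[of _ k])
  ultimately have "((\<lambda>s. exp (c * of_real s)) has_integral 0) {0..1}" by simp
  moreover have "(\<lambda>s. cis (2 * pi * of_int k * s)) = (\<lambda>s. exp (c * of_real s))"
    by (simp add: cis_conv_exp c_def mult_ac)
  ultimately show ?thesis using False by (simp add: integral_unique)
qed simp

text \<open>The periodised Gaussian and the series formed with its Fourier transform are continuous
  with equal end values and have the same Fourier coefficients. The shift \<open>w\<close> is
  complex because the two-dimensional formula applies this one after completing a square with
  complex coefficients.\<close>

theorem poisson_gaussian_1d:
  assumes z: "Re z > 0"
  shows "(\<Sum>\<^sub>\<infinity>n::int. exp (- of_real pi * z * (of_int n + w)\<^sup>2))
     = (\<Sum>\<^sub>\<infinity>k::int. exp (- of_real pi * of_int k ^ 2 / z + 2 * of_real pi * \<i> * of_int k * w)) / csqrt z"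
proof -
  define \<phi> where "\<phi> = (\<lambda>x::real. exp (- of_real pi * z * (of_real x + w)\<^sup>2))"
  define a where "a = (\<lambda>k::int. exp (- of_real pi * of_int k ^ 2 / z + 2 * of_real pi * \<i> * of_int k * w) / csqrt z)"
  define f where "f = (\<lambda>s. \<Sum>\<^sub>\<infinity>n::int. \<phi> (of_int n + s))"
  define T where "T = (\<lambda>s. \<Sum>\<^sub>\<infinity>k::int. a k * cis (2 * pi * of_int k * s))"
  define M where "M = (\<lambda>n::int. exp ((2 * pi * norm z * (norm w + 1))\<^sup>2 / (2 * (pi * Re z)) + pi * norm z * (norm w + 1)\<^sup>2)
      * exp (- (pi * Re z / 2) * (of_int n)\<^sup>2))"
  have M: "M summable_on UNIV"
    unfolding M_def using z by (intro summable_on_cmult_right summable_gaussian_int) auto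
  have contp: "continuous_on S \<phi>" for S unfolding \<phi>_def by (intro continuous_intros)
  have bd: "norm (\<phi> (of_int n + s)) \<le> M n" if "s \<in> {0..1}" for n s
  proof -
    have "norm (of_real s + w) \<le> norm (of_real s :: complex) + norm w" by (rule norm_triangle_ineq)
    hence "norm (of_real s + w) \<le> norm w + 1" using that by auto
    from norm_complex_gaussian_le[OF z this, of "of_int n"] show ?thesis
      by (simp add: \<phi>_def M_def add.assoc)
  qed
  have a_abs: "(\<lambda>k. norm (a k)) summable_on UNIV"
    using summable_on_cmult_left[OF summable_dual_gaussian[OF z, of w], of "inverse (norm (csqrt z))"]
    unfolding a_def norm_divide by (simp add: divide_inverse)
  have contf: "continuous_on {0..1} f" unfolding f_def
    by (rule continuous_on_infsum_uniform[where M = M])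
       (auto intro!: continuous_on_compose2[OF contp[of UNIV]] continuous_intros bd M)
  have contT: "continuous_on {0..1} T" unfolding T_def
    by (rule continuous_on_infsum_uniform[where M = "\<lambda>k. norm (a k)"])
       (auto intro!: continuous_intros a_abs simp: norm_mult)
  have "fourier_null (\<lambda>s. f s - T s)"
    unfolding fourier_null_def
  proof (intro conjI allI)
    show "continuous_on {0..1} (\<lambda>s. f s - T s)" by (intro continuous_intros contf contT)
    fix k :: int
    have cis_shift: "cis (2 * pi * of_int k * (of_int n + s)) = cis (2 * pi * of_int k * s)" for n s
    proof -
      have "cis (2 * pi * of_int k * of_int n) = 1"
        using cis_multiple_2pi[of "of_int (k * n)"] by (simp add: mult_ac)
      thus ?thesis by (simp add: distrib_left cis_mult[symmetric])
    qed
    have "integral {0..1} (\<lambda>s. f s * cis (2 * pi * of_int k * s)) =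
      integral {0..1} (\<lambda>s. \<Sum>\<^sub>\<infinity>n. \<phi> (of_int n + s) * cis (2 * pi * of_int k * (of_int n + s)))"
      unfolding cis_shift f_def by (simp add: infsum_cmult_left')
    also have "\<dots> = (LINT x|lborel. \<phi> x * cis (2 * pi * of_int k * x))"
      by (rule integral_periodization[where M = M])
         (use gaussian_fourier_integral(1)[OF z, of w k] in
           \<open>auto simp: \<phi>_def norm_mult intro!: bd[unfolded \<phi>_def, simplified] M continuous_intros\<close>)
    \<comment> \<open>Testing against the character of index \<open>k\<close> extracts the
      coefficient of index \<open>- k\<close>.\<close>
    also have "\<dots> = a (- k)"
      unfolding \<phi>_def gaussian_fourier_integral(2)[OF z] a_def by simp
    finally have 1: "integral {0..1} (\<lambda>s. f s * cis (2 * pi * of_int k * s)) = a (- k)" .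
    have "((\<lambda>l. integral {0..1} (\<lambda>s. a l * cis (2 * pi * of_int l * s) * cis (2 * pi * of_int k * s)))
        has_sum integral {0..1} (\<lambda>s. \<Sum>\<^sub>\<infinity>l. a l * cis (2 * pi * of_int l * s) * cis (2 * pi * of_int k * s))) UNIV"
      by (rule has_sum_integral_uniform[where M = "\<lambda>k. norm (a k)"])
         (auto intro!: continuous_intros a_abs simp: norm_mult)
    moreover have "integral {0..1} (\<lambda>s. a l * cis (2 * pi * of_int l * s) * cis (2 * pi * of_int k * s))
        = (if l = - k then a (- k) else 0)" for l
    proof -
      have "(\<lambda>s. a l * cis (2 * pi * of_int l * s) * cis (2 * pi * of_int k * s)) = (\<lambda>s. a l * cis (2 * pi * of_int (l + k) * s))"
        by (rule ext) (simp add: cis_mult mult.assoc distrib_left distrib_right)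
      thus ?thesis using integral_cis_int[of "l + k"]
        by (auto simp del: of_int_add simp: eq_neg_iff_add_eq_0[symmetric])
    qed
    ultimately have "((\<lambda>l. if l = - k then a (- k) else 0) has_sum
        integral {0..1} (\<lambda>s. T s * cis (2 * pi * of_int k * s))) UNIV"
      by (simp add: T_def infsum_cmult_left')
    moreover have "((\<lambda>l. if l = - k then a (- k) else 0) has_sum a (- k)) UNIV"
      by (rule has_sum_finite_neutralI[of "{- k}"]) auto
    ultimately have 2: "integral {0..1} (\<lambda>s. T s * cis (2 * pi * of_int k * s)) = a (- k)"
      using has_sum_unique by blast
    have "integral {0..1} (\<lambda>s. f s * cis (2 * pi * of_int k * s) - T s * cis (2 * pi * of_int k * s)) = 0"
      by (subst Henstock_Kurzweil_Integration.integral_diff)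
         (auto simp: 1 2 intro!: integrable_continuous_real continuous_intros contf contT)
    thus "integral {0..1} (\<lambda>s. (f s - T s) * cis (2 * pi * of_int k * s)) = 0"
      by (simp add: left_diff_distrib)
  qed
  moreover have "f 1 = f 0"
  proof -
    have "f 1 = (\<Sum>\<^sub>\<infinity>n. (\<lambda>n. \<phi> (of_int n)) (n + 1))" by (simp add: f_def)
    also have "\<dots> = (\<Sum>\<^sub>\<infinity>n\<in>range (\<lambda>n. n + 1). \<phi> (of_int n))"
      by (subst infsum_reindex) (auto simp: o_def inj_on_def)
    also have "range (\<lambda>n::int. n + 1) = UNIV" by (rule surjI[of _ "\<lambda>n. n - 1"]) simp
    finally show ?thesis by (simp add: f_def)
  qed
  moreover have "T 1 = T 0"
  proof -
    have "cis (2 * pi * of_int k) = 1" for k :: int using cis_multiple_2pi[of "of_int k"] by simp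
    thus ?thesis by (simp add: T_def)
  qed
  ultimately have "f 0 - T 0 = 0"
    by (intro fourier_null_imp_zero[of "\<lambda>s. f s - T s" 0]) auto
  thus ?thesis
    by (simp add: f_def T_def \<phi>_def a_def divide_inverse infsum_cmult_left')
qed

lemma norm_summable_onI:
  fixes f :: "'i \<Rightarrow> complex"
  assumes "g summable_on A" "\<And>i. i \<in> A \<Longrightarrow> norm (f i) \<le> g i"
  shows "f summable_on A" and "(\<lambda>i. norm (f i)) summable_on A"
proof -
  show "(\<lambda>i. norm (f i)) summable_on A"
    by (rule summable_on_comparison_test[OF assms(1)]) (use assms(2) in auto)
  thus "f summable_on A" by (rule abs_summable_summable)
qed

section \<open>Binary Gaussian series and Poisson summation in two variables\<close>

lemma summable_gaussian_int_pair:
  assumes d: "\<delta> > (0::real)"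
  shows "(\<lambda>(n::int, m::int). exp (- \<delta> * ((of_int n)\<^sup>2 + (of_int m)\<^sup>2))) summable_on UNIV"
proof -
  let ?g = "\<lambda>n::int. exp (- \<delta> * (of_int n)\<^sup>2)"
  have g: "?g summable_on UNIV" by (rule summable_gaussian_int[OF d])
  have "(\<lambda>(n, m). ?g n * ?g m) summable_on (UNIV \<times> UNIV)"
  proof (rule summable_on_SigmaI)
    fix n :: int
    show "((\<lambda>m. case (n, m) of (n, m) \<Rightarrow> ?g n * ?g m) has_sum (?g n * infsum ?g UNIV)) UNIV"
      using g by (auto intro!: has_sum_cmult_right has_sum_infsum)
    show "(\<lambda>n. ?g n * infsum ?g UNIV) summable_on UNIV"
      using g by (rule summable_on_cmult_left)
  qed auto
  thus ?thesis by (simp add: exp_add[symmetric] algebra_simps)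
qed

lemma summable_gaussian_int_pair_shift:
  assumes d: "\<delta> > (0::real)"
  shows "(\<lambda>(n::int, m::int). exp (- \<delta> * ((of_int n + w1)\<^sup>2 + (of_int m + w2)\<^sup>2))) summable_on UNIV"
proof (rule summable_on_comparison_test)
  have sq: "(x + w)\<^sup>2 \<ge> x\<^sup>2 / 2 - w\<^sup>2" for x w :: real
  proof -
    have "0 \<le> (x + 2 * w)\<^sup>2 / 2" by simp
    also have "\<dots> = (x + w)\<^sup>2 - (x\<^sup>2 / 2 - w\<^sup>2)" by (simp add: power2_eq_square field_simps)
    finally show ?thesis by simp
  qed
  show "(\<lambda>p. exp (\<delta> * (w1\<^sup>2 + w2\<^sup>2)) * (case p of (n::int, m::int) \<Rightarrow> exp (- (\<delta> / 2) * ((of_int n)\<^sup>2 + (of_int m)\<^sup>2)))) summable_on UNIV"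
    using d by (intro summable_on_cmult_right summable_gaussian_int_pair) simp
  fix p :: "int \<times> int"
  obtain n m where p: "p = (n, m)" by (cases p)
  have "\<delta> * ((of_int n)\<^sup>2 / 2 - w1\<^sup>2 + ((of_int m)\<^sup>2 / 2 - w2\<^sup>2)) \<le> \<delta> * ((of_int n + w1)\<^sup>2 + (of_int m + w2)\<^sup>2)"
    using d sq[of "of_int n" w1] sq[of "of_int m" w2] by (intro mult_left_mono add_mono) auto
  thus "(case p of (n, m) \<Rightarrow> exp (- \<delta> * ((of_int n + w1)\<^sup>2 + (of_int m + w2)\<^sup>2)))
     \<le> exp (\<delta> * (w1\<^sup>2 + w2\<^sup>2)) * (case p of (n, m) \<Rightarrow> exp (- (\<delta> / 2) * ((of_int n)\<^sup>2 + (of_int m)\<^sup>2)))"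
    unfolding p by (simp add: exp_add[symmetric] algebra_simps)
qed auto

text \<open>For a symmetric matrix the mixed terms combine to \<open>z12\<close> times the real
  number \<open>cnj u * v + cnj v * u\<close>, so only the real part of the matrix is seen.\<close>

lemma Re_hermitian_form:
  fixes z11 z12 z22 u v :: complex
  shows "Re (cnj u * (z11 * u + z12 * v) + cnj v * (z12 * u + z22 * v)) =
     (Re z11 * (Re u)\<^sup>2 + 2 * Re z12 * Re u * Re v + Re z22 * (Re v)\<^sup>2)
   + (Re z11 * (Im u)\<^sup>2 + 2 * Re z12 * Im u * Im v + Re z22 * (Im v)\<^sup>2)"
  by (simp add: power2_eq_square algebra_simps)

text \<open>A symmetric complex matrix with positive definite real part. The explicit
  \<open>\<epsilon>\<close> is what the dominating Gaussian series are built from.\<close>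

locale complex_binary_form =
  fixes z11 z12 z22 :: complex and \<epsilon> :: real
  assumes eps: "\<epsilon> > 0"
    and posdef: "\<And>x y. Re z11 * x\<^sup>2 + 2 * Re z12 * x * y + Re z22 * y\<^sup>2 \<ge> \<epsilon> * (x\<^sup>2 + y\<^sup>2)"
begin

definition form :: "complex \<Rightarrow> complex \<Rightarrow> complex" where
  "form x y = z11 * x\<^sup>2 + 2 * z12 * x * y + z22 * y\<^sup>2"

definition disc :: complex where "disc = z11 * z22 - z12\<^sup>2"

text \<open>Positivity is extended to complex vectors so that it can be evaluated at vectors solving
  a linear equation with complex coefficients; the Schur complement and the partially dual form are
  both controlled in this way.\<close>

lemma hermitian_ge:
  "\<epsilon> * ((norm u)\<^sup>2 + (norm v)\<^sup>2) \<le> Re (cnj u * (z11 * u + z12 * v) + cnj v * (z12 * u + z22 * v))"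
proof -
  have "\<epsilon> * ((norm u)\<^sup>2 + (norm v)\<^sup>2) = \<epsilon> * ((Re u)\<^sup>2 + (Re v)\<^sup>2) + \<epsilon> * ((Im u)\<^sup>2 + (Im v)\<^sup>2)"
    by (simp add: cmod_power2 algebra_simps)
  also have "\<dots> \<le> Re (cnj u * (z11 * u + z12 * v) + cnj v * (z12 * u + z22 * v))"
    unfolding Re_hermitian_form by (intro add_mono posdef)
  finally show ?thesis .
qed

lemma Re_z11_pos: "Re z11 > 0"
  using posdef[of 1 0] eps by simp

lemma z11_nz: "z11 \<noteq> 0" using Re_z11_pos by auto

text \<open>At \<open>u = - z12 / z11\<close>, \<open>v = 1\<close> the first row of the matrix
  gives 0 and the Hermitian form reduces to the Schur complement.\<close>

lemma Re_schur_pos: "Re (disc / z11) > 0"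
proof -
  let ?u = "- z12 / z11"
  have z: "z11 * ?u + z12 * 1 = 0" using z11_nz by simp
  have "z12 * ?u + z22 * 1 = disc / z11" using z11_nz by (simp add: disc_def field_simps power2_eq_square)
  hence "Re (disc / z11) \<ge> \<epsilon> * ((norm ?u)\<^sup>2 + (norm (1::complex))\<^sup>2)"
    using hermitian_ge[of ?u 1] unfolding z by simp
  moreover have "\<epsilon> * ((norm ?u)\<^sup>2 + (norm (1::complex))\<^sup>2) > 0"
    using eps by (intro mult_pos_pos add_nonneg_pos) auto
  ultimately show ?thesis by linarith
qed

lemma disc_nz: "disc \<noteq> 0" using Re_schur_pos by auto

lemma form_complete_square: "form x y = z11 * (x + z12 / z11 * y)\<^sup>2 + disc / z11 * y\<^sup>2"
  using z11_nz by (simp add: form_def disc_def field_simps power2_eq_square)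

lemma Re_form_ge: "Re (form (of_real x) (of_real y)) \<ge> \<epsilon> * (x\<^sup>2 + y\<^sup>2)"
  using posdef[of x y] by (simp add: form_def power2_eq_square algebra_simps)

text \<open>The form on the left is the Hermitian form at \<open>(u, y)\<close> with \<open>z11 u + z12 y = - i k\<close>.\<close>
lemma partial_dual_bound:
  "Re ((of_real k)\<^sup>2 / z11 - 2 * \<i> * of_real k * (z12 / z11) * of_real y + disc / z11 * (of_real y)\<^sup>2)
     \<ge> \<epsilon> / (2 * (norm z11)\<^sup>2 + 2 * (norm z12)\<^sup>2 + 1) * (k\<^sup>2 + y\<^sup>2)"
proof -
  define u where "u = - \<i> * of_real k / z11 - z12 / z11 * of_real y"
  define v :: complex where "v = of_real y"
  define B where "B = 2 * (norm z11)\<^sup>2 + 2 * (norm z12)\<^sup>2 + 1"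
  have uv: "z11 * u + z12 * v = - \<i> * of_real k"
    using z11_nz by (simp add: u_def v_def right_diff_distrib)
  have uv2: "z12 * u + z22 * v = - \<i> * of_real k * (z12 / z11) + disc / z11 * of_real y"
    using z11_nz by (simp add: u_def v_def disc_def field_simps power2_eq_square)
  have "Re (cnj u * (z11 * u + z12 * v) + cnj v * (z12 * u + z22 * v)) =
     Re ((of_real k)\<^sup>2 / z11 - 2 * \<i> * of_real k * (z12 / z11) * of_real y + disc / z11 * (of_real y)\<^sup>2)"
  proof -
    have cu: "cnj u = \<i> * of_real k * cnj (1 / z11) - cnj (z12 / z11) * of_real y"
      by (simp add: u_def)
    have "cnj u * (z11 * u + z12 * v) + cnj v * (z12 * u + z22 * v) =
      (of_real k)\<^sup>2 * cnj (1 / z11) + \<i> * of_real (k * y) * (cnj (z12 / z11) - z12 / z11) + disc / z11 * (of_real y)\<^sup>2"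
      unfolding uv uv2 cu by (simp add: v_def power2_eq_square algebra_simps)
    also have "Re \<dots> = k\<^sup>2 * Re (1 / z11) + 2 * (k * y) * Im (z12 / z11) + Re (disc / z11) * y\<^sup>2"
    proof -
      have "Re ((of_real k)\<^sup>2 * cnj \<alpha> + \<i> * of_real (k * y) * (cnj \<beta> - \<beta>) + \<sigma> * (of_real y)\<^sup>2)
        = k\<^sup>2 * Re \<alpha> + 2 * (k * y) * Im \<beta> + Re \<sigma> * y\<^sup>2" for \<alpha> \<beta> \<sigma>
        by (simp add: power2_eq_square algebra_simps)
      thus ?thesis .
    qed
    also have "\<dots> = Re ((of_real k)\<^sup>2 * (1 / z11) - 2 * \<i> * of_real k * (z12 / z11) * of_real y + disc / z11 * (of_real y)\<^sup>2)"
      by (simp only: plus_complex.sel minus_complex.sel times_complex.sel) (simp add: power2_eq_square algebra_simps)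
    finally show ?thesis by simp
  qed
  moreover have "k\<^sup>2 + y\<^sup>2 \<le> B * ((norm u)\<^sup>2 + (norm v)\<^sup>2)"
  proof -
    have "\<bar>k\<bar> = norm (z11 * u + z12 * v)" by (simp add: uv norm_mult)
    also have "\<dots> \<le> norm z11 * norm u + norm z12 * norm v"
      using norm_triangle_ineq[of "z11 * u" "z12 * v"] by (simp add: norm_mult)
    finally have "\<bar>k\<bar>\<^sup>2 \<le> (norm z11 * norm u + norm z12 * norm v)\<^sup>2" by (intro power_mono) auto
    also have "\<dots> \<le> 2 * (norm z11 * norm u)\<^sup>2 + 2 * (norm z12 * norm v)\<^sup>2"
      using sum_squares_bound[of "norm z11 * norm u" "norm z12 * norm v"] by (simp add: power2_sum)
    also have "\<dots> = 2 * (norm z11)\<^sup>2 * (norm u)\<^sup>2 + 2 * (norm z12)\<^sup>2 * (norm v)\<^sup>2"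
      by (simp add: power_mult_distrib)
    finally have "k\<^sup>2 + y\<^sup>2 \<le> 2 * (norm z11)\<^sup>2 * (norm u)\<^sup>2 + 2 * (norm z12)\<^sup>2 * (norm v)\<^sup>2 + (norm v)\<^sup>2"
      by (simp add: v_def)
    also have "\<dots> \<le> B * ((norm u)\<^sup>2 + (norm v)\<^sup>2)"
      by (simp add: B_def algebra_simps)
    finally show ?thesis .
  qed
  hence "\<epsilon> / B * (k\<^sup>2 + y\<^sup>2) \<le> \<epsilon> / B * (B * ((norm u)\<^sup>2 + (norm v)\<^sup>2))"
    using eps by (intro mult_left_mono) (auto simp: B_def)
  moreover have "B > 0" by (simp add: B_def add_nonneg_pos)
  hence "\<epsilon> / B * (B * ((norm u)\<^sup>2 + (norm v)\<^sup>2)) = \<epsilon> * ((norm u)\<^sup>2 + (norm v)\<^sup>2)" by simp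
  ultimately show ?thesis using hermitian_ge[of u v] unfolding B_def by linarith
qed

text \<open>One-dimensional summation in the first variable and then in the second. The interchange
  in between concerns the half-dualised series, whose terms have to be dominated by
  \<open>partial_dual_bound\<close>. The denominator stays a product of two principal roots, as
  \<open>csqrt\<close> is not multiplicative; the branch is settled where the matrix is
  explicit.\<close>

theorem poisson_gaussian_2d:
  fixes w1 w2 :: real
  assumes dual: "(\<lambda>(k::int, l::int). exp (- of_real pi * (z22 * (of_int k)\<^sup>2 - 2 * z12 * of_int k * of_int l + z11 * (of_int l)\<^sup>2) / disc
        + 2 * of_real pi * \<i> * (of_int k * of_real w1 + of_int l * of_real w2))) summable_on UNIV"
  shows "(\<Sum>\<^sub>\<infinity>(n::int, m::int). exp (- of_real pi * form (of_int n + of_real w1) (of_int m + of_real w2)))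
    = (\<Sum>\<^sub>\<infinity>(k::int, l::int). exp (- of_real pi * (z22 * (of_int k)\<^sup>2 - 2 * z12 * of_int k * of_int l + z11 * (of_int l)\<^sup>2) / disc
        + 2 * of_real pi * \<i> * (of_int k * of_real w1 + of_int l * of_real w2))) / (csqrt z11 * csqrt (disc / z11))"
proof -
  define \<rho> where "\<rho> = z12 / z11"
  define s where "s = disc / z11"
  have s: "Re s > 0" using Re_schur_pos by (simp add: s_def)
  hence s0: "s \<noteq> 0" by auto
  define f where "f = (\<lambda>(m::int) (n::int). exp (- of_real pi * form (of_int n + of_real w1) (of_int m + of_real w2)))"
  define g where "g = (\<lambda>(m::int) (k::int). exp (- of_real pi * (of_int k)\<^sup>2 / z11 + 2 * of_real pi * \<i> * of_int k * (of_real w1 + \<rho> * (of_int m + of_real w2)))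
      * exp (- of_real pi * s * (of_int m + of_real w2)\<^sup>2))"
  define h where "h = (\<lambda>(k::int) (l::int). exp (- of_real pi * (z22 * (of_int k)\<^sup>2 - 2 * z12 * of_int k * of_int l + z11 * (of_int l)\<^sup>2) / disc
        + 2 * of_real pi * \<i> * (of_int k * of_real w1 + of_int l * of_real w2)))"
  have f_eq: "f m n = exp (- of_real pi * z11 * (of_int n + (of_real w1 + \<rho> * (of_int m + of_real w2)))\<^sup>2)
      * exp (- of_real pi * s * (of_int m + of_real w2)\<^sup>2)" for m n
    unfolding f_def form_complete_square s_def[symmetric] \<rho>_def[symmetric] exp_add[symmetric]
    by (rule arg_cong[where f = exp]) (simp add: algebra_simps)
  have sumf: "(\<lambda>(m, n). f m n) summable_on UNIV"
  proof (rule norm_summable_onI(1))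
    show "(\<lambda>(m::int, n::int). exp (- (pi * \<epsilon>) * ((of_int m + w2)\<^sup>2 + (of_int n + w1)\<^sup>2))) summable_on UNIV"
      using eps by (intro summable_gaussian_int_pair_shift) auto
    fix p :: "int \<times> int"
    obtain m n where p: "p = (m, n)" by (cases p)
    have "pi * (\<epsilon> * ((of_int n + w1)\<^sup>2 + (of_int m + w2)\<^sup>2)) \<le> pi * Re (form (of_real (of_int n + w1)) (of_real (of_int m + w2)))"
      by (intro mult_left_mono Re_form_ge) auto
    thus "norm (case p of (m, n) \<Rightarrow> f m n) \<le> (case p of (m, n) \<Rightarrow> exp (- (pi * \<epsilon>) * ((of_int m + w2)\<^sup>2 + (of_int n + w1)\<^sup>2)))"
      unfolding p f_def by (simp add: algebra_simps)
  qed
  have sumg: "(\<lambda>(m, k). g m k) summable_on UNIV"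
  proof (rule norm_summable_onI(1))
    define e where "e = \<epsilon> / (2 * (norm z11)\<^sup>2 + 2 * (norm z12)\<^sup>2 + 1)"
    have e: "e > 0" using eps by (auto simp: e_def intro!: divide_pos_pos add_nonneg_pos)
    show "(\<lambda>(m::int, k::int). exp (- (pi * e) * ((of_int m + w2)\<^sup>2 + (of_int k + 0)\<^sup>2))) summable_on UNIV"
      using e by (intro summable_gaussian_int_pair_shift) auto
    fix p :: "int \<times> int"
    obtain m k where p: "p = (m, k)" by (cases p)
    define y where "y = of_int m + w2"
    let ?X = "(of_real (of_int k))\<^sup>2 / z11 - 2 * \<i> * of_real (of_int k) * (z12 / z11) * of_real y + disc / z11 * (of_real y)\<^sup>2"
    have X: "- of_real pi * (of_int k)\<^sup>2 / z11 + 2 * of_real pi * \<i> * of_int k * (of_real w1 + \<rho> * of_real y) - of_real pi * s * (of_real y)\<^sup>2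
        = of_real (- pi) * ?X + \<i> * of_real (2 * pi * of_int k * w1)"
      by (simp add: \<rho>_def s_def algebra_simps)
    have "pi * (e * ((of_int k)\<^sup>2 + y\<^sup>2)) \<le> pi * Re ((of_real (of_int k))\<^sup>2 / z11 - 2 * \<i> * of_real (of_int k) * (z12 / z11) * of_real y + disc / z11 * (of_real y)\<^sup>2)"
      unfolding e_def by (intro mult_left_mono partial_dual_bound) auto
    also have "\<dots> = - Re (- of_real pi * (of_int k)\<^sup>2 / z11 + 2 * of_real pi * \<i> * of_int k * (of_real w1 + \<rho> * of_real y) - of_real pi * s * (of_real y)\<^sup>2)"
      unfolding X by (simp del: of_real_of_int_eq)
    finally show "norm (case p of (m, k) \<Rightarrow> g m k) \<le> (case p of (m, k) \<Rightarrow> exp (- (pi * e) * ((of_int m + w2)\<^sup>2 + (of_int k + 0)\<^sup>2)))"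
      unfolding p g_def by (simp add: exp_add[symmetric] norm_mult y_def algebra_simps)
  qed
  have inner: "(\<Sum>\<^sub>\<infinity>n. f m n) = (\<Sum>\<^sub>\<infinity>k. g m k) / csqrt z11" for m
    unfolding f_eq g_def infsum_cmult_left' by (subst poisson_gaussian_1d[OF Re_z11_pos]) simp
  have outer: "(\<Sum>\<^sub>\<infinity>m. g m k) = (\<Sum>\<^sub>\<infinity>l. h k l) / csqrt s" for k
  proof -
    \<comment> \<open>The part free of \<open>m\<close>. Completing the square in \<open>m\<close>
      moves the coupling \<open>\<rho>\<close> into a complex shift of \<open>w2\<close>.\<close>
    define E where "E = exp (- of_real pi * (of_int k)\<^sup>2 / z11 + 2 * of_real pi * \<i> * of_int k * of_real w1 - of_real pi * (of_int k)\<^sup>2 * \<rho>\<^sup>2 / s)"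
    have "g m k = E * exp (- of_real pi * s * (of_int m + (of_real w2 - \<i> * of_int k * \<rho> / s))\<^sup>2)" for m
      unfolding g_def E_def exp_add[symmetric]
      by (rule arg_cong[where f = exp]) (use s0 in \<open>simp add: power2_eq_square field_simps\<close>)
    hence "(\<Sum>\<^sub>\<infinity>m. g m k) = E * ((\<Sum>\<^sub>\<infinity>l::int. exp (- of_real pi * (of_int l)\<^sup>2 / s + 2 * of_real pi * \<i> * of_int l * (of_real w2 - \<i> * of_int k * \<rho> / s))) / csqrt s)"
      by (simp only: infsum_cmult_right' poisson_gaussian_1d[OF s])
    also have "\<dots> = (\<Sum>\<^sub>\<infinity>l::int. E * exp (- of_real pi * (of_int l)\<^sup>2 / s + 2 * of_real pi * \<i> * of_int l * (of_real w2 - \<i> * of_int k * \<rho> / s))) / csqrt s"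
      by (simp add: infsum_cmult_right')
    also have "(\<lambda>l::int. E * exp (- of_real pi * (of_int l)\<^sup>2 / s + 2 * of_real pi * \<i> * of_int l * (of_real w2 - \<i> * of_int k * \<rho> / s))) = h k"
    proof
      fix l :: int
      have q: "- of_real pi * (z22 * (of_int k)\<^sup>2 - 2 * z12 * of_int k * of_int l + z11 * (of_int l)\<^sup>2) / disc
         = - of_real pi * ((z22 / disc) * (of_int k)\<^sup>2 - 2 * (z12 / disc) * of_int k * of_int l + (z11 / disc) * (of_int l)\<^sup>2)"
        using disc_nz by (simp add: field_simps)
      have "1 / s = z11 / disc" "\<rho> / s = z12 / disc" "1 / z11 + \<rho>\<^sup>2 / s = z22 / disc"
        using z11_nz disc_nz by (auto simp: s_def \<rho>_def disc_def field_simps power2_eq_square)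
      moreover have "- of_real pi * (of_int k)\<^sup>2 / z11 + 2 * of_real pi * \<i> * of_int k * of_real w1 - of_real pi * (of_int k)\<^sup>2 * \<rho>\<^sup>2 / s +
        (- of_real pi * (of_int l)\<^sup>2 / s + 2 * of_real pi * \<i> * of_int l * (of_real w2 - \<i> * of_int k * \<rho> / s))
        = - of_real pi * ((1 / z11 + \<rho>\<^sup>2 / s) * (of_int k)\<^sup>2 - 2 * (\<rho> / s) * of_int k * of_int l + (1 / s) * (of_int l)\<^sup>2)
        + 2 * of_real pi * \<i> * (of_int k * of_real w1 + of_int l * of_real w2)"
        by (simp add: algebra_simps)
      ultimately show "E * exp (- of_real pi * (of_int l)\<^sup>2 / s + 2 * of_real pi * \<i> * of_int l * (of_real w2 - \<i> * of_int k * \<rho> / s)) = h k l"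
        unfolding E_def h_def q by (simp only: exp_add[symmetric])
    qed
    finally show ?thesis .
  qed
  have "(\<Sum>\<^sub>\<infinity>(n, m). f m n) = (\<Sum>\<^sub>\<infinity>n. \<Sum>\<^sub>\<infinity>m. f m n)"
  proof -
    have "(\<lambda>(n, m). f m n) summable_on UNIV \<times> UNIV"
      using sumf summable_on_swap[of "\<lambda>(m, n). f m n" UNIV UNIV] by (simp add: prod.case_distrib case_prod_unfold)
    from infsum_Sigma'_banach[OF this] show ?thesis by simp
  qed
  also have "\<dots> = (\<Sum>\<^sub>\<infinity>m. \<Sum>\<^sub>\<infinity>n. f m n)"
    using sumf by (subst infsum_swap_banach[of "\<lambda>m n. f m n"]) simp_all
  also have "\<dots> = (\<Sum>\<^sub>\<infinity>m. \<Sum>\<^sub>\<infinity>k. g m k) / csqrt z11"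
    unfolding inner by (simp add: divide_inverse infsum_cmult_left')
  also have "(\<Sum>\<^sub>\<infinity>m. \<Sum>\<^sub>\<infinity>k. g m k) = (\<Sum>\<^sub>\<infinity>k. \<Sum>\<^sub>\<infinity>m. g m k)"
    using sumg by (subst infsum_swap_banach[of "\<lambda>m k. g m k"]) simp_all
  also have "\<dots> = (\<Sum>\<^sub>\<infinity>k. \<Sum>\<^sub>\<infinity>l. h k l) / csqrt s"
    unfolding outer by (simp add: divide_inverse infsum_cmult_left')
  also have "(\<Sum>\<^sub>\<infinity>k. \<Sum>\<^sub>\<infinity>l. h k l) = (\<Sum>\<^sub>\<infinity>(k, l). h k l)"
    using infsum_Sigma'_banach[of h UNIV "\<lambda>_. UNIV"] dual unfolding h_def by simp
  finally show ?thesis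
    by (simp add: f_def h_def s_def mult.commute)
qed

end

subsection \<open>Gauss sums\<close>

definition ec :: "real \<Rightarrow> complex" where "ec x = cis (2 * pi * x)"

lemma ec_add: "ec (x + y) = ec x * ec y"
  by (simp add: ec_def distrib_left cis_mult)

lemma ec_eq_1_iff: "ec x = 1 \<longleftrightarrow> x \<in> \<int>"
proof
  assume "ec x = 1"
  hence "exp (\<i> * of_real (2 * pi * x)) = 1" by (simp add: ec_def cis_conv_exp)
  then obtain n :: int where "2 * pi * x = of_int (2 * n) * pi"
    unfolding exp_eq_1 by auto
  hence "x = of_int n" by simp
  thus "x \<in> \<int>" by simp
next
  assume "x \<in> \<int>"
  thus "ec x = 1" by (auto simp: ec_def cis_multiple_2pi)
qed

lemma ec_Ints [simp]: "x \<in> \<int> \<Longrightarrow> ec x = 1"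
  by (simp add: ec_eq_1_iff)

lemma ec_cong_Ints: "x - y \<in> \<int> \<Longrightarrow> ec x = ec y"
  using ec_add[of "x - y" y] by simp

text \<open>The period may be negative, since it will be \<open>2 * c\<close> for a matrix entry
  \<open>c\<close> of either sign; summation ranges therefore use its absolute value.\<close>

definition per2 :: "int \<Rightarrow> (int \<Rightarrow> int \<Rightarrow> complex) \<Rightarrow> bool" where
  "per2 K f \<longleftrightarrow> (\<forall>x y i j. f (x + K * i) (y + K * j) = f x y)"

lemma sum_periodic_shift:
  fixes f :: "int \<Rightarrow> complex"
  assumes K: "K \<noteq> 0" and f: "\<And>x i. f (x + K * i) = f x"
  shows "(\<Sum>x\<in>{0..<\<bar>K\<bar>}. f (x + s)) = (\<Sum>x\<in>{0..<\<bar>K\<bar>}. f x)"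
proof -
  have red: "f (x mod \<bar>K\<bar>) = f x" for x
  proof -
    have "\<bar>K\<bar> = K * sgn K" by (simp add: abs_sgn)
    moreover have "x mod \<bar>K\<bar> = x + \<bar>K\<bar> * (- (x div \<bar>K\<bar>))"
      by (simp add: minus_div_mult_eq_mod[symmetric] algebra_simps)
    ultimately have "x mod \<bar>K\<bar> = x + K * (sgn K * - (x div \<bar>K\<bar>))" by (simp add: mult.assoc)
    thus ?thesis by (simp only: f)
  qed
  show ?thesis
  proof (rule sum.reindex_bij_witness[of _ "\<lambda>x. (x - s) mod \<bar>K\<bar>" "\<lambda>x. (x + s) mod \<bar>K\<bar>"])
    fix x assume "x \<in> {0..<\<bar>K\<bar>}"
    thus "((x + s) mod \<bar>K\<bar> - s) mod \<bar>K\<bar> = x" by (simp add: mod_diff_left_eq)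
    show "f ((x + s) mod \<bar>K\<bar>) = f (x + s)" by (rule red)
  next
    fix x assume "x \<in> {0..<\<bar>K\<bar>}"
    thus "((x - s) mod \<bar>K\<bar> + s) mod \<bar>K\<bar> = x" by (simp add: mod_add_left_eq)
  qed (use K in auto)
qed

lemma sum_per2_shift:
  assumes K: "K \<noteq> 0" and f: "per2 K f"
  shows "(\<Sum>x\<in>{0..<\<bar>K\<bar>}. \<Sum>y\<in>{0..<\<bar>K\<bar>}. f (x + s) (y + t)) = (\<Sum>x\<in>{0..<\<bar>K\<bar>}. \<Sum>y\<in>{0..<\<bar>K\<bar>}. f x y)"
proof -
  have f1: "f (x + K * i) y = f x y" and f2: "f x (y + K * i) = f x y" for x y i
    using f[unfolded per2_def, rule_format, of x i y 0] f[unfolded per2_def, rule_format, of x 0 y i] by simp_all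
  have "(\<Sum>x\<in>{0..<\<bar>K\<bar>}. \<Sum>y\<in>{0..<\<bar>K\<bar>}. f (x + s) (y + t)) = (\<Sum>x\<in>{0..<\<bar>K\<bar>}. \<Sum>y\<in>{0..<\<bar>K\<bar>}. f (x + s) y)"
    by (intro sum.cong refl sum_periodic_shift K f2)
  also have "\<dots> = (\<Sum>x\<in>{0..<\<bar>K\<bar>}. \<Sum>y\<in>{0..<\<bar>K\<bar>}. f x y)"
    by (rule sum_periodic_shift[OF K, of "\<lambda>x. \<Sum>y\<in>{0..<\<bar>K\<bar>}. f x y"]) (simp add: f1)
  finally show ?thesis .
qed

text \<open>Moving the summation variable by one multiplies the sum by a root of unity; if that root
  is not 1, the sum is 0.\<close>

lemma sum_roots_of_unity:
  assumes L: "L > (0::int)"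
  shows "(\<Sum>\<kappa>\<in>{0..<L}. ec (of_int x * of_int \<kappa> / of_int L)) = (if L dvd x then of_int L else 0)"
proof (cases "L dvd x")
  case True
  then obtain j where "x = L * j" by blast
  hence "ec (of_int x * of_int \<kappa> / of_int L) = 1" for \<kappa> using L by simp
  thus ?thesis using True L by simp
next
  case False
  let ?S = "\<Sum>\<kappa>\<in>{0..<L}. ec (of_int x * of_int \<kappa> / of_int L)"
  have "(\<Sum>\<kappa>\<in>{0..<\<bar>L\<bar>}. ec (of_int x * of_int (\<kappa> + 1) / of_int L)) = (\<Sum>\<kappa>\<in>{0..<\<bar>L\<bar>}. ec (of_int x * of_int \<kappa> / of_int L))"
  proof (rule sum_periodic_shift)
    fix y i
    show "ec (of_int x * of_int (y + L * i) / of_int L) = ec (of_int x * of_int y / of_int L)"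
      using L by (intro ec_cong_Ints) (simp add: field_simps)
  qed (use L in auto)
  moreover have "ec (of_int x * of_int (\<kappa> + 1) / of_int L) = ec (of_int x / of_int L) * ec (of_int x * of_int \<kappa> / of_int L)" for \<kappa>
    unfolding ec_add[symmetric] by (simp add: add_divide_distrib distrib_left add.commute)
  ultimately have "ec (of_int x / of_int L) * ?S = ?S"
    using L by (simp add: sum_distrib_left)
  hence "(ec (of_int x / of_int L) - 1) * ?S = 0" by (simp add: left_diff_distrib)
  moreover have "ec (of_int x / of_int L) \<noteq> 1"
  proof
    assume "ec (of_int x / of_int L) = 1"
    then obtain j where "of_int x / of_int L = real_of_int j" unfolding ec_eq_1_iff by (auto elim: Ints_cases)
    hence "real_of_int x = of_int (L * j)" using L by (simp add: field_simps)
    hence "x = L * j" by linarith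
    thus False using False by simp
  qed
  ultimately show ?thesis using False by simp
qed

text \<open>The numbers \<open>p\<close>, \<open>q\<close>, \<open>r\<close> are the entries of
  \<open>A\<close>. The diagonal may be odd, so \<open>Qf\<close> is only half-integral; the modulus
  \<open>2 * c\<close> and the parity conditions below come from this.\<close>

locale int_binary_form =
  fixes p q r :: int
begin

definition Qf :: "int \<Rightarrow> int \<Rightarrow> real" where
  "Qf x y = (of_int p * (of_int x)\<^sup>2 + 2 * of_int q * of_int x * of_int y + of_int r * (of_int y)\<^sup>2) / 2"

definition Bf :: "int \<Rightarrow> int \<Rightarrow> int \<Rightarrow> int \<Rightarrow> int" where
  "Bf x y s t = p * x * s + q * (x * t + y * s) + r * y * t"

definition dsc :: int where "dsc = p * r - q\<^sup>2"

lemma Qf_add: "Qf (x + s) (y + t) = Qf x y + of_int (Bf x y s t) + Qf s t"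
  by (simp add: Qf_def Bf_def power2_eq_square field_simps)

lemma Qf_scale: "Qf (k * x) (k * y) = (of_int k)\<^sup>2 * Qf x y"
  by (simp add: Qf_def power2_eq_square field_simps)

lemma two_Qf: "2 * Qf x y = of_int (Bf x y x y)"
  by (simp add: Qf_def Bf_def power2_eq_square field_simps)

lemma two_Qf_Ints: "even k \<Longrightarrow> of_int k * Qf x y \<in> \<int>"
proof (elim evenE)
  fix j assume "k = 2 * j"
  hence "of_int k * Qf x y = of_int (j * Bf x y x y)" using two_Qf[of x y] by simp
  thus "of_int k * Qf x y \<in> \<int>" by (simp only: Ints_of_int)
qed

text \<open>The quadratic phase has period \<open>2 * c\<close>, in general not \<open>c\<close>,
  because \<open>Qf\<close> is half-integral. The frequencies \<open>k\<close>, \<open>l\<close>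
  come from Poisson summation over a residue class modulo \<open>2 * c\<close>.\<close>

definition gauss_term where
  "gauss_term m a c k l x y = m x y * ec (of_int a * Qf x y / of_int c) * ec (- of_int (k * x + l * y) / of_int (2 * c))"

definition gauss_sum :: "(int \<Rightarrow> int \<Rightarrow> complex) \<Rightarrow> int \<Rightarrow> int \<Rightarrow> int \<Rightarrow> int \<Rightarrow> complex" where
  "gauss_sum m a c k l = (\<Sum>x\<in>{0..<\<bar>2 * c\<bar>}. \<Sum>y\<in>{0..<\<bar>2 * c\<bar>}. gauss_term m a c k l x y)"

definition gauss_const :: "int \<Rightarrow> int \<Rightarrow> int \<Rightarrow> complex" where
  "gauss_const L a c = (\<Sum>x\<in>{0..<\<bar>2 * c\<bar>}. \<Sum>y\<in>{0..<\<bar>2 * c\<bar>}.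
     if L dvd x \<and> L dvd y then ec (of_int a * Qf x y / of_int c) else 0)"

text \<open>The last factor gathers all that a translation adds to the phase. Periodicity, vanishing
  and evaluation of the Gauss sums are read off from it with different choices of
  \<open>(s, t)\<close>.\<close>

lemma gauss_term_shift:
  "gauss_term m a c k l (x + s) (y + t) =
     m (x + s) (y + t) * ec (of_int a * Qf x y / of_int c) * ec (- of_int (k * x + l * y) / of_int (2 * c))
     * ec (of_int a * (of_int (Bf x y s t) + Qf s t) / of_int c - of_int (k * s + l * t) / of_int (2 * c))"
proof -
  have "of_int a * Qf (x + s) (y + t) / of_int c + - of_int (k * (x + s) + l * (y + t)) / of_int (2 * c) =
     of_int a * Qf x y / of_int c + - of_int (k * x + l * y) / of_int (2 * c)
     + (of_int a * (of_int (Bf x y s t) + Qf s t) / of_int c - of_int (k * s + l * t) / of_int (2 * c))"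
    unfolding Qf_add by (cases "c = 0") (simp_all add: field_simps)
  thus ?thesis unfolding gauss_term_def by (simp only: mult.assoc ec_add[symmetric])
qed

lemma per2_gauss_term:
  assumes c: "c \<noteq> 0" and m: "per2 L m" and L: "L dvd 2 * c"
  shows "per2 (2 * c) (gauss_term m a c k l)"
  unfolding per2_def
proof (intro allI)
  fix x y i j
  from L obtain e where e: "2 * c = L * e" by blast
  have m': "m (x + 2 * c * i) (y + 2 * c * j) = m x y"
    using m unfolding per2_def e mult.assoc by blast
  have "Bf x y (2 * c * i) (2 * c * j) = 2 * c * Bf x y i j" by (simp add: Bf_def algebra_simps)
  hence "of_int a * (of_int (Bf x y (2 * c * i) (2 * c * j)) + Qf (2 * c * i) (2 * c * j)) / of_int c
     - of_int (k * (2 * c * i) + l * (2 * c * j)) / of_int (2 * c) =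
     of_int (2 * a * Bf x y i j - (k * i + l * j)) + of_int (4 * a * c) * Qf i j"
    unfolding Qf_scale using c by (simp add: power2_eq_square field_simps)
  also have "\<dots> \<in> \<int>" by (intro Ints_add Ints_of_int two_Qf_Ints) auto
  finally show "gauss_term m a c k l (x + 2 * c * i) (y + 2 * c * j) = gauss_term m a c k l x y"
    unfolding gauss_term_shift m' by (simp add: gauss_term_def)
qed

text \<open>A shift of the summation variable by \<open>c A\<^sup>-\<^sup>1 \<kappa>\<close> multiplies the sum by a root of unity, hence by 1 unless the sum vanishes.\<close>
lemma gauss_sum_vanishes:
  assumes L: "L > 0" and D: "dsc \<noteq> 0" and c: "c \<noteq> 0" and m: "per2 L m"
    and c0: "c = 2 * L * L * dsc * c0" and ne: "gauss_sum m a c k l \<noteq> 0"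
  shows "\<exists>\<nu>1 \<nu>2. k = 2 * (p * \<nu>1 + q * \<nu>2) \<and> l = 2 * (q * \<nu>1 + r * \<nu>2)"
proof -
  have "L dvd 2 * c" using c0 by simp
  from per2_gauss_term[OF c m this] have per: "per2 (2 * c) (gauss_term m a c k l)" .
  have key: "of_int (\<kappa>1 * (r * k - q * l) + \<kappa>2 * (p * l - q * k)) / of_int (2 * dsc) \<in> (\<int> :: real set)" for \<kappa>1 \<kappa>2
  proof -
    \<comment> \<open>The pair \<open>(s, t)\<close> is \<open>c A\<^sup>-\<^sup>1 \<kappa>\<close>,
      written with the adjugate of \<open>A\<close> and \<open>c / dsc = 2 L\<^sup>2 c0\<close>. It
      lies in \<open>L Z\<^sup>2\<close>, so \<open>m\<close> is unaffected by the shift.\<close>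
    define s where "s = 2 * L * L * c0 * (r * \<kappa>1 - q * \<kappa>2)"
    define t where "t = 2 * L * L * c0 * (p * \<kappa>2 - q * \<kappa>1)"
    let ?\<phi> = "ec (- (of_int (\<kappa>1 * (r * k - q * l) + \<kappa>2 * (p * l - q * k)) / of_int (2 * dsc)))"
    have "gauss_term m a c k l (x + s) (y + t) = gauss_term m a c k l x y * ?\<phi>" for x y
    proof -
      have "m (x + L * (2 * L * c0 * (r * \<kappa>1 - q * \<kappa>2))) (y + L * (2 * L * c0 * (p * \<kappa>2 - q * \<kappa>1))) = m x y"
        using m unfolding per2_def by blast
      hence m': "m (x + s) (y + t) = m x y" by (simp add: s_def t_def mult_ac)
      have B: "Bf x y s t = c * (x * \<kappa>1 + y * \<kappa>2)" for x y
        unfolding c0 s_def t_def Bf_def dsc_def by (simp add: power2_eq_square algebra_simps)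
      have "2 * Qf s t = of_int (2 * (c * (L * L * c0 * (r * \<kappa>1 - q * \<kappa>2) * \<kappa>1 + L * L * c0 * (p * \<kappa>2 - q * \<kappa>1) * \<kappa>2)))"
        unfolding two_Qf B by (simp add: s_def t_def algebra_simps)
      hence Q: "Qf s t = of_int (c * (L * L * c0 * (r * \<kappa>1 - q * \<kappa>2) * \<kappa>1 + L * L * c0 * (p * \<kappa>2 - q * \<kappa>1) * \<kappa>2))"
        by simp
      have ph: "of_int (k * s + l * t) / of_int (2 * c) = (of_int (\<kappa>1 * (r * k - q * l) + \<kappa>2 * (p * l - q * k)) / of_int (2 * dsc) :: real)"
      proof -
        have "k * s + l * t = (2 * L * L * c0) * (\<kappa>1 * (r * k - q * l) + \<kappa>2 * (p * l - q * k))"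
          by (simp add: s_def t_def algebra_simps)
        moreover have "2 * c = (2 * L * L * c0) * (2 * dsc)" by (simp add: c0)
        moreover have "2 * L * L * c0 \<noteq> 0" using c c0 by auto
        moreover have "W \<noteq> 0 \<Longrightarrow> of_int (W * R) / of_int (W * E) = (of_int R / of_int E :: real)" for W R E :: int
          by simp
        ultimately show ?thesis by (simp only: not_False_eq_True)
      qed
      have "ec (of_int a * (of_int (Bf x y s t) + Qf s t) / of_int c - of_int (k * s + l * t) / of_int (2 * c)) = ?\<phi>"
        unfolding ph
      proof (rule ec_cong_Ints)
        have "of_int a * (of_int (Bf x y s t) + Qf s t) / of_int c =
           (of_int (a * ((x * \<kappa>1 + y * \<kappa>2) + (L * L * c0 * (r * \<kappa>1 - q * \<kappa>2) * \<kappa>1 + L * L * c0 * (p * \<kappa>2 - q * \<kappa>1) * \<kappa>2))) :: real)"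
          unfolding B Q of_int_mult[of c] distrib_left[symmetric] using c by (simp add: mult_ac)
        also have "\<dots> \<in> \<int>" by (rule Ints_of_int)
        finally show "of_int a * (of_int (Bf x y s t) + Qf s t) / of_int c - of_int (\<kappa>1 * (r * k - q * l) + \<kappa>2 * (p * l - q * k)) / of_int (2 * dsc)
          - - (of_int (\<kappa>1 * (r * k - q * l) + \<kappa>2 * (p * l - q * k)) / of_int (2 * dsc)) \<in> (\<int> :: real set)" by simp
      qed
      thus ?thesis unfolding gauss_term_shift m' by (simp add: gauss_term_def)
    qed
    hence "gauss_sum m a c k l * ?\<phi> = gauss_sum m a c k l"
      using sum_per2_shift[OF _ per, of s t] c by (simp add: gauss_sum_def sum_distrib_right)
    hence "?\<phi> = 1" using ne by simp
    thus ?thesis by (simp add: ec_eq_1_iff)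
  qed
  \<comment> \<open>The unit vectors as \<open>\<kappa>\<close> show that both coordinates of
    \<open>A\<^sup>-\<^sup>1 (k, l) / 2\<close> are integers; these are \<open>\<nu>1\<close> and
    \<open>\<nu>2\<close>.\<close>
  from key[of 1 0] key[of 0 1] obtain \<nu>1 \<nu>2 where
    n: "of_int (r * k - q * l) / of_int (2 * dsc) = real_of_int \<nu>1" "of_int (p * l - q * k) / of_int (2 * dsc) = real_of_int \<nu>2"
    by (auto elim!: Ints_cases)
  have "real_of_int (r * k - q * l) = of_int (2 * dsc * \<nu>1)" "real_of_int (p * l - q * k) = of_int (2 * dsc * \<nu>2)"
    using n D by (simp_all add: field_simps)
  hence n1: "r * k - q * l = 2 * dsc * \<nu>1" and n2: "p * l - q * k = 2 * dsc * \<nu>2" by linarith+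
  have "dsc * k = p * (r * k - q * l) + q * (p * l - q * k)" "dsc * l = q * (r * k - q * l) + r * (p * l - q * k)"
    by (simp_all add: dsc_def power2_eq_square algebra_simps)
  hence "dsc * k = dsc * (2 * (p * \<nu>1 + q * \<nu>2))" "dsc * l = dsc * (2 * (q * \<nu>1 + r * \<nu>2))"
    unfolding n1 n2 by (simp_all add: algebra_simps)
  thus ?thesis using D by auto
qed

text \<open>The shift by \<open>d \<nu>\<close> completes the square; averaging over the shifts by \<open>(c/L) A\<^sup>-\<^sup>1 \<kappa>\<close> leaves only the
  residues divisible by \<open>L\<close>, on which the periodic factor is constant.\<close>
lemma gauss_sum_eval:
  assumes L: "L > 0" and D: "dsc \<noteq> 0" and c: "c \<noteq> 0" and m: "per2 L m"
    and c0: "c = 2 * L * L * dsc * c0" and det: "a * d - b * c = 1" and b: "even b"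
    and a: "L dvd a - 1" and d: "L dvd d - 1"
    and k: "k = 2 * (p * \<nu>1 + q * \<nu>2)" and l: "l = 2 * (q * \<nu>1 + r * \<nu>2)"
  shows "gauss_sum m a c k l * ec (of_int d * Qf \<nu>1 \<nu>2 / of_int c) = m \<nu>1 \<nu>2 * gauss_const L a c"
proof -
  have L2c: "L dvd 2 * c" using c0 by simp
  from per2_gauss_term[OF c m this] have per: "per2 (2 * c) (gauss_term m a c k l)" .
  \<comment> \<open>As \<open>d\<close> is 1 modulo \<open>L\<close>, the translation by
    \<open>d * \<nu>\<close> acts on \<open>m\<close> like the translation by
    \<open>\<nu>\<close>.\<close>
  define m' where "m' = (\<lambda>x y. m (x + \<nu>1) (y + \<nu>2))"
  have perm': "per2 L m'"
    unfolding per2_def m'_def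
  proof (intro allI)
    fix x y i j
    show "m (x + L * i + \<nu>1) (y + L * j + \<nu>2) = m (x + \<nu>1) (y + \<nu>2)"
      using m[unfolded per2_def, rule_format, of "x + \<nu>1" i "y + \<nu>2" j] by (simp add: algebra_simps)
  qed
  define T where "T = (\<lambda>x y. gauss_term m' a c 0 0 x y)"
  have perT: "per2 (2 * c) T" unfolding T_def by (rule per2_gauss_term[OF c perm' L2c])
  have "gauss_term m a c k l (x + d * \<nu>1) (y + d * \<nu>2) = T x y * ec (- (of_int d * Qf \<nu>1 \<nu>2 / of_int c))" for x y
  proof -
    obtain e where e: "d = 1 + L * e" using d by (metis dvd_def add_diff_cancel_left' diff_add_cancel add.commute)
    have mm: "m (x + d * \<nu>1) (y + d * \<nu>2) = m' x y"
      using m[unfolded per2_def, rule_format, of "x + \<nu>1" "e * \<nu>1" "y + \<nu>2" "e * \<nu>2"]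
      by (simp add: e m'_def algebra_simps)
    have kl: "k * x + l * y = 2 * Bf x y \<nu>1 \<nu>2" by (simp add: k l Bf_def algebra_simps)
    have kl2: "of_int (k * (d * \<nu>1) + l * (d * \<nu>2)) = (of_int d * (4 * Qf \<nu>1 \<nu>2) :: real)"
    proof -
      have "k * (d * \<nu>1) + l * (d * \<nu>2) = d * (2 * Bf \<nu>1 \<nu>2 \<nu>1 \<nu>2)" by (simp add: k l Bf_def algebra_simps)
      thus ?thesis using two_Qf[of \<nu>1 \<nu>2] by simp
    qed
    have Bd: "Bf x y (d * \<nu>1) (d * \<nu>2) = d * Bf x y \<nu>1 \<nu>2" by (simp add: Bf_def algebra_simps)
    have "- of_int (k * x + l * y) / of_int (2 * c) + (of_int a * (of_int (Bf x y (d * \<nu>1) (d * \<nu>2)) + Qf (d * \<nu>1) (d * \<nu>2)) / of_int c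
       - of_int (k * (d * \<nu>1) + l * (d * \<nu>2)) / of_int (2 * c))
       = of_int (a * d - 1) / of_int c * of_int (Bf x y \<nu>1 \<nu>2) + (of_int d * (of_int (a * d - 1) / of_int c) * Qf \<nu>1 \<nu>2 - of_int d * Qf \<nu>1 \<nu>2 / of_int c)"
      unfolding kl kl2 Bd Qf_scale using c by (simp add: field_simps power2_eq_square)
    \<comment> \<open>\<open>d\<close> inverts \<open>a\<close> modulo \<open>c\<close>, which
      cancels the linear phase. What is left over are integers and \<open>d * b\<close> times
      \<open>Qf \<nu>1 \<nu>2\<close>, which is an integer because \<open>b\<close> is even.\<close>
    moreover have "of_int (a * d - 1) / of_int c = (of_int b :: real)"
    proof -
      have "a * d - 1 = b * c" using det by simp
      thus ?thesis using c by simp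
    qed
    moreover have "ec (of_int b * of_int (Bf x y \<nu>1 \<nu>2) + (of_int d * of_int b * Qf \<nu>1 \<nu>2 - of_int d * Qf \<nu>1 \<nu>2 / of_int c))
       = ec (- (of_int d * Qf \<nu>1 \<nu>2 / of_int c))"
    proof (rule ec_cong_Ints)
      have "of_int (b * Bf x y \<nu>1 \<nu>2) + of_int (d * b) * Qf \<nu>1 \<nu>2 \<in> \<int>"
        using b by (intro Ints_add Ints_of_int two_Qf_Ints) auto
      thus "of_int b * of_int (Bf x y \<nu>1 \<nu>2) + (of_int d * of_int b * Qf \<nu>1 \<nu>2 - of_int d * Qf \<nu>1 \<nu>2 / of_int c)
        - - (of_int d * Qf \<nu>1 \<nu>2 / of_int c) \<in> \<int>" by simp
    qed
    ultimately have "ec (- of_int (k * x + l * y) / of_int (2 * c)) * ec (of_int a * (of_int (Bf x y (d * \<nu>1) (d * \<nu>2)) + Qf (d * \<nu>1) (d * \<nu>2)) / of_int c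
       - of_int (k * (d * \<nu>1) + l * (d * \<nu>2)) / of_int (2 * c)) = ec (- (of_int d * Qf \<nu>1 \<nu>2 / of_int c))"
      unfolding ec_add[symmetric] by (simp only:)
    moreover have "T x y = m' x y * ec (of_int a * Qf x y / of_int c)" by (simp add: T_def gauss_term_def)
    ultimately show ?thesis unfolding gauss_term_shift mm by (simp only: mult.assoc)
  qed
  hence "gauss_sum m a c k l = (\<Sum>x\<in>{0..<\<bar>2 * c\<bar>}. \<Sum>y\<in>{0..<\<bar>2 * c\<bar>}. T x y) * ec (- (of_int d * Qf \<nu>1 \<nu>2 / of_int c))"
    using sum_per2_shift[OF _ per, of "d * \<nu>1" "d * \<nu>2"] c by (simp add: gauss_sum_def sum_distrib_right)
  hence 1: "gauss_sum m a c k l * ec (of_int d * Qf \<nu>1 \<nu>2 / of_int c) = (\<Sum>x\<in>{0..<\<bar>2 * c\<bar>}. \<Sum>y\<in>{0..<\<bar>2 * c\<bar>}. T x y)"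
    by (simp add: mult.assoc ec_add[symmetric])
  let ?e = "\<lambda>x y \<kappa>1 \<kappa>2. ec (of_int x * of_int \<kappa>1 / of_int L) * ec (of_int y * of_int \<kappa>2 / of_int L)"
  have 2: "(\<Sum>x\<in>{0..<\<bar>2 * c\<bar>}. \<Sum>y\<in>{0..<\<bar>2 * c\<bar>}. T x y) = (\<Sum>x\<in>{0..<\<bar>2 * c\<bar>}. \<Sum>y\<in>{0..<\<bar>2 * c\<bar>}. T x y * ?e x y \<kappa>1 \<kappa>2)" for \<kappa>1 \<kappa>2
  proof -
    \<comment> \<open>Now \<open>(s, t)\<close> is
      \<open>(c / L) A\<^sup>-\<^sup>1 \<kappa>\<close>. One factor \<open>L\<close> of
      \<open>c\<close> is given up and the other keeps \<open>s\<close> and \<open>t\<close>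
      divisible by \<open>L\<close>. As \<open>a\<close> is 1 modulo \<open>L\<close>, the shift
      contributes exactly the character of index \<open>\<kappa>\<close> modulo
      \<open>L\<close>.\<close>
    define s where "s = 2 * L * c0 * (r * \<kappa>1 - q * \<kappa>2)"
    define t where "t = 2 * L * c0 * (p * \<kappa>2 - q * \<kappa>1)"
    have "T (x + s) (y + t) = T x y * ?e x y \<kappa>1 \<kappa>2" for x y
    proof -
      have "m' (x + L * (2 * c0 * (r * \<kappa>1 - q * \<kappa>2))) (y + L * (2 * c0 * (p * \<kappa>2 - q * \<kappa>1))) = m' x y"
        using perm' unfolding per2_def by blast
      hence mm: "m' (x + s) (y + t) = m' x y" by (simp add: s_def t_def mult_ac)
      have B: "of_int (Bf x y s t) = (of_int c * (of_int (x * \<kappa>1 + y * \<kappa>2) / of_int L) :: real)" for x y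
      proof -
        have "L * Bf x y s t = c * (x * \<kappa>1 + y * \<kappa>2)"
          unfolding c0 s_def t_def Bf_def dsc_def by (simp add: power2_eq_square algebra_simps)
        hence "real_of_int (L * Bf x y s t) = of_int (c * (x * \<kappa>1 + y * \<kappa>2))" by (simp only:)
        thus ?thesis using L by (simp add: field_simps)
      qed
      have Q: "Qf s t = of_int c * of_int (c0 * ((r * \<kappa>1 - q * \<kappa>2) * \<kappa>1 + (p * \<kappa>2 - q * \<kappa>1) * \<kappa>2))"
      proof -
        have "s * \<kappa>1 + t * \<kappa>2 = L * (2 * (c0 * ((r * \<kappa>1 - q * \<kappa>2) * \<kappa>1 + (p * \<kappa>2 - q * \<kappa>1) * \<kappa>2)))"
          by (simp add: s_def t_def algebra_simps)
        hence "2 * Qf s t = of_int c * (of_int (L * (2 * (c0 * ((r * \<kappa>1 - q * \<kappa>2) * \<kappa>1 + (p * \<kappa>2 - q * \<kappa>1) * \<kappa>2)))) / of_int L)"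
          unfolding two_Qf B by (simp only:)
        thus ?thesis using L by simp
      qed
      obtain e where e: "a = 1 + L * e" using a by (metis dvd_def add_diff_cancel_left' diff_add_cancel add.commute)
      have "ec (of_int a * (of_int (Bf x y s t) + Qf s t) / of_int c - of_int (0 * s + 0 * t) / of_int (2 * c))
          = ec (of_int x * of_int \<kappa>1 / of_int L + of_int y * of_int \<kappa>2 / of_int L)"
      proof (rule ec_cong_Ints)
        have "of_int a * (of_int (Bf x y s t) + Qf s t) / of_int c - of_int (0 * s + 0 * t) / of_int (2 * c)
           - (of_int x * of_int \<kappa>1 / of_int L + of_int y * of_int \<kappa>2 / of_int L)
           = (of_int (e * (x * \<kappa>1 + y * \<kappa>2) + a * (c0 * ((r * \<kappa>1 - q * \<kappa>2) * \<kappa>1 + (p * \<kappa>2 - q * \<kappa>1) * \<kappa>2))) :: real)"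
          unfolding B Q e distrib_left[symmetric] using c L by (simp add: field_simps)
        also have "\<dots> \<in> \<int>" by (rule Ints_of_int)
        finally show "of_int a * (of_int (Bf x y s t) + Qf s t) / of_int c - of_int (0 * s + 0 * t) / of_int (2 * c)
           - (of_int x * of_int \<kappa>1 / of_int L + of_int y * of_int \<kappa>2 / of_int L) \<in> \<int>" .
      qed
      thus ?thesis unfolding T_def gauss_term_shift mm by (simp add: gauss_term_def ec_add)
    qed
    thus ?thesis using sum_per2_shift[OF _ perT, of s t] c by simp
  qed
  have "of_int (L * L) * (\<Sum>x\<in>{0..<\<bar>2 * c\<bar>}. \<Sum>y\<in>{0..<\<bar>2 * c\<bar>}. T x y) =
      (\<Sum>\<kappa>1\<in>{0..<L}. \<Sum>\<kappa>2\<in>{0..<L}. \<Sum>x\<in>{0..<\<bar>2 * c\<bar>}. \<Sum>y\<in>{0..<\<bar>2 * c\<bar>}. T x y)"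
    using L by simp
  also have "\<dots> = (\<Sum>\<kappa>1\<in>{0..<L}. \<Sum>\<kappa>2\<in>{0..<L}. \<Sum>x\<in>{0..<\<bar>2 * c\<bar>}. \<Sum>y\<in>{0..<\<bar>2 * c\<bar>}. T x y * ?e x y \<kappa>1 \<kappa>2)"
    by (intro sum.cong refl 2)
  also have "\<dots> = (\<Sum>x\<in>{0..<\<bar>2 * c\<bar>}. \<Sum>y\<in>{0..<\<bar>2 * c\<bar>}. \<Sum>\<kappa>1\<in>{0..<L}. \<Sum>\<kappa>2\<in>{0..<L}. T x y * ?e x y \<kappa>1 \<kappa>2)"
    by (simp only: sum.swap[of _ "{0..<L}" "{0..<\<bar>2 * c\<bar>}"])
  also have "\<dots> = (\<Sum>x\<in>{0..<\<bar>2 * c\<bar>}. \<Sum>y\<in>{0..<\<bar>2 * c\<bar>}.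
      T x y * ((\<Sum>\<kappa>1\<in>{0..<L}. ec (of_int x * of_int \<kappa>1 / of_int L)) * (\<Sum>\<kappa>2\<in>{0..<L}. ec (of_int y * of_int \<kappa>2 / of_int L))))"
    by (simp only: sum_product) (simp add: sum_distrib_left)
  also have "\<dots> = (\<Sum>x\<in>{0..<\<bar>2 * c\<bar>}. \<Sum>y\<in>{0..<\<bar>2 * c\<bar>}.
      of_int (L * L) * (m \<nu>1 \<nu>2 * (if L dvd x \<and> L dvd y then ec (of_int a * Qf x y / of_int c) else 0)))"
  proof (intro sum.cong refl)
    fix x y
    have "m' x y = m \<nu>1 \<nu>2" if "L dvd x" "L dvd y"
      using that m[unfolded per2_def, rule_format, of \<nu>1 _ \<nu>2] by (auto simp: m'_def add.commute elim!: dvdE)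
    thus "T x y * ((\<Sum>\<kappa>1\<in>{0..<L}. ec (of_int x * of_int \<kappa>1 / of_int L)) * (\<Sum>\<kappa>2\<in>{0..<L}. ec (of_int y * of_int \<kappa>2 / of_int L)))
      = of_int (L * L) * (m \<nu>1 \<nu>2 * (if L dvd x \<and> L dvd y then ec (of_int a * Qf x y / of_int c) else 0))"
      by (simp add: sum_roots_of_unity[OF L] T_def gauss_term_def)
  qed
  also have "\<dots> = of_int (L * L) * (m \<nu>1 \<nu>2 * gauss_const L a c)"
    by (simp add: gauss_const_def sum_distrib_left)
  finally have "(\<Sum>x\<in>{0..<\<bar>2 * c\<bar>}. \<Sum>y\<in>{0..<\<bar>2 * c\<bar>}. T x y) = m \<nu>1 \<nu>2 * gauss_const L a c"
    using L by simp
  thus ?thesis using 1 by simp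
qed

end

subsection \<open>The Siegel theta function and its modularity\<close>

text \<open>Siegel's kernel: with \<open>Q\<^sub>+ = (\<alpha> + \<beta>)\<^sup>2 / 4\<close> and
  \<open>Q\<^sub>- = - (\<alpha> - \<beta>)\<^sup>2 / 4\<close>, whose sum is
  \<open>\<alpha>\<beta>\<close>, it is the exponential of \<open>2\<pi>i\<close> times
  \<open>Q\<^sub>+ \<tau> + Q\<^sub>- cnj \<tau>\<close>.\<close>

definition hyp_gauss :: "complex \<Rightarrow> real \<Rightarrow> real \<Rightarrow> complex" where
  "hyp_gauss \<tau> \<alpha> \<beta> = exp (of_real (2 * pi * Re \<tau> * (\<alpha> * \<beta>)) * \<i> - of_real (pi * Im \<tau> * (\<alpha>\<^sup>2 + \<beta>\<^sup>2)))"

lemma norm_hyp_gauss: "norm (hyp_gauss \<tau> \<alpha> \<beta>) = exp (- (pi * Im \<tau> * (\<alpha>\<^sup>2 + \<beta>\<^sup>2)))"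
  by (simp add: hyp_gauss_def)

lemma hyp_gauss_scale: "hyp_gauss \<tau> (s * \<alpha>) (s * \<beta>) = hyp_gauss (of_real (s\<^sup>2) * \<tau>) \<alpha> \<beta>"
  unfolding hyp_gauss_def by (rule arg_cong[where f = exp]) (simp add: power2_eq_square algebra_simps)

lemma hyp_gauss_add_real: "hyp_gauss (of_real x + \<tau>) \<alpha> \<beta> = ec (x * (\<alpha> * \<beta>)) * hyp_gauss \<tau> \<alpha> \<beta>"
  unfolding hyp_gauss_def ec_def cis_conv_exp exp_add[symmetric]
  by (rule arg_cong[where f = exp]) (simp add: algebra_simps)

text \<open>The integral coefficients are kept apart from the real linear factors, since the factors
  are rescaled along the curve while the integral form, and with it every Gauss sum, stays the
  same.\<close>

locale hyp_binary_form = int_binary_form p q r for p q r :: int +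
  fixes a1 a2 b1 b2 :: real
  assumes pq: "2 * a1 * b1 = of_int p" "a1 * b2 + a2 * b1 = of_int q" "2 * a2 * b2 = of_int r"
    and det_nz: "a1 * b2 - a2 * b1 \<noteq> 0"
begin

definition al :: "real \<Rightarrow> real \<Rightarrow> real" where "al x y = a1 * x + a2 * y"
definition be :: "real \<Rightarrow> real \<Rightarrow> real" where "be x y = b1 * x + b2 * y"

definition \<Delta> :: real where "\<Delta> = a1 * b2 - a2 * b1"

text \<open>Squared determinant over squared Frobenius norm of the matrix of
  \<open>(al, be)\<close>, a lower bound for its smallest squared singular value.\<close>

definition \<kappa> :: real where "\<kappa> = \<Delta>\<^sup>2 / (a1\<^sup>2 + a2\<^sup>2 + b1\<^sup>2 + b2\<^sup>2)"

lemma Delta_nz: "\<Delta> \<noteq> 0" using det_nz by (simp add: \<Delta>_def)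

lemma dsc_eq: "of_int dsc = - \<Delta>\<^sup>2"
  by (simp add: dsc_def \<Delta>_def pq[symmetric] power2_eq_square algebra_simps)

lemma dsc_nz: "dsc \<noteq> 0"
proof
  assume "dsc = 0"
  hence "real_of_int dsc = 0" by simp
  thus False using dsc_eq Delta_nz by simp
qed

lemma Qf_eq: "Qf x y = al (of_int x) (of_int y) * be (of_int x) (of_int y)"
  by (simp add: Qf_def al_def be_def pq[symmetric] power2_eq_square field_simps)

lemma coeff_sum_pos: "a1\<^sup>2 + a2\<^sup>2 + b1\<^sup>2 + b2\<^sup>2 > 0"
proof -
  have "\<not> (a1 = 0 \<and> a2 = 0)" using det_nz by auto
  hence "a1\<^sup>2 + a2\<^sup>2 > 0" by (simp add: sum_power2_gt_zero_iff)
  moreover have "b1\<^sup>2 + b2\<^sup>2 \<ge> 0" by simp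
  ultimately show ?thesis by linarith
qed

lemma kappa_pos: "\<kappa> > 0"
  using coeff_sum_pos Delta_nz by (simp add: \<kappa>_def)

text \<open>Cramer's rule expresses \<open>x\<close> and \<open>y\<close> through the two linear
  forms, and Cauchy-Schwarz bounds the result.\<close>

lemma al_be_ge: "\<kappa> * (x\<^sup>2 + y\<^sup>2) \<le> (al x y)\<^sup>2 + (be x y)\<^sup>2"
proof -
  let ?A = "al x y" and ?B = "be x y"
  have "(\<Delta> * x)\<^sup>2 = (b2 * ?A - a2 * ?B)\<^sup>2" "(\<Delta> * y)\<^sup>2 = (a1 * ?B - b1 * ?A)\<^sup>2"
    by (simp_all add: \<Delta>_def al_def be_def algebra_simps)
  moreover have "(u * s - v * t)\<^sup>2 \<le> (u\<^sup>2 + v\<^sup>2) * (s\<^sup>2 + t\<^sup>2)" for u v s t :: real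
  proof -
    have "0 \<le> (u * t + v * s)\<^sup>2" by simp
    thus ?thesis by (simp add: power2_eq_square algebra_simps)
  qed
  from this[of b2 ?A a2 ?B] this[of a1 ?B b1 ?A]
  have "(b2 * ?A - a2 * ?B)\<^sup>2 + (a1 * ?B - b1 * ?A)\<^sup>2 \<le> (a1\<^sup>2 + a2\<^sup>2 + b1\<^sup>2 + b2\<^sup>2) * (?A\<^sup>2 + ?B\<^sup>2)"
    by (simp add: algebra_simps)
  ultimately have "\<Delta>\<^sup>2 * (x\<^sup>2 + y\<^sup>2) \<le> (a1\<^sup>2 + a2\<^sup>2 + b1\<^sup>2 + b2\<^sup>2) * (?A\<^sup>2 + ?B\<^sup>2)"
    by (simp add: power_mult_distrib distrib_left)
  thus ?thesis using coeff_sum_pos by (simp add: \<kappa>_def field_simps)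
qed

abbreviation T :: "complex \<Rightarrow> real \<Rightarrow> real \<Rightarrow> complex" where
  "T \<tau> x y \<equiv> hyp_gauss \<tau> (al x y) (be x y)"

lemma T_scale: "T \<tau> (s * x) (s * y) = T (of_real (s\<^sup>2) * \<tau>) x y"
proof -
  have "al (s * x) (s * y) = s * al x y" "be (s * x) (s * y) = s * be x y"
    by (simp_all add: al_def be_def algebra_simps)
  thus ?thesis by (simp add: hyp_gauss_scale)
qed

lemma norm_T_le: "Im \<tau> > 0 \<Longrightarrow> norm (T \<tau> x y) \<le> exp (- (pi * Im \<tau> * \<kappa>) * (x\<^sup>2 + y\<^sup>2))"
  unfolding norm_hyp_gauss using al_be_ge[of x y] by (simp add: mult.assoc)

lemma summable_T_shift:
  assumes "Im \<tau> > 0"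
  shows "(\<lambda>(n::int, m::int). norm (T \<tau> (of_int n + w1) (of_int m + w2))) summable_on UNIV"
proof (rule summable_on_comparison_test)
  show "(\<lambda>(n::int, m::int). exp (- (pi * Im \<tau> * \<kappa>) * ((of_int n + w1)\<^sup>2 + (of_int m + w2)\<^sup>2))) summable_on UNIV"
    using assms kappa_pos by (intro summable_gaussian_int_pair_shift) auto
qed (use norm_T_le[OF assms] in auto)

text \<open>The pair \<open>(du k l, dv k l)\<close> is \<open>A\<^sup>-\<^sup>1 (k, l)\<close>, the
  point of the dual lattice with index \<open>(k, l)\<close>.\<close>

abbreviation du :: "int \<Rightarrow> int \<Rightarrow> real" where "du k l \<equiv> of_int (r * k - q * l) / of_int dsc"
abbreviation dv :: "int \<Rightarrow> int \<Rightarrow> real" where "dv k l \<equiv> of_int (p * l - q * k) / of_int dsc"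

text \<open>Up to the factor \<open>1 / \<Delta>\<close> and a sign, passing to the dual point
  rotates the index by a right angle. Therefore \<open>al_be_ge\<close> also bounds the theta kernel
  on the dual lattice.\<close>

lemma al_dual:
  "al (du k l) (dv k l) = al (of_int l) (- of_int k) / \<Delta>"
proof -
  have e: "a1 * of_int (r * k - q * l) + a2 * of_int (p * l - q * k) = - \<Delta> * al (of_int l) (- of_int k)"
    by (simp add: pq[symmetric] \<Delta>_def al_def algebra_simps)
  have "al (du k l) (dv k l)
      = (a1 * of_int (r * k - q * l) + a2 * of_int (p * l - q * k)) / of_int dsc"
    by (simp add: al_def[of "_ / _"] add_divide_distrib)
  thus ?thesis unfolding e dsc_eq using Delta_nz by (simp add: power2_eq_square)
qed

lemma be_dual:
  "be (du k l) (dv k l) = - be (of_int l) (- of_int k) / \<Delta>"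
proof -
  have e: "b1 * of_int (r * k - q * l) + b2 * of_int (p * l - q * k) = \<Delta> * be (of_int l) (- of_int k)"
    by (simp add: pq[symmetric] \<Delta>_def be_def algebra_simps)
  have "be (du k l) (dv k l)
      = (b1 * of_int (r * k - q * l) + b2 * of_int (p * l - q * k)) / of_int dsc"
    by (simp add: be_def[of "_ / _"] add_divide_distrib)
  thus ?thesis unfolding e dsc_eq using Delta_nz by (simp add: power2_eq_square)
qed

lemma summable_T_dual:
  assumes \<tau>: "Im \<tau> > 0"
  shows "(\<lambda>(k::int, l::int). T \<tau> (du k l) (dv k l) * ec (f k l)) summable_on UNIV"
proof (rule norm_summable_onI(1))
  show "(\<lambda>(k::int, l::int). exp (- (Im \<tau> * (pi * \<kappa> / \<Delta>\<^sup>2)) * ((of_int k)\<^sup>2 + (of_int l)\<^sup>2))) summable_on UNIV"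
    using kappa_pos Delta_nz by (intro summable_gaussian_int_pair mult_pos_pos[OF \<tau>] divide_pos_pos mult_pos_pos) auto
  fix pr :: "int \<times> int"
  obtain k l where pr: "pr = (k, l)" by (cases pr)
  have "\<kappa> * ((of_int k)\<^sup>2 + (of_int l)\<^sup>2) \<le> (al (of_int l) (- of_int k))\<^sup>2 + (be (of_int l) (- of_int k))\<^sup>2"
    using al_be_ge[of "of_int l" "- of_int k"] by (simp add: add.commute)
  hence "\<kappa> * ((of_int k)\<^sup>2 + (of_int l)\<^sup>2) / \<Delta>\<^sup>2 \<le> ((al (of_int l) (- of_int k))\<^sup>2 + (be (of_int l) (- of_int k))\<^sup>2) / \<Delta>\<^sup>2"
    by (rule divide_right_mono) simp
  hence "\<kappa> / \<Delta>\<^sup>2 * ((of_int k)\<^sup>2 + (of_int l)\<^sup>2) \<le> (al (of_int l) (- of_int k) / \<Delta>)\<^sup>2 + (- be (of_int l) (- of_int k) / \<Delta>)\<^sup>2"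
    by (simp add: power_divide add_divide_distrib)
  hence "Im \<tau> * pi * (\<kappa> / \<Delta>\<^sup>2 * ((of_int k)\<^sup>2 + (of_int l)\<^sup>2)) \<le> Im \<tau> * pi * ((al (of_int l) (- of_int k) / \<Delta>)\<^sup>2 + (- be (of_int l) (- of_int k) / \<Delta>)\<^sup>2)"
    by (intro mult_left_mono mult_nonneg_nonneg less_imp_le[OF \<tau>]) auto
  thus "norm (case pr of (k, l) \<Rightarrow> T \<tau> (du k l) (dv k l) * ec (f k l))
    \<le> (case pr of (k, l) \<Rightarrow> exp (- (Im \<tau> * (pi * \<kappa> / \<Delta>\<^sup>2)) * ((of_int k)\<^sup>2 + (of_int l)\<^sup>2)))"
    unfolding pr prod.case norm_mult norm_hyp_gauss al_dual be_dual ec_def norm_cis by (simp add: mult_ac)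
qed

text \<open>The kernel is the Gaussian of \<open>Im \<tau> M\<^sup>T M - \<i> Re \<tau> A\<close>,
  where \<open>M\<close> is the matrix of \<open>(al, be)\<close>. For signature (1,1) the
  determinant of this complex matrix is the positive number
  \<open>(\<Delta> * norm \<tau>)^2\<close>, which is why the absolute value of
  \<open>\<tau>\<close> appears and no power of \<open>\<tau>\<close> itself.\<close>

lemma theta_inversion:
  assumes \<tau>: "Im \<tau> > 0"
  shows "(\<Sum>\<^sub>\<infinity>(n::int, m::int). T \<tau> (of_int n + w1) (of_int m + w2)) =
    (\<Sum>\<^sub>\<infinity>(k::int, l::int). T (- 1 / \<tau>) (du k l) (dv k l)
       * ec (- (of_int k * w1 + of_int l * w2))) / of_real (\<bar>\<Delta>\<bar> * norm \<tau>)"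
proof -
  define X where "X = Re \<tau>"
  define Y where "Y = Im \<tau>"
  have Y: "Y > 0" using \<tau> by (simp add: Y_def)
  define z11 where "z11 = Complex (Y * (a1\<^sup>2 + b1\<^sup>2)) (- 2 * X * a1 * b1)"
  define z12 where "z12 = Complex (Y * (a1 * a2 + b1 * b2)) (- X * (a1 * b2 + a2 * b1))"
  define z22 where "z22 = Complex (Y * (a2\<^sup>2 + b2\<^sup>2)) (- 2 * X * a2 * b2)"
  interpret F: complex_binary_form z11 z12 z22 "Y * \<kappa>"
  proof
    show "Y * \<kappa> > 0" using Y kappa_pos by simp
    fix x y :: real
    have "Y * \<kappa> * (x\<^sup>2 + y\<^sup>2) \<le> Y * ((al x y)\<^sup>2 + (be x y)\<^sup>2)"
      using Y al_be_ge[of x y] by (simp add: mult.assoc)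
    also have "\<dots> = Re z11 * x\<^sup>2 + 2 * Re z12 * x * y + Re z22 * y\<^sup>2"
      by (simp add: z11_def z12_def z22_def al_def be_def power2_eq_square algebra_simps)
    finally show "Y * \<kappa> * (x\<^sup>2 + y\<^sup>2) \<le> Re z11 * x\<^sup>2 + 2 * Re z12 * x * y + Re z22 * y\<^sup>2" .
  qed
  have nt: "(norm \<tau>)\<^sup>2 = X\<^sup>2 + Y\<^sup>2" by (simp add: cmod_power2 X_def Y_def)
  have disc: "F.disc = of_real ((\<Delta> * norm \<tau>)\<^sup>2)"
    unfolding F.disc_def power_mult_distrib nt
    by (simp add: complex_eq_iff z11_def z12_def z22_def \<Delta>_def power2_eq_square algebra_simps)
  have T_form: "T \<tau> x y = exp (- of_real pi * F.form (of_real x) (of_real y))" for x y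
    unfolding hyp_gauss_def F.form_def
    by (rule arg_cong[where f = exp])
       (simp add: complex_eq_iff z11_def z12_def z22_def al_def be_def X_def[symmetric] Y_def[symmetric] power2_eq_square algebra_simps)
  have dual: "exp (- of_real pi * (z22 * (of_int k)\<^sup>2 - 2 * z12 * of_int k * of_int l + z11 * (of_int l)\<^sup>2) / F.disc
        + 2 * of_real pi * \<i> * (of_int k * of_real w1 + of_int l * of_real w2))
      = T (- 1 / \<tau>) (du k l) (dv k l) * ec (of_int k * w1 + of_int l * w2)" for k l :: int
  proof -
    define al0 where "al0 = al (of_int l) (- of_int k)"
    define be0 where "be0 = be (of_int l) (- of_int k)"
    note al = al_dual[of k l, folded al0_def] and be = be_dual[of k l, folded be0_def]
    have t0: "X\<^sup>2 + Y\<^sup>2 > 0" using Y by (simp add: sum_power2_gt_zero_iff)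
    have im: "Im (- 1 / \<tau>) = Y / (X\<^sup>2 + Y\<^sup>2)" and re: "Re (- 1 / \<tau>) = - X / (X\<^sup>2 + Y\<^sup>2)"
      by (simp_all add: Im_divide Re_divide X_def Y_def)
    have num: "z22 * (of_int k)\<^sup>2 - 2 * z12 * of_int k * of_int l + z11 * (of_int l)\<^sup>2 = Complex (Y * (al0\<^sup>2 + be0\<^sup>2)) (- 2 * X * al0 * be0)"
      by (simp add: complex_eq_iff z11_def z12_def z22_def al0_def be0_def al_def be_def power2_eq_square algebra_simps)
    have "- of_real pi * (z22 * (of_int k)\<^sup>2 - 2 * z12 * of_int k * of_int l + z11 * (of_int l)\<^sup>2) / F.disc =
       of_real (2 * pi * Re (- 1 / \<tau>) * (al0 / \<Delta> * (- be0 / \<Delta>))) * \<i> - of_real (pi * Im (- 1 / \<tau>) * ((al0 / \<Delta>)\<^sup>2 + (- be0 / \<Delta>)\<^sup>2))"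
      unfolding num disc im re power_mult_distrib nt using t0 Delta_nz
      by (simp add: complex_eq_iff Re_divide_of_real Im_divide_of_real divide_simps power2_eq_square del: of_real_mult of_real_add of_real_power)
    thus ?thesis unfolding hyp_gauss_def al be ec_def cis_conv_exp exp_add[symmetric]
      by (simp add: algebra_simps)
  qed
  have im': "Im (- 1 / \<tau>) > 0"
    using \<tau> by (simp add: Im_divide sum_power2_gt_zero_iff)
  note summ = summable_T_dual[OF im', of "\<lambda>k l. of_int k * w1 + of_int l * w2"]
  \<comment> \<open>\<open>F.disc / z11\<close> is a positive multiple of \<open>cnj z11\<close>, so
    the two principal roots are conjugate up to a positive factor and their product is
    positive.\<close>
  have sqrt: "csqrt z11 * csqrt (F.disc / z11) = of_real (\<bar>\<Delta>\<bar> * norm \<tau>)"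
  proof -
    let ?s = "csqrt z11 * csqrt (F.disc / z11)"
    have "\<tau> \<noteq> 0" using \<tau> by auto
    hence n0: "\<bar>\<Delta>\<bar> * norm \<tau> > 0" using Delta_nz by simp
    have pos: "F.disc / z11 = of_real ((\<Delta> * norm \<tau>)\<^sup>2 / (norm z11)\<^sup>2) * cnj z11"
      unfolding disc using F.z11_nz by (simp add: complex_div_cnj[of _ z11])
    have "csqrt (F.disc / z11) = of_real (\<bar>\<Delta>\<bar> * norm \<tau> / norm z11) * cnj (csqrt z11)"
    proof (rule csqrt_unique)
      have "(cnj (csqrt z11))\<^sup>2 = cnj z11" by (simp flip: complex_cnj_power)
      thus "(of_real (\<bar>\<Delta>\<bar> * norm \<tau> / norm z11) * cnj (csqrt z11))\<^sup>2 = F.disc / z11"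
        unfolding pos by (simp add: power_mult_distrib power_divide flip: of_real_power)
      have "Re (csqrt z11) > 0" using F.Re_z11_pos
        by (simp add: add_nonneg_pos)
      hence "Re (of_real (\<bar>\<Delta>\<bar> * norm \<tau> / norm z11) * cnj (csqrt z11)) > 0"
        using n0 F.z11_nz by (simp add: divide_pos_pos mult_pos_pos)
      thus "0 < Re (of_real (\<bar>\<Delta>\<bar> * norm \<tau> / norm z11) * cnj (csqrt z11)) \<or>
         Re (of_real (\<bar>\<Delta>\<bar> * norm \<tau> / norm z11) * cnj (csqrt z11)) = 0 \<and> 0 \<le> Im (of_real (\<bar>\<Delta>\<bar> * norm \<tau> / norm z11) * cnj (csqrt z11))" by blast
    qed
    hence "?s = of_real (\<bar>\<Delta>\<bar> * norm \<tau> / norm z11) * (csqrt z11 * cnj (csqrt z11))" by simp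
    also have "csqrt z11 * cnj (csqrt z11) = of_real ((norm (csqrt z11))\<^sup>2)" by (rule complex_norm_square[symmetric])
    finally show ?thesis using F.z11_nz by (simp add: norm_csqrt)
  qed
  have "(\<Sum>\<^sub>\<infinity>(n::int, m::int). T \<tau> (of_int n + w1) (of_int m + w2)) =
    (\<Sum>\<^sub>\<infinity>(k::int, l::int). T (- 1 / \<tau>) (du k l) (dv k l)
       * ec (of_int k * w1 + of_int l * w2)) / of_real (\<bar>\<Delta>\<bar> * norm \<tau>)"
    using F.poisson_gaussian_2d[of w1 w2] summ unfolding dual sqrt T_form by simp
  \<comment> \<open>The kernel is even, so the index may be negated; the resulting sign of the phase
    is the one in \<open>gauss_term\<close>.\<close>
  also have "(\<Sum>\<^sub>\<infinity>(k::int, l::int). T (- 1 / \<tau>) (du k l) (dv k l)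
       * ec (of_int k * w1 + of_int l * w2)) =
     (\<Sum>\<^sub>\<infinity>(k::int, l::int). T (- 1 / \<tau>) (du k l) (dv k l)
       * ec (- (of_int k * w1 + of_int l * w2)))"
  proof (rule infsum_reindex_bij_witness[of _ "\<lambda>(k, l). (- k, - l)" "\<lambda>(k, l). (- k, - l)"])
    fix pr :: "int \<times> int"
    obtain k l where pr: "pr = (k, l)" by (cases pr)
    have "of_int (r * - k - q * - l) / of_int dsc = (- 1 :: real) * (of_int (r * k - q * l) / of_int dsc)"
      "of_int (p * - l - q * - k) / of_int dsc = (- 1 :: real) * (of_int (p * l - q * k) / of_int dsc)"
      by (simp_all add: diff_divide_distrib minus_divide_left)
    hence "T (- 1 / \<tau>) (of_int (r * - k - q * - l) / of_int dsc) (of_int (p * - l - q * - k) / of_int dsc)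
       = T (- 1 / \<tau>) (du k l) (dv k l)"
      using T_scale[of "- 1 / \<tau>" "- 1" "of_int (r * k - q * l) / of_int dsc" "of_int (p * l - q * k) / of_int dsc"] by (simp only:) simp
    thus "(case (case pr of (k, l) \<Rightarrow> (- k, - l)) of (k, l) \<Rightarrow> T (- 1 / \<tau>) (du k l) (dv k l)
       * ec (- (of_int k * w1 + of_int l * w2))) =
       (case pr of (k, l) \<Rightarrow> T (- 1 / \<tau>) (du k l) (dv k l)
       * ec (of_int k * w1 + of_int l * w2))"
      unfolding pr by simp
  qed auto
  finally show ?thesis .
qed

end

section \<open>Theta series with periodic coefficients and their transformation\<close>

lemma has_sum_finite_sum:
  fixes f :: "'i \<Rightarrow> 'a \<Rightarrow> 'b :: topological_comm_monoid_add"
  assumes "finite I" "\<And>i. i \<in> I \<Longrightarrow> (f i has_sum s i) A"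
  shows "((\<lambda>x. \<Sum>i\<in>I. f i x) has_sum (\<Sum>i\<in>I. s i)) A"
  using assms by (induction I rule: finite_induct) (auto intro!: has_sum_add)

lemma per2_bounded:
  assumes L: "L > 0" and m: "per2 L m"
  obtains B where "B > 0" "\<And>x y. norm (m x y) \<le> B"
proof -
  define B where "B = (\<Sum>x\<in>{0..<L}. \<Sum>y\<in>{0..<L}. norm (m x y)) + 1"
  have "norm (m x y) \<le> B" for x y
  proof -
    have "m x y = m (x mod L) (y mod L)"
      using m[unfolded per2_def, rule_format, of "x mod L" "x div L" "y mod L" "y div L"] by simp
    also have "norm \<dots> \<le> (\<Sum>y\<in>{0..<L}. norm (m (x mod L) y))"
      using L by (intro member_le_sum) auto
    also have "\<dots> \<le> (\<Sum>x\<in>{0..<L}. \<Sum>y\<in>{0..<L}. norm (m x y))"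
      using L by (intro member_le_sum[of "x mod L" _ "\<lambda>x. \<Sum>y\<in>{0..<L}. norm (m x y)"]) (auto intro: sum_nonneg)
    finally show ?thesis by (simp add: B_def)
  qed
  moreover have "B > 0" unfolding B_def by (intro add_nonneg_pos sum_nonneg) auto
  ultimately show ?thesis using that by blast
qed

text \<open>Division with remainder is by the absolute value of \<open>K\<close>; for negative
  \<open>K\<close> the sign is moved into the quotient, which keeps the arguments in the form
  \<open>x + K * i\<close>.\<close>

lemma infsum_residue_classes:
  fixes F :: "int \<Rightarrow> int \<Rightarrow> complex"
  assumes K: "K \<noteq> 0" and F: "(\<lambda>(x, y). F x y) summable_on UNIV"
  shows "(\<Sum>\<^sub>\<infinity>(x, y). F x y) = (\<Sum>x\<in>{0..<\<bar>K\<bar>}. \<Sum>y\<in>{0..<\<bar>K\<bar>}. \<Sum>\<^sub>\<infinity>(i, j). F (x + K * i) (y + K * j))"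
proof -
  let ?R = "{0..<\<bar>K\<bar>}"
  let ?h = "\<lambda>((x, y), (i, j)). (x + K * i, y + K * j)"
  have recon: "x mod \<bar>K\<bar> + K * (sgn K * (x div \<bar>K\<bar>)) = x" for x
    by (simp add: mult.assoc[symmetric] abs_sgn[symmetric])
  have uniq1: "(x + K * i) mod \<bar>K\<bar> = x" if "x \<in> ?R" for x i
  proof -
    have "K * i = \<bar>K\<bar> * (sgn K * i)" by (simp add: mult.assoc[symmetric] abs_mult_sgn mult.commute[of "\<bar>K\<bar>"])
    thus ?thesis using that by (simp only:) simp
  qed
  have bij: "bij_betw ?h ((?R \<times> ?R) \<times> UNIV) UNIV"
  proof (rule bij_betw_imageI)
    show "inj_on ?h ((?R \<times> ?R) \<times> UNIV)"
    proof (rule inj_onI, clarsimp simp only: prod.inject mem_Times_iff fst_conv snd_conv prod.case)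
      fix x y i j x' y' i' j'
      assume A: "x \<in> ?R" "y \<in> ?R" "x' \<in> ?R" "y' \<in> ?R" "x + K * i = x' + K * i'" "y + K * j = y' + K * j'"
      have "x = x'" "y = y'" using uniq1[OF A(1), of i] uniq1[OF A(3), of i'] uniq1[OF A(2), of j] uniq1[OF A(4), of j'] A by simp_all
      thus "((x = x' \<and> y = y') \<and> i = i' \<and> j = j')" using A K by simp
    qed
    show "?h ` ((?R \<times> ?R) \<times> UNIV) = UNIV"
    proof (intro equalityI subsetI UNIV_I)
      fix n :: "int \<times> int"
      obtain x y where n: "n = (x, y)" by (cases n)
      have "n = ?h ((x mod \<bar>K\<bar>, y mod \<bar>K\<bar>), (sgn K * (x div \<bar>K\<bar>), sgn K * (y div \<bar>K\<bar>)))"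
        by (simp add: n recon)
      moreover have "((x mod \<bar>K\<bar>, y mod \<bar>K\<bar>), (sgn K * (x div \<bar>K\<bar>), sgn K * (y div \<bar>K\<bar>))) \<in> (?R \<times> ?R) \<times> UNIV"
        using K by simp
      ultimately show "n \<in> ?h ` ((?R \<times> ?R) \<times> UNIV)" by blast
    qed
  qed
  let ?g = "\<lambda>r n. case ?h (r, n) of (x, y) \<Rightarrow> F x y"
  have "(\<lambda>rn. case ?h rn of (x, y) \<Rightarrow> F x y) summable_on ((?R \<times> ?R) \<times> UNIV)"
    using summable_on_reindex_bij_betw[OF bij, of "\<lambda>(x, y). F x y"] F by simp
  hence s: "(\<lambda>(r, n). ?g r n) summable_on ((?R \<times> ?R) \<times> UNIV)" by (simp add: case_prod_unfold)
  have "(\<Sum>\<^sub>\<infinity>(x, y). F x y) = (\<Sum>\<^sub>\<infinity>rn\<in>(?R \<times> ?R) \<times> UNIV. case ?h rn of (x, y) \<Rightarrow> F x y)"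
    by (rule infsum_reindex_bij_betw[OF bij, symmetric])
  also have "\<dots> = (\<Sum>\<^sub>\<infinity>(r, n)\<in>(?R \<times> ?R) \<times> UNIV. ?g r n)" by (simp add: case_prod_unfold)
  also have "\<dots> = (\<Sum>\<^sub>\<infinity>r\<in>?R \<times> ?R. \<Sum>\<^sub>\<infinity>n. ?g r n)"
    using infsum_Sigma'_banach[OF s] by simp
  also have "\<dots> = (\<Sum>r\<in>?R \<times> ?R. \<Sum>\<^sub>\<infinity>n. ?g r n)" by (rule infsum_finite) simp
  also have "\<dots> = (\<Sum>x\<in>?R. \<Sum>y\<in>?R. \<Sum>\<^sub>\<infinity>n. ?g (x, y) n)"
    unfolding sum.cartesian_product by (intro sum.cong) auto
  finally show ?thesis by (simp add: case_prod_unfold)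
qed

context hyp_binary_form
begin

definition theta :: "(int \<Rightarrow> int \<Rightarrow> complex) \<Rightarrow> complex \<Rightarrow> complex" where
  "theta m \<tau> = (\<Sum>\<^sub>\<infinity>(x::int, y::int). m x y * T \<tau> (of_int x) (of_int y))"

lemma summable_T: "Im \<tau> > 0 \<Longrightarrow> (\<lambda>(x::int, y::int). norm (T \<tau> (of_int x) (of_int y))) summable_on UNIV"
  using summable_T_shift[of \<tau> 0 0] by simp

lemma summable_theta:
  assumes L: "L > 0" "per2 L m" and \<tau>: "Im \<tau> > 0"
  shows "(\<lambda>(x::int, y::int). m x y * T \<tau> (of_int x) (of_int y)) summable_on UNIV"
proof -
  obtain B where B: "B > 0" "\<And>x y. norm (m x y) \<le> B" using per2_bounded[OF L] by blast
  show ?thesis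
  proof (rule norm_summable_onI(1))
    show "(\<lambda>pr. B * (case pr of (x::int, y::int) \<Rightarrow> norm (T \<tau> (of_int x) (of_int y)))) summable_on UNIV"
      by (intro summable_on_cmult_right summable_T \<tau>)
  qed (use B in \<open>auto simp: norm_mult intro!: mult_right_mono\<close>)
qed

text \<open>The linear forms enter only through \<open>|\<Delta>|\<close>, which does not change when \<open>(\<alpha>, \<beta>)\<close> is rescaled to
  \<open>(e\<^sup>-\<^sup>u \<alpha>, e\<^sup>u \<beta>)\<close>.\<close>
definition theta_mult :: "int \<Rightarrow> int \<Rightarrow> int \<Rightarrow> complex" where
  "theta_mult L a c = (if c = 0 then 1 else gauss_const L a c / of_real (4 * \<bar>of_int c\<bar> * \<bar>\<Delta>\<bar>))"

text \<open>The argument is the image of \<open>\<tau>\<close> in the form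
  \<open>a/c - 1/(c (c \<tau> + d))\<close>. The translation by \<open>a/c\<close> is a phase of
  period \<open>2 * c\<close> in the lattice vector, so each residue class can be inverted
  separately; resumming the phases gives the Gauss sums.\<close>

lemma theta_cusp_expansion:
  assumes c: "c \<noteq> 0" and m: "per2 L m" and L: "L > 0" "L dvd 2 * c" and \<tau>: "Im \<tau> > 0"
  shows "theta m (of_real (of_int a / of_int c) - 1 / (of_int c * (of_int c * \<tau> + of_int d))) =
    (\<Sum>\<^sub>\<infinity>(k::int, l::int). gauss_sum m a c k l *
       T (of_real (of_int d / of_int c) + \<tau>) (of_int (r * k - q * l) / of_int (2 * dsc)) (of_int (p * l - q * k) / of_int (2 * dsc)))
    * of_real (norm (of_int c * \<tau> + of_int d) / (4 * \<bar>of_int c\<bar> * \<bar>\<Delta>\<bar>))"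
proof -
  define K where "K = 2 * c"
  have K: "K \<noteq> 0" using c by (simp add: K_def)
  define j where "j = of_int c * \<tau> + of_int d"
  have "Im j \<noteq> 0" using \<tau> c by (simp add: j_def)
  hence j0: "j \<noteq> 0" by auto
  define t0 where "t0 = - 1 / (of_int c * j)"
  have im0: "Im t0 > 0"
  proof -
    have cj: "of_int c * j \<noteq> 0" using c j0 by simp
    have "Im (of_int c * j) = (of_int c)\<^sup>2 * Im \<tau>" by (simp add: j_def power2_eq_square)
    hence "Im (of_int c * j) > 0" using \<tau> c by simp
    thus ?thesis unfolding t0_def Im_divide using cj
      by (auto simp: sum_power2_gt_zero_iff complex_eq_iff intro!: divide_pos_pos)
  qed
  define t1 where "t1 = of_real (of_int d / of_int c) + \<tau>"
  have t1: "j = of_int c * t1" using c by (simp add: t1_def j_def algebra_simps)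
  have imt1: "Im t1 > 0" using \<tau> by (simp add: t1_def)
  \<comment> \<open>Scaling by \<open>2 * c\<close> before the inversion leaves a quarter of
    \<open>t1\<close>, which means that dual points are halved; hence the denominators
    \<open>2 * dsc\<close>.\<close>
  have Kt0: "- 1 / (of_real ((of_int K)\<^sup>2) * t0) = of_real ((1 / 2)\<^sup>2) * t1"
    unfolding t0_def t1 K_def using c j0 t1 by (simp add: field_simps power2_eq_square)
  have nK: "norm (of_real ((of_int K)\<^sup>2) * t0) = 4 * \<bar>of_int c\<bar> / norm j"
    unfolding t0_def K_def using c j0 by (simp add: norm_mult norm_divide norm_power power2_eq_square)
  have imKt0: "Im (of_real ((of_int K)\<^sup>2) * t0) > 0" using im0 K by simp
  have imq: "Im (of_real ((1 / 2)\<^sup>2) * t1) > 0" using imt1 by simp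
  define C where "C = complex_of_real (norm j / (4 * \<bar>of_int c\<bar> * \<bar>\<Delta>\<bar>))"
  define V where "V = (\<lambda>k l. T t1 (of_int (r * k - q * l) / of_int (2 * dsc)) (of_int (p * l - q * k) / of_int (2 * dsc)))"
  have V: "T (of_real ((1 / 2)\<^sup>2) * t1) (du k l) (dv k l) = V k l" for k l
    unfolding V_def T_scale[symmetric] by simp
  have inner: "(\<Sum>\<^sub>\<infinity>(i::int, j::int). T t0 (of_int (x + K * i)) (of_int (y + K * j))) =
     (\<Sum>\<^sub>\<infinity>(k::int, l::int). V k l * ec (- of_int (k * x + l * y) / of_int (2 * c))) * C" for x y :: int
  proof -
    have sc: "T t0 (of_int (x + K * i)) (of_int (y + K * j)) =
       T (of_real ((of_int K)\<^sup>2) * t0) (of_int i + of_int x / of_int K) (of_int j + of_int y / of_int K)" for i j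
    proof -
      have "real_of_int (x + K * i) = of_int K * (of_int i + of_int x / of_int K)"
        "real_of_int (y + K * j) = of_int K * (of_int j + of_int y / of_int K)"
        using K by (simp_all add: distrib_left)
      thus ?thesis by (simp only: T_scale)
    qed
    have e: "- (of_int k * (of_int x / of_int K) + of_int l * (of_int y / of_int K)) = (- of_int (k * x + l * y) / of_int (2 * c) :: real)" for k l
      unfolding K_def using c by (simp add: field_simps)
    show ?thesis
      unfolding sc theta_inversion[OF imKt0] Kt0 V nK e
      by (simp add: C_def)
  qed
  define f where "f = gauss_term m a c 0 0"
  have f: "f x y = m x y * ec (of_int a * Qf x y / of_int c)" for x y by (simp add: f_def gauss_term_def)
  have perf: "per2 K f" unfolding f_def K_def by (rule per2_gauss_term[OF c m L(2)])
  have fper: "f (x + K * i) (y + K * j) = f x y" for x y i j using perf by (simp add: per2_def)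
  have T_shift: "T (of_real (of_int a / of_int c) + t0) (of_int x) (of_int y) = ec (of_int a * Qf x y / of_int c) * T t0 (of_int x) (of_int y)" for x y
    unfolding hyp_gauss_add_real Qf_eq by simp
  have "of_real (of_int a / of_int c) - 1 / (of_int c * (of_int c * \<tau> + of_int d)) = of_real (of_int a / of_int c) + t0"
    by (simp add: t0_def j_def)
  hence "theta m (of_real (of_int a / of_int c) - 1 / (of_int c * (of_int c * \<tau> + of_int d))) =
     (\<Sum>\<^sub>\<infinity>(x::int, y::int). f x y * T t0 (of_int x) (of_int y))"
    unfolding theta_def by (simp only: T_shift f mult.assoc)
  also have "\<dots> = (\<Sum>x\<in>{0..<\<bar>K\<bar>}. \<Sum>y\<in>{0..<\<bar>K\<bar>}. \<Sum>\<^sub>\<infinity>(i, j). f (x + K * i) (y + K * j) * T t0 (of_int (x + K * i)) (of_int (y + K * j)))"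
  proof (rule infsum_residue_classes[OF K])
    have "per2 \<bar>K\<bar> f" unfolding per2_def
    proof (intro allI)
      fix x y i j
      show "f (x + \<bar>K\<bar> * i) (y + \<bar>K\<bar> * j) = f x y"
        using fper[of x "sgn K * i" y "sgn K * j"] by (simp add: mult.assoc[symmetric] abs_sgn)
    qed
    thus "(\<lambda>(x, y). f x y * T t0 (of_int x) (of_int y)) summable_on UNIV"
      using K im0 by (intro summable_theta) auto
  qed
  also have "\<dots> = (\<Sum>x\<in>{0..<\<bar>K\<bar>}. \<Sum>y\<in>{0..<\<bar>K\<bar>}. f x y * ((\<Sum>\<^sub>\<infinity>(k::int, l::int). V k l * ec (- of_int (k * x + l * y) / of_int (2 * c))) * C))"
    unfolding fper inner[symmetric] by (simp add: case_prod_unfold infsum_cmult_right')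
  also have "\<dots> = (\<Sum>x\<in>{0..<\<bar>K\<bar>}. \<Sum>y\<in>{0..<\<bar>K\<bar>}. \<Sum>\<^sub>\<infinity>(k::int, l::int). gauss_term m a c k l x y * V k l) * C"
  proof -
    have "f x y * ((\<Sum>\<^sub>\<infinity>(k::int, l::int). V k l * ec (- of_int (k * x + l * y) / of_int (2 * c))) * C)
      = (\<Sum>\<^sub>\<infinity>(k::int, l::int). gauss_term m a c k l x y * V k l) * C" for x y
    proof -
      have "f x y * (\<Sum>\<^sub>\<infinity>(k::int, l::int). V k l * ec (- of_int (k * x + l * y) / of_int (2 * c)))
         = (\<Sum>\<^sub>\<infinity>pr. f x y * (case pr of (k::int, l::int) \<Rightarrow> V k l * ec (- of_int (k * x + l * y) / of_int (2 * c))))"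
        by (rule infsum_cmult_right'[symmetric])
      also have "\<dots> = (\<Sum>\<^sub>\<infinity>(k::int, l::int). gauss_term m a c k l x y * V k l)"
        by (intro infsum_cong) (auto simp: f gauss_term_def mult_ac)
      finally show ?thesis by (simp add: mult.assoc[symmetric])
    qed
    thus ?thesis by (simp only: sum_distrib_right)
  qed
  also have "(\<Sum>x\<in>{0..<\<bar>K\<bar>}. \<Sum>y\<in>{0..<\<bar>K\<bar>}. \<Sum>\<^sub>\<infinity>(k::int, l::int). gauss_term m a c k l x y * V k l) =
     (\<Sum>\<^sub>\<infinity>(k::int, l::int). gauss_sum m a c k l * V k l)"
  proof -
    have s: "(\<lambda>(k::int, l::int). gauss_term m a c k l x y * V k l) summable_on UNIV" for x y
    proof -
      have "(\<lambda>pr. f x y * (case pr of (k::int, l::int) \<Rightarrow> V k l * ec (- of_int (k * x + l * y) / of_int (2 * c)))) summable_on UNIV"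
        unfolding V[symmetric] by (intro summable_on_cmult_right summable_T_dual imq)
      thus ?thesis by (rule summable_on_cong[THEN iffD1, rotated]) (auto simp: f gauss_term_def mult_ac)
    qed
    have "((\<lambda>pr. \<Sum>x\<in>{0..<\<bar>K\<bar>}. \<Sum>y\<in>{0..<\<bar>K\<bar>}. case pr of (k::int, l::int) \<Rightarrow> gauss_term m a c k l x y * V k l) has_sum
      (\<Sum>x\<in>{0..<\<bar>K\<bar>}. \<Sum>y\<in>{0..<\<bar>K\<bar>}. \<Sum>\<^sub>\<infinity>(k::int, l::int). gauss_term m a c k l x y * V k l)) UNIV"
      by (intro has_sum_finite_sum has_sum_infsum s finite_atLeastLessThan_int)
    moreover have "(\<Sum>x\<in>{0..<\<bar>K\<bar>}. \<Sum>y\<in>{0..<\<bar>K\<bar>}. case pr of (k::int, l::int) \<Rightarrow> gauss_term m a c k l x y * V k l) =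
       (case pr of (k, l) \<Rightarrow> gauss_sum m a c k l * V k l)" for pr
      by (cases pr) (simp add: gauss_sum_def K_def sum_distrib_right)
    ultimately show ?thesis by (simp add: infsumI)
  qed
  finally show ?thesis by (simp add: C_def V_def t1_def j_def)
qed

lemma dual_index_inj: "inj (\<lambda>(x, y). (2 * (p * x + q * y), 2 * (q * x + r * y)))"
proof (rule injI)
  fix u v
  assume e: "(\<lambda>(x, y). (2 * (p * x + q * y), 2 * (q * x + r * y))) u = (\<lambda>(x, y). (2 * (p * x + q * y), 2 * (q * x + r * y))) v"
  obtain x y x' y' where uv: "u = (x, y)" "v = (x', y')" by (cases u, cases v)
  have h: "p * x + q * y = p * x' + q * y'" "q * x + r * y = q * x' + r * y'"
    using e by (simp_all add: uv)
  have "dsc * x = r * (p * x + q * y) - q * (q * x + r * y)" "dsc * x' = r * (p * x' + q * y') - q * (q * x' + r * y')"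
    "dsc * y = p * (q * x + r * y) - q * (p * x + q * y)" "dsc * y' = p * (q * x' + r * y') - q * (p * x' + q * y')"
    by (simp_all add: dsc_def power2_eq_square algebra_simps)
  hence "dsc * x = dsc * x'" "dsc * y = dsc * y'" unfolding h by simp_all
  thus "u = v" using dsc_nz by (simp add: uv)
qed

text \<open>For \<open>c \<noteq> 0\<close> only the indices \<open>(k, l) = 2 A \<nu>\<close>
  survive, and there the halved dual point is \<open>\<nu>\<close> again. The phase produced by the
  translation \<open>d/c\<close> is exactly the one that \<open>gauss_sum_eval\<close> needs to turn
  the Gauss sum into \<open>m \<nu>\<close> times a constant.\<close>

lemma theta_modular:
  assumes L: "L > 0" and m: "per2 L m" and N: "N = 4 * L * L * dsc"
    and det: "a * d - b * c = 1" and cong: "N dvd a - 1" "N dvd b" "N dvd c" "N dvd d - 1"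
    and \<tau>: "Im \<tau> > 0"
  shows "theta m ((of_int a * \<tau> + of_int b) / (of_int c * \<tau> + of_int d)) =
    theta_mult L a c * of_real (norm (of_int c * \<tau> + of_int d)) * theta m \<tau>"
proof (cases "c = 0")
  case True
  \<comment> \<open>This excludes \<open>a = - 1\<close>, for which \<open>N\<close> would have to
    divide 2.\<close>
  have "\<bar>N\<bar> > 2"
  proof -
    have "L * L * \<bar>dsc\<bar> > 0" using L dsc_nz by simp
    moreover have "\<bar>N\<bar> = 4 * (L * L * \<bar>dsc\<bar>)" using L by (simp add: N abs_mult)
    ultimately show ?thesis by linarith
  qed
  moreover have "a * d = 1" using det True by simp
  hence "a = 1 \<and> d = 1 \<or> a = - 1 \<and> d = - 1" by (simp add: zmult_eq_1_iff)
  ultimately have ad: "a = 1" "d = 1"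
    using cong(1) dvd_imp_le_int[of "a - 1" N] by auto
  have "2 dvd N" by (simp add: N)
  hence "even b" using cong(2) dvd_trans by blast
  hence "T (of_real (of_int b) + \<tau>) (of_int x) (of_int y) = T \<tau> (of_int x) (of_int y)" for x y
    unfolding hyp_gauss_add_real Qf_eq[symmetric] using two_Qf_Ints by simp
  thus ?thesis using True ad by (simp add: theta_def theta_mult_def add.commute)
next
  case False
  note c = False
  from cong(3) obtain c' where "c = N * c'" by blast
  hence c0: "c = 2 * L * L * dsc * (2 * c')" by (simp add: N)
  have LN: "L dvd N" by (simp add: N)
  have La: "L dvd a - 1" and Ld: "L dvd d - 1" using LN cong dvd_trans by blast+
  have "2 dvd N" by (simp add: N)
  hence b: "even b" using cong(2) dvd_trans by blast
  have L2c: "L dvd 2 * c" by (simp add: c0)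
  define j where "j = of_int c * \<tau> + of_int d"
  have "Im j \<noteq> 0" using \<tau> c by (simp add: j_def)
  hence j0: "j \<noteq> 0" by auto
  have "(of_int a * \<tau> + of_int b) / j = of_real (of_int a / of_int c) - 1 / (of_int c * j)"
  proof -
    have "of_int c * (of_int a * \<tau> + of_int b) = of_int a * j - (of_int (a * d - b * c) :: complex)"
      by (simp add: j_def algebra_simps)
    hence "of_int c * (of_int a * \<tau> + of_int b) = of_int a * j - 1" unfolding det by simp
    hence e: "of_int a * \<tau> + of_int b = (of_int a * j - 1) / of_int c" using c by (simp add: field_simps)
    show ?thesis unfolding e using c j0 by (simp add: diff_divide_distrib)
  qed
  hence "theta m ((of_int a * \<tau> + of_int b) / j) = 
    (\<Sum>\<^sub>\<infinity>(k::int, l::int). gauss_sum m a c k l *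
       T (of_real (of_int d / of_int c) + \<tau>) (of_int (r * k - q * l) / of_int (2 * dsc)) (of_int (p * l - q * k) / of_int (2 * dsc)))
    * of_real (norm j / (4 * \<bar>of_int c\<bar> * \<bar>\<Delta>\<bar>))"
    using theta_cusp_expansion[OF c m L L2c \<tau>, of a d] by (simp add: j_def)
  also have "(\<Sum>\<^sub>\<infinity>(k::int, l::int). gauss_sum m a c k l *
       T (of_real (of_int d / of_int c) + \<tau>) (of_int (r * k - q * l) / of_int (2 * dsc)) (of_int (p * l - q * k) / of_int (2 * dsc)))
     = (\<Sum>\<^sub>\<infinity>(k::int, l::int)\<in>range (\<lambda>(x, y). (2 * (p * x + q * y), 2 * (q * x + r * y))). gauss_sum m a c k l *
       T (of_real (of_int d / of_int c) + \<tau>) (of_int (r * k - q * l) / of_int (2 * dsc)) (of_int (p * l - q * k) / of_int (2 * dsc)))"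
  proof (rule infsum_cong_neutral)
    fix pr assume pr: "pr \<in> UNIV - range (\<lambda>(x, y). (2 * (p * x + q * y), 2 * (q * x + r * y)))"
    obtain k l where kl: "pr = (k, l)" by (cases pr)
    have "gauss_sum m a c k l = 0"
    proof (rule ccontr)
      assume "gauss_sum m a c k l \<noteq> 0"
      from gauss_sum_vanishes[OF L dsc_nz c m c0 this] obtain x y where
        "k = 2 * (p * x + q * y)" "l = 2 * (q * x + r * y)" by blast
      hence "pr = (\<lambda>(x, y). (2 * (p * x + q * y), 2 * (q * x + r * y))) (x, y)" by (simp add: kl)
      thus False using pr by blast
    qed
    thus "(case pr of (k, l) \<Rightarrow> gauss_sum m a c k l *
       T (of_real (of_int d / of_int c) + \<tau>) (of_int (r * k - q * l) / of_int (2 * dsc)) (of_int (p * l - q * k) / of_int (2 * dsc))) = 0"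
      by (simp add: kl)
  qed auto
  also have "\<dots> = (\<Sum>\<^sub>\<infinity>(x, y). gauss_const L a c * (m x y * T \<tau> (of_int x) (of_int y)))"
  proof (subst infsum_reindex[OF dual_index_inj], rule infsum_cong)
    fix pr :: "int \<times> int"
    obtain x y where pr: "pr = (x, y)" by (cases pr)
    define k where "k = 2 * (p * x + q * y)"
    define l where "l = 2 * (q * x + r * y)"
    have 1: "r * k - q * l = 2 * dsc * x" "p * l - q * k = 2 * dsc * y"
      by (simp_all add: k_def l_def dsc_def power2_eq_square algebra_simps)
    have "of_int (r * k - q * l) / of_int (2 * dsc) = real_of_int x" "of_int (p * l - q * k) / of_int (2 * dsc) = real_of_int y"
      unfolding 1 using dsc_nz by simp_all
    hence "gauss_sum m a c k l * T (of_real (of_int d / of_int c) + \<tau>) (of_int (r * k - q * l) / of_int (2 * dsc)) (of_int (p * l - q * k) / of_int (2 * dsc))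
      = (gauss_sum m a c k l * ec (of_int d * Qf x y / of_int c)) * T \<tau> (of_int x) (of_int y)"
      unfolding hyp_gauss_add_real by (simp add: Qf_eq)
    also have "gauss_sum m a c k l * ec (of_int d * Qf x y / of_int c) = m x y * gauss_const L a c"
      by (rule gauss_sum_eval[OF L dsc_nz c m c0 det b La Ld k_def l_def])
    finally show "((\<lambda>(k, l). gauss_sum m a c k l * T (of_real (of_int d / of_int c) + \<tau>) (of_int (r * k - q * l) / of_int (2 * dsc)) (of_int (p * l - q * k) / of_int (2 * dsc)))
       \<circ> (\<lambda>(x, y). (2 * (p * x + q * y), 2 * (q * x + r * y)))) pr = (case pr of (x, y) \<Rightarrow> gauss_const L a c * (m x y * T \<tau> (of_int x) (of_int y)))"
      by (simp add: pr k_def l_def mult_ac)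
  qed
  also have "\<dots> = gauss_const L a c * theta m \<tau>"
    unfolding theta_def by (simp add: case_prod_unfold infsum_cmult_right')
  finally show ?thesis using c by (simp add: theta_mult_def j_def)
qed

end

subsection \<open>The Bessel function and its theta decomposition\<close>

lemma cosh_ge_quadratic: "cosh (s::real) \<ge> 1 + s\<^sup>2 / 4"
proof -
  have "1 + \<bar>s\<bar> + \<bar>s\<bar>\<^sup>2 / 2 \<le> exp \<bar>s\<bar>" by (rule exp_lower_Taylor_quadratic) simp
  moreover have "1 + (- \<bar>s\<bar>) \<le> exp (- \<bar>s\<bar>)" by (rule exp_ge_add_one_self)
  ultimately have "1 + s\<^sup>2 / 4 \<le> (exp \<bar>s\<bar> + exp (- \<bar>s\<bar>)) / 2" by simp
  also have "\<dots> = cosh \<bar>s\<bar>" by (simp add: cosh_field_def)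
  finally show ?thesis by (simp add: cosh_real_abs)
qed

lemma gaussian_integral_pos:
  assumes "x > (0::real)"
  shows "has_bochner_integral lborel (\<lambda>s. exp (- (x * s\<^sup>2))) (sqrt (pi / x))"
proof -
  have z: "x / pi > 0" using assms by simp
  have "has_bochner_integral lborel (\<lambda>s. complex_of_real (exp (- (x * s\<^sup>2)))) (of_real (sqrt (pi / x)))"
    using gaussian_integral_real[OF z, of 0] assms
    by (simp add: exp_of_real[symmetric] real_sqrt_divide)
  hence "has_bochner_integral lborel (\<lambda>s. Re (complex_of_real (exp (- (x * s\<^sup>2))))) (Re (of_real (sqrt (pi / x))))"
    by (rule has_bochner_integral_bounded_linear[OF bounded_linear_Re])
  thus ?thesis by simp
qed

text \<open>The factor 2 in the argument matches the speed at which the majorant varies with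
  \<open>u\<close>, and it compensates for integrating over the whole line instead of the half
  line.\<close>

definition K0_full :: "real \<Rightarrow> real" where
  "K0_full x = (LINT s|lborel. exp (- x * cosh (2 * s)))"

lemma exp_cosh_le:
  fixes x s :: real
  assumes "x > 0"
  shows "exp (- x * cosh (2 * s)) \<le> exp (- x) * exp (- (x * s\<^sup>2))"
proof -
  have "x * (1 + (2 * s)\<^sup>2 / 4) \<le> x * cosh (2 * s)"
    using assms by (intro mult_left_mono cosh_ge_quadratic) auto
  thus ?thesis by (simp add: exp_add[symmetric] algebra_simps power2_eq_square)
qed

lemma integrable_exp_cosh:
  assumes "x > (0::real)"
  shows "integrable lborel (\<lambda>s. exp (- x * cosh (2 * s)))"
proof (rule Bochner_Integration.integrable_bound)
  show "integrable lborel (\<lambda>s. exp (- x) * exp (- (x * s\<^sup>2)))"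
    using gaussian_integral_pos[of x] assms by (auto simp: has_bochner_integral_iff)
  have "continuous_on UNIV (\<lambda>s. exp (- x * cosh (2 * s)))" by (intro continuous_intros)
  from borel_measurable_continuous_onI[OF this]
  show "(\<lambda>s. exp (- x * cosh (2 * s))) \<in> borel_measurable lborel" by simp
  show "AE s in lborel. norm (exp (- x * cosh (2 * s))) \<le> norm (exp (- x) * exp (- (x * s\<^sup>2)))"
    using exp_cosh_le[OF assms] by auto
qed

lemma K0_full_nonneg: "K0_full x \<ge> 0"
  unfolding K0_full_def by (rule integral_nonneg_AE) auto

lemma K0_full_le:
  assumes "x > 0"
  shows "K0_full x \<le> exp (- x) * sqrt (pi / x)"
proof -
  have "K0_full x \<le> (LINT s|lborel. exp (- x) * exp (- (x * s\<^sup>2)))"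
    unfolding K0_full_def
    using assms gaussian_integral_pos[of x] exp_cosh_le[OF assms]
    by (intro integral_mono integrable_exp_cosh) (auto simp: has_bochner_integral_iff)
  also have "\<dots> = exp (- x) * sqrt (pi / x)"
    using assms gaussian_integral_pos[of x] by (simp add: has_bochner_integral_iff)
  finally show ?thesis .
qed

lemma bessel_K0_eq_full:
  assumes x: "x > 0"
  shows "bessel_K0 x = K0_full x"
proof -
  define f where "f = (\<lambda>t. exp (- x * cosh t))"
  have int2: "has_bochner_integral lborel (\<lambda>s. f (0 + 2 * s)) (K0_full x)"
    using integrable_exp_cosh[OF x] by (simp add: has_bochner_integral_iff K0_full_def f_def)
  hence "has_bochner_integral lborel f (2 * K0_full x)"
    using lborel_has_bochner_integral_real_affine_iff[of 2 f "2 * K0_full x" 0] by simp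
  hence int: "integrable lborel f" and val: "(LINT t|lborel. f t) = 2 * K0_full x"
    by (auto simp: has_bochner_integral_iff)
  have si: "set_integrable lborel {0..} f"
    unfolding set_integrable_def by (rule integrable_mult_indicator[OF _ int]) simp
  have "bessel_K0 x = (LINT t:{0..}|lborel. f t)"
    using set_borel_integral_eq_integral(2)[OF si] by (simp add: bessel_K0_def f_def)
  moreover have "(LINT t|lborel. f t) = 2 * (LINT t:{0..}|lborel. f t)"
  proof -
    have "has_bochner_integral lborel (\<lambda>t. indicator {0..} t *\<^sub>R f t) (LINT t:{0..}|lborel. f t)"
      using si by (simp add: has_bochner_integral_iff set_integrable_def set_lebesgue_integral_def)
    hence "has_bochner_integral lborel f (2 *\<^sub>R (LINT t:{0..}|lborel. f t))"
      by (rule has_bochner_integral_even_function) (simp add: f_def)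
    thus ?thesis by (simp add: has_bochner_integral_iff)
  qed
  ultimately show ?thesis using val by simp
qed

lemma K0_full_shift:
  assumes "x > 0"
  shows "has_bochner_integral lborel (\<lambda>u. exp (- x * cosh (2 * (u - t)))) (K0_full x)"
proof -
  have "has_bochner_integral lborel (\<lambda>s. exp (- x * cosh (2 * s))) (K0_full x)"
    using integrable_exp_cosh[OF assms] by (simp add: has_bochner_integral_iff K0_full_def)
  thus ?thesis
    using lborel_has_bochner_integral_real_affine_iff[of 1 "\<lambda>s. exp (- x * cosh (2 * s))" _ "- t"] by simp
qed

text \<open>The majorant of \<open>Q = \<alpha>\<beta>\<close> at parameter \<open>u\<close>, up to a factor 2; for \<open>Q \<noteq> 0\<close> it is smallest at
  \<open>u = hyp_param \<alpha> \<beta>\<close>.\<close>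
definition majorant :: "real \<Rightarrow> real \<Rightarrow> real \<Rightarrow> real" where
  "majorant \<alpha> \<beta> u = (\<alpha> * exp (- u))\<^sup>2 + (\<beta> * exp u)\<^sup>2"

text \<open>For \<open>\<alpha>\<beta> > 0\<close> this is the parameter where
  \<open>B(\<nu>, c(t))\<close> changes sign, for \<open>\<alpha>\<beta> < 0\<close> the one where
  the form with the orthogonal curve does.\<close>

definition hyp_param :: "real \<Rightarrow> real \<Rightarrow> real" where
  "hyp_param \<alpha> \<beta> = ln (\<bar>\<alpha>\<bar> / \<bar>\<beta>\<bar>) / 2"

lemma majorant_eq_cosh:
  assumes "\<alpha> * \<beta> \<noteq> 0"
  shows "majorant \<alpha> \<beta> u = 2 * \<bar>\<alpha> * \<beta>\<bar> * cosh (2 * (u - hyp_param \<alpha> \<beta>))"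
proof -
  have ab: "\<bar>\<alpha>\<bar> > 0" "\<bar>\<beta>\<bar> > 0" using assms by auto
  have e: "exp (2 * hyp_param \<alpha> \<beta>) = \<bar>\<alpha>\<bar> / \<bar>\<beta>\<bar>" using ab by (simp add: hyp_param_def)
  hence e': "exp (- (2 * hyp_param \<alpha> \<beta>)) = \<bar>\<beta>\<bar> / \<bar>\<alpha>\<bar>" by (simp add: exp_minus)
  have "2 * cosh (2 * (u - hyp_param \<alpha> \<beta>)) = exp (2 * u) * exp (- (2 * hyp_param \<alpha> \<beta>)) + exp (- (2 * u)) * exp (2 * hyp_param \<alpha> \<beta>)"
    by (simp add: cosh_field_def exp_add[symmetric] algebra_simps)
  also have "\<dots> = exp (2 * u) * (\<bar>\<beta>\<bar> / \<bar>\<alpha>\<bar>) + exp (- (2 * u)) * (\<bar>\<alpha>\<bar> / \<bar>\<beta>\<bar>)" unfolding e e' ..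
  finally have "2 * \<bar>\<alpha> * \<beta>\<bar> * cosh (2 * (u - hyp_param \<alpha> \<beta>)) = \<bar>\<alpha>\<bar> * \<bar>\<beta>\<bar> * (exp (2 * u) * (\<bar>\<beta>\<bar> / \<bar>\<alpha>\<bar>) + exp (- (2 * u)) * (\<bar>\<alpha>\<bar> / \<bar>\<beta>\<bar>))"
    by (simp add: abs_mult)
  also have "\<dots> = \<bar>\<beta>\<bar>\<^sup>2 * exp (2 * u) + \<bar>\<alpha>\<bar>\<^sup>2 * exp (- (2 * u))"
    using ab by (simp add: field_simps power2_eq_square del: abs_mult_self_eq)
  also have "\<dots> = majorant \<alpha> \<beta> u"
    by (simp add: majorant_def power_mult_distrib) (simp add: power2_eq_square exp_add[symmetric])
  finally show ?thesis by simp
qed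

lemma majorant_scale: "majorant (exp s * \<alpha>) (exp (- s) * \<beta>) (u + s) = majorant \<alpha> \<beta> u"
proof -
  have "exp s * \<alpha> * exp (- (u + s)) = \<alpha> * exp (- u)" "exp (- s) * \<beta> * exp (u + s) = \<beta> * exp u"
    using exp_add[of s "- (u + s)"] exp_add[of "- s" "u + s"] by (simp_all add: mult_ac)
  thus ?thesis by (simp only: majorant_def)
qed

lemma hyp_param_scale:
  assumes "\<alpha> * \<beta> \<noteq> 0"
  shows "hyp_param (exp s * \<alpha>) (exp (- s) * \<beta>) = hyp_param \<alpha> \<beta> + s"
proof -
  have ab: "\<bar>\<alpha>\<bar> > 0" "\<bar>\<beta>\<bar> > 0" using assms by auto
  have "\<bar>exp s * \<alpha>\<bar> / \<bar>exp (- s) * \<beta>\<bar> = exp (2 * s) * (\<bar>\<alpha>\<bar> / \<bar>\<beta>\<bar>)"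
    using ab exp_add[of s s] by (simp add: abs_mult exp_minus field_simps)
  hence "ln (\<bar>exp s * \<alpha>\<bar> / \<bar>exp (- s) * \<beta>\<bar>) = 2 * s + ln (\<bar>\<alpha>\<bar> / \<bar>\<beta>\<bar>)"
    using ab ln_mult_pos[of "exp (2 * s)" "\<bar>\<alpha>\<bar> / \<bar>\<beta>\<bar>"] by simp
  thus ?thesis by (simp add: hyp_param_def)
qed

lemma majorant_ge: "majorant \<alpha> \<beta> u \<ge> 2 * \<bar>\<alpha> * \<beta>\<bar>"
proof -
  have "2 * \<bar>\<alpha> * exp (- u)\<bar> * \<bar>\<beta> * exp u\<bar> \<le> \<bar>\<alpha> * exp (- u)\<bar>\<^sup>2 + \<bar>\<beta> * exp u\<bar>\<^sup>2"
    by (rule sum_squares_bound)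
  moreover have "\<bar>\<alpha> * exp (- u)\<bar> * \<bar>\<beta> * exp u\<bar> = \<bar>\<alpha> * \<beta>\<bar>"
    by (simp add: abs_mult exp_minus field_simps)
  ultimately show ?thesis by (simp only: majorant_def power2_abs mult.assoc)
qed

lemma majorant_integral:
  assumes "\<alpha> * \<beta> \<noteq> 0" "y > 0"
  shows "has_bochner_integral lborel (\<lambda>u. exp (- (pi * y * majorant \<alpha> \<beta> u))) (K0_full (2 * pi * \<bar>\<alpha> * \<beta>\<bar> * y))"
  using K0_full_shift[of "2 * pi * \<bar>\<alpha> * \<beta>\<bar> * y" "hyp_param \<alpha> \<beta>"] assms
  by (simp add: majorant_eq_cosh mult_ac)

text \<open>Replaces the Gaussian concentrated around \<open>hyp_param \<alpha> \<beta>\<close> by its total mass placed at that point, and measures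
  the difference against \<open>sgn (t - u) / 2\<close>.\<close>
definition err_int :: "real \<Rightarrow> real \<Rightarrow> real \<Rightarrow> real \<Rightarrow> real" where
  "err_int y \<alpha> \<beta> t = (LINT u|lborel. exp (- (pi * y * majorant \<alpha> \<beta> u)) * ((sgn (t - hyp_param \<alpha> \<beta>) - sgn (t - u)) / 2))"

lemma integrable_sgn_mult:
  assumes "integrable lborel (g :: real \<Rightarrow> real)" "\<bar>c\<bar> \<le> 1"
  shows "integrable lborel (\<lambda>u. g u * ((c - sgn (t - u)) / 2))"
proof (rule Bochner_Integration.integrable_bound[OF assms(1)])
  have [measurable]: "g \<in> borel_measurable lborel" using assms by auto
  show "(\<lambda>u. g u * ((c - sgn (t - u)) / 2)) \<in> borel_measurable lborel" by measurable
  have "\<bar>(c - sgn (t - u)) / 2\<bar> \<le> 1" for u using assms(2) by (auto simp: sgn_real_def)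
  hence "norm (g u * ((c - sgn (t - u)) / 2)) \<le> norm (g u)" for u
    unfolding real_norm_def abs_mult[of "g u"] by (intro mult_left_le) auto
  thus "AE u in lborel. norm (g u * ((c - sgn (t - u)) / 2)) \<le> norm (g u)"
    by simp
qed

text \<open>The weight can be nonzero only if \<open>u - t\<close> and
  \<open>t - hyp_param \<alpha> \<beta>\<close> do not have opposite signs. Then
  \<open>cosh (x + y) \<ge> cosh x * cosh y\<close> separates the majorant at \<open>t\<close> from
  the integration. The bound decays like a Gaussian in the lattice vector for fixed
  \<open>t\<close>, whereas the Bessel factor itself depends on \<open>\<alpha> * \<beta>\<close>
  only.\<close>

lemma abs_err_int_le:
  assumes ab: "\<alpha> * \<beta> \<noteq> 0" and y: "y > 0"
  shows "\<bar>err_int y \<alpha> \<beta> t\<bar> \<le> K0_full (pi * y * majorant \<alpha> \<beta> t)"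
proof -
  define R where "R = majorant \<alpha> \<beta> t"
  have "2 * \<bar>\<alpha> * \<beta>\<bar> > 0" using ab by simp
  hence R: "R > 0" using majorant_ge[of \<alpha> \<beta> t] unfolding R_def by linarith
  let ?g = "\<lambda>u. exp (- (pi * y * majorant \<alpha> \<beta> u))"
  let ?w = "\<lambda>u. (sgn (t - hyp_param \<alpha> \<beta>) - sgn (t - u)) / 2"
  have ig: "integrable lborel ?g" using majorant_integral[OF ab y] by (simp add: has_bochner_integral_iff)
  have hb: "has_bochner_integral lborel (\<lambda>u. exp (- (pi * y * R) * cosh (2 * (u - t)))) (K0_full (pi * y * R))"
    using R y by (intro K0_full_shift) simp
  have "\<bar>err_int y \<alpha> \<beta> t\<bar> \<le> (LINT u|lborel. norm (?g u * ?w u))"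
    unfolding err_int_def using integral_norm_bound[of lborel "\<lambda>u. ?g u * ?w u"] by simp
  also have "\<dots> \<le> (LINT u|lborel. exp (- (pi * y * R) * cosh (2 * (u - t))))"
  proof (rule integral_mono)
    show "integrable lborel (\<lambda>u. norm (?g u * ?w u))"
      by (intro integrable_norm integrable_sgn_mult ig) (simp add: sgn_real_def)
    show "integrable lborel (\<lambda>u. exp (- (pi * y * R) * cosh (2 * (u - t))))"
      using hb by (simp add: has_bochner_integral_iff)
    fix u
    show "norm (?g u * ?w u) \<le> exp (- (pi * y * R) * cosh (2 * (u - t)))"
    proof (cases "?w u = 0")
      case False
      let ?h = "hyp_param \<alpha> \<beta>"
      have same: "(t - ?h) * (u - t) \<ge> 0"
      proof -
        have "\<not> (t > ?h \<and> t > u)" "\<not> (t < ?h \<and> t < u)" using False by auto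
        thus ?thesis by (auto simp: zero_le_mult_iff not_less)
      qed
      have "sinh (2 * (t - ?h)) * sinh (2 * (u - t)) \<ge> 0"
        using same by (auto simp: zero_le_mult_iff)
      hence "cosh (2 * (t - ?h)) * cosh (2 * (u - t)) \<le> cosh (2 * (t - ?h) + 2 * (u - t))"
        unfolding cosh_add by simp
      also have "2 * (t - ?h) + 2 * (u - t) = 2 * (u - ?h)" by simp
      finally have "2 * \<bar>\<alpha> * \<beta>\<bar> * (cosh (2 * (t - ?h)) * cosh (2 * (u - t))) \<le> 2 * \<bar>\<alpha> * \<beta>\<bar> * cosh (2 * (u - ?h))"
        by (rule mult_left_mono) simp
      hence "R * cosh (2 * (u - t)) \<le> majorant \<alpha> \<beta> u"
        unfolding R_def majorant_eq_cosh[OF ab] by (simp add: mult_ac)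
      hence "?g u \<le> exp (- (pi * y * R) * cosh (2 * (u - t)))"
        using y by (simp add: mult.assoc)
      moreover have "\<bar>?w u\<bar> \<le> 1" by (auto simp: sgn_real_def)
      ultimately have "?g u * \<bar>?w u\<bar> \<le> exp (- (pi * y * R) * cosh (2 * (u - t))) * 1"
        by (intro mult_mono) auto
      thus ?thesis by (simp add: abs_mult)
    qed simp
  qed
  also have "\<dots> = K0_full (pi * y * R)" using hb by (simp add: has_bochner_integral_iff)
  finally show ?thesis by (simp add: R_def)
qed

lemma err_int_scale:
  assumes ab: "\<alpha> * \<beta> \<noteq> 0"
  shows "err_int y (exp s * \<alpha>) (exp (- s) * \<beta>) (t + s) = err_int y \<alpha> \<beta> t"
proof -
  let ?f = "\<lambda>u. exp (- (pi * y * majorant (exp s * \<alpha>) (exp (- s) * \<beta>) u)) * ((sgn (t - hyp_param \<alpha> \<beta>) - sgn (t + s - u)) / 2)"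
  have "err_int y (exp s * \<alpha>) (exp (- s) * \<beta>) (t + s) = (LINT u|lborel. ?f u)"
    unfolding err_int_def hyp_param_scale[OF ab] by simp
  also have "\<dots> = (LINT u|lborel. ?f (s + 1 * u))"
    by (subst lborel_integral_real_affine[of 1 _ s]) simp_all
  also have "\<dots> = err_int y \<alpha> \<beta> t"
    unfolding err_int_def using majorant_scale[of s \<alpha> \<beta>] by (simp add: add.commute)
  finally show ?thesis .
qed

lemma integral_sgn_difference:
  fixes g :: "real \<Rightarrow> real"
  assumes g: "integrable lborel g"
  shows "(LINT u|lborel. g u * ((sgn (t2 - u) - sgn (t1 - u)) / 2)) = sgn (t2 - t1) * integral {min t1 t2..max t1 t2} g"
proof -
  have [measurable]: "g \<in> borel_measurable lborel" using g by auto
  have si: "set_integrable lborel {min t1 t2..max t1 t2} g"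
    unfolding set_integrable_def by (rule integrable_mult_indicator[OF _ g]) simp
  have "(LINT u|lborel. g u * ((sgn (t2 - u) - sgn (t1 - u)) / 2)) = (LINT u|lborel. sgn (t2 - t1) * (indicator {min t1 t2..max t1 t2} u *\<^sub>R g u))"
  proof (rule integral_cong_AE)
    show "AE u in lborel. g u * ((sgn (t2 - u) - sgn (t1 - u)) / 2) = sgn (t2 - t1) * (indicator {min t1 t2..max t1 t2} u *\<^sub>R g u)"
      using AE_lborel_singleton[of t1] AE_lborel_singleton[of t2]
    proof eventually_elim
      case (elim u)
      thus ?case by (auto simp: sgn_real_def indicator_def min_def max_def)
    qed
  qed measurable
  also have "\<dots> = sgn (t2 - t1) * integral {min t1 t2..max t1 t2} g"
    using set_borel_integral_eq_integral(2)[OF si] by (simp add: set_lebesgue_integral_def)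
  finally show ?thesis .
qed

text \<open>Under the integral for the Bessel function,
  \<open>sgn (t - hyp_param \<alpha> \<beta>)\<close> is replaced by \<open>sgn (t - u)\<close> at
  both ends. The replacements are the errors, and the difference of the new signs is twice the
  signed indicator of the interval between \<open>t1\<close> and \<open>t2\<close>, up to its end
  points.\<close>

lemma K0_weight_decomposition:
  assumes ab: "\<alpha> * \<beta> \<noteq> 0" and y: "y > 0"
  shows "(sgn (t2 - hyp_param \<alpha> \<beta>) - sgn (t1 - hyp_param \<alpha> \<beta>)) / 2 * K0_full (2 * pi * \<bar>\<alpha> * \<beta>\<bar> * y) =
    err_int y \<alpha> \<beta> t2 - err_int y \<alpha> \<beta> t1
    + sgn (t2 - t1) * integral {min t1 t2..max t1 t2} (\<lambda>u. exp (- (pi * y * majorant \<alpha> \<beta> u)))"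
proof -
  let ?g = "\<lambda>u. exp (- (pi * y * majorant \<alpha> \<beta> u))" and ?h = "hyp_param \<alpha> \<beta>"
  have g: "integrable lborel ?g" and K: "(LINT u|lborel. ?g u) = K0_full (2 * pi * \<bar>\<alpha> * \<beta>\<bar> * y)"
    using majorant_integral[OF ab y] by (auto simp: has_bochner_integral_iff)
  have i: "integrable lborel (\<lambda>u. ?g u * ((sgn (t - ?h) - sgn (t - u)) / 2))" for t
    by (rule integrable_sgn_mult[OF g]) (simp add: sgn_real_def)
  have j: "integrable lborel (\<lambda>u. ?g u * ((sgn (t2 - u) - sgn (t1 - u)) / 2))"
  proof -
    have "integrable lborel (\<lambda>u. ?g u * ((0 - sgn (t1 - u)) / 2) - ?g u * ((0 - sgn (t2 - u)) / 2))"
      by (intro Bochner_Integration.integrable_diff integrable_sgn_mult g) auto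
    thus ?thesis by (simp add: algebra_simps diff_divide_distrib)
  qed
  have "err_int y \<alpha> \<beta> t2 - err_int y \<alpha> \<beta> t1 + (LINT u|lborel. ?g u * ((sgn (t2 - u) - sgn (t1 - u)) / 2))
     = (LINT u|lborel. ?g u * ((sgn (t2 - ?h) - sgn (t2 - u)) / 2) - ?g u * ((sgn (t1 - ?h) - sgn (t1 - u)) / 2) + ?g u * ((sgn (t2 - u) - sgn (t1 - u)) / 2))"
    unfolding err_int_def using i j by simp
  also have "\<dots> = (LINT u|lborel. ?g u * ((sgn (t2 - ?h) - sgn (t1 - ?h)) / 2))"
    by (rule Bochner_Integration.integral_cong) (auto simp: field_simps)
  also have "\<dots> = K0_full (2 * pi * \<bar>\<alpha> * \<beta>\<bar> * y) * ((sgn (t2 - ?h) - sgn (t1 - ?h)) / 2)"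
    by (subst integral_mult_left_zero) (simp add: K)
  finally show ?thesis unfolding integral_sgn_difference[OF g] by simp
qed

lemma hyp_gauss_majorant:
  "hyp_gauss \<tau> (\<alpha> * exp (- u)) (\<beta> * exp u) = ec (Re \<tau> * (\<alpha> * \<beta>)) * of_real (exp (- (pi * Im \<tau> * majorant \<alpha> \<beta> u)))"
proof -
  have "\<alpha> * exp (- u) * (\<beta> * exp u) = \<alpha> * \<beta>" by (simp add: exp_minus field_simps)
  thus ?thesis
    by (simp add: hyp_gauss_def majorant_def ec_def cis_conv_exp exp_of_real[symmetric] exp_add[symmetric] algebra_simps)
qed

lemma exp_abs_le_majorant:
  assumes "\<bar>u\<bar> \<le> R"
  shows "exp (- 2 * R) * (\<alpha>\<^sup>2 + \<beta>\<^sup>2) \<le> majorant \<alpha> \<beta> u"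
proof -
  have "majorant \<alpha> \<beta> u = \<alpha>\<^sup>2 * exp (- 2 * u) + \<beta>\<^sup>2 * exp (2 * u)"
    by (simp add: majorant_def power_mult_distrib) (simp add: power2_eq_square exp_add[symmetric])
  moreover have "\<alpha>\<^sup>2 * exp (- 2 * R) \<le> \<alpha>\<^sup>2 * exp (- 2 * u)" "\<beta>\<^sup>2 * exp (- 2 * R) \<le> \<beta>\<^sup>2 * exp (2 * u)"
    using assms by (auto intro!: mult_left_mono)
  ultimately show ?thesis by (simp add: algebra_simps)
qed

lemma continuous_on_majorant: "continuous_on S (majorant \<alpha> \<beta>)"
  unfolding majorant_def by (intro continuous_intros)

lemma has_sum_diff:
  fixes f g :: "'a \<Rightarrow> complex"
  assumes "(f has_sum a) A" "(g has_sum b) A"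
  shows "((\<lambda>x. f x - g x) has_sum (a - b)) A"
  using has_sum_add[OF assms(1) has_sum_uminusI[OF assms(2)]] by simp

section \<open>Splitting of the indefinite series into errors and a theta integral\<close>

context hyp_binary_form
begin

definition av :: "int \<times> int \<Rightarrow> real" where "av n = al (of_int (fst n)) (of_int (snd n))"
definition bv :: "int \<times> int \<Rightarrow> real" where "bv n = be (of_int (fst n)) (of_int (snd n))"

text \<open>Boundedness instead of periodicity, so that the property passes to the parts of
  \<open>m\<close> supported on \<open>Q > 0\<close> and on \<open>Q < 0\<close>, which are in
  general not periodic.\<close>

definition good :: "(int \<times> int \<Rightarrow> complex) \<Rightarrow> bool" where
  "good m \<longleftrightarrow> (\<exists>B. \<forall>n. norm (m n) \<le> B) \<and> (\<forall>n. m n \<noteq> 0 \<longrightarrow> av n * bv n \<noteq> 0)"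

lemma good_nz: "good m \<Longrightarrow> m n \<noteq> 0 \<Longrightarrow> av n * bv n \<noteq> 0"
  unfolding good_def by blast

definition sgn_weight :: "real \<Rightarrow> real \<Rightarrow> int \<times> int \<Rightarrow> real" where
  "sgn_weight t1 t2 n = (sgn (t2 - hyp_param (av n) (bv n)) - sgn (t1 - hyp_param (av n) (bv n))) / 2"

text \<open>One formula for the terms of both sums in \<open>\<Phi>\<close>, without the common
  factor \<open>\<surd>y\<close>: the absolute value of \<open>Q\<close> covers both signs.\<close>

definition psi_term where
  "psi_term m \<tau> t1 t2 n = m n * ec (Re \<tau> * (av n * bv n)) *
     of_real (sgn_weight t1 t2 n * K0_full (2 * pi * \<bar>av n * bv n\<bar> * Im \<tau>))"

definition psi where "psi m \<tau> t1 t2 = infsum (psi_term m \<tau> t1 t2) UNIV"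

definition err_term where
  "err_term m \<tau> t n = m n * ec (Re \<tau> * (av n * bv n)) * of_real (err_int (Im \<tau>) (av n) (bv n) t)"

definition theta_term where
  "theta_term m \<tau> u n = m n * hyp_gauss \<tau> (av n * exp (- u)) (bv n * exp u)"

definition theta_int where
  "theta_int m \<tau> t1 t2 = of_real (sgn (t2 - t1)) * integral {min t1 t2..max t1 t2} (\<lambda>u. infsum (theta_term m \<tau> u) UNIV)"

lemma av_bv_Qf: "av n * bv n = Qf (fst n) (snd n)"
  by (simp add: av_def bv_def Qf_eq)

text \<open>Twice the form is an integer on the lattice. The majorant is therefore at least 1 on the
  support of a good \<open>m\<close>, which keeps the inverse square root in the Bessel bound under
  control.\<close>

lemma abs_av_bv_ge: "av n * bv n \<noteq> 0 \<Longrightarrow> 2 * \<bar>av n * bv n\<bar> \<ge> 1"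
proof -
  assume "av n * bv n \<noteq> 0"
  moreover have e: "2 * (av n * bv n) = of_int (Bf (fst n) (snd n) (fst n) (snd n))"
    unfolding av_bv_Qf by (rule two_Qf)
  ultimately have "Bf (fst n) (snd n) (fst n) (snd n) \<noteq> 0" by auto
  hence "\<bar>of_int (Bf (fst n) (snd n) (fst n) (snd n)) :: real\<bar> \<ge> 1" by linarith
  thus ?thesis unfolding e[symmetric] by (simp add: abs_mult)
qed

definition gdec :: "real \<Rightarrow> int \<times> int \<Rightarrow> real" where
  "gdec \<delta> n = exp (- \<delta> * ((of_int (fst n))\<^sup>2 + (of_int (snd n))\<^sup>2))"

lemma summable_gdec: "\<delta> > 0 \<Longrightarrow> gdec \<delta> summable_on UNIV"
  using summable_gaussian_int_pair[of \<delta>] unfolding gdec_def[abs_def] case_prod_unfold .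

lemma exp_majorant_le:
  assumes "y > 0" "\<bar>u\<bar> \<le> R"
  shows "exp (- (pi * y * majorant (av n) (bv n) u)) \<le> gdec (pi * y * exp (- 2 * R) * \<kappa>) n"
proof -
  have "\<kappa> * ((of_int (fst n))\<^sup>2 + (of_int (snd n))\<^sup>2) \<le> (av n)\<^sup>2 + (bv n)\<^sup>2"
    unfolding av_def bv_def by (rule al_be_ge)
  hence "exp (- 2 * R) * (\<kappa> * ((of_int (fst n))\<^sup>2 + (of_int (snd n))\<^sup>2)) \<le> exp (- 2 * R) * ((av n)\<^sup>2 + (bv n)\<^sup>2)"
    by (rule mult_left_mono) simp
  also have "\<dots> \<le> majorant (av n) (bv n) u" by (rule exp_abs_le_majorant[OF assms(2)])
  finally have "pi * y * (exp (- 2 * R) * (\<kappa> * ((of_int (fst n))\<^sup>2 + (of_int (snd n))\<^sup>2))) \<le> pi * y * majorant (av n) (bv n) u"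
    using assms(1) by (intro mult_left_mono) auto
  thus ?thesis by (simp add: gdec_def mult_ac)
qed

lemma gdec_exponent_pos: "y > 0 \<Longrightarrow> pi * y * exp (- 2 * R) * \<kappa> > 0"
  using kappa_pos by simp

lemma norm_ec [simp]: "norm (ec x) = 1" by (simp add: ec_def)

lemma norm_err_term_le:
  assumes "good m" "Im \<tau> > 0" "\<And>n. norm (m n) \<le> B"
  shows "norm (err_term m \<tau> t n) \<le> B * sqrt (1 / Im \<tau>) * gdec (pi * Im \<tau> * exp (- 2 * \<bar>t\<bar>) * \<kappa>) n"
proof (cases "m n = 0")
  case True
  have "B \<ge> 0" using assms(3)[of n] norm_ge_zero[of "m n"] by linarith
  thus ?thesis using True assms(2) by (simp add: err_term_def gdec_def)
next
  case False
  let ?R = "majorant (av n) (bv n) t" and ?y = "Im \<tau>"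
  have ab: "av n * bv n \<noteq> 0" using assms(1) False by (rule good_nz)
  have R: "?R \<ge> 1" using abs_av_bv_ge[OF ab] majorant_ge[of "av n" "bv n" t] by linarith
  have "\<bar>err_int ?y (av n) (bv n) t\<bar> \<le> K0_full (pi * ?y * ?R)" by (rule abs_err_int_le[OF ab assms(2)])
  also have "\<dots> \<le> exp (- (pi * ?y * ?R)) * sqrt (pi / (pi * ?y * ?R))"
    using assms(2) R by (intro K0_full_le) simp
  also have "\<dots> \<le> gdec (pi * ?y * exp (- 2 * \<bar>t\<bar>) * \<kappa>) n * sqrt (1 / ?y)"
  proof (rule mult_mono)
    show "exp (- (pi * ?y * ?R)) \<le> gdec (pi * ?y * exp (- 2 * \<bar>t\<bar>) * \<kappa>) n"
      by (rule exp_majorant_le[OF assms(2)]) simp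
    have "1 / (?y * ?R) \<le> 1 / ?y" using assms(2) R by (intro divide_left_mono) auto
    thus "sqrt (pi / (pi * ?y * ?R)) \<le> sqrt (1 / ?y)" by (simp add: mult.assoc)
  qed (use assms(2) R in \<open>auto simp: gdec_def intro!: mult_nonneg_nonneg\<close>)
  finally have e: "\<bar>err_int ?y (av n) (bv n) t\<bar> \<le> gdec (pi * ?y * exp (- 2 * \<bar>t\<bar>) * \<kappa>) n * sqrt (1 / ?y)" .
  have "norm (err_term m \<tau> t n) = norm (m n) * \<bar>err_int ?y (av n) (bv n) t\<bar>"
    by (simp add: err_term_def norm_mult)
  also have "\<dots> \<le> B * (gdec (pi * ?y * exp (- 2 * \<bar>t\<bar>) * \<kappa>) n * sqrt (1 / ?y))"
  proof (rule mult_mono[OF assms(3) e])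
    show "B \<ge> 0" using assms(3)[of n] norm_ge_zero[of "m n"] by linarith
  qed simp
  finally show ?thesis by (simp add: mult_ac)
qed

lemma summable_err_term:
  assumes "good m" "Im \<tau> > 0"
  shows "err_term m \<tau> t summable_on UNIV" and "(\<lambda>n. norm (err_term m \<tau> t n)) summable_on UNIV"
proof -
  obtain B where B: "\<And>n. norm (m n) \<le> B" using assms(1) by (auto simp: good_def)
  have s: "(\<lambda>n. B * sqrt (1 / Im \<tau>) * gdec (pi * Im \<tau> * exp (- 2 * \<bar>t\<bar>) * \<kappa>) n) summable_on UNIV"
    by (intro summable_on_cmult_right summable_gdec gdec_exponent_pos assms)
  show "err_term m \<tau> t summable_on UNIV" "(\<lambda>n. norm (err_term m \<tau> t n)) summable_on UNIV"
    using norm_summable_onI[OF s] norm_err_term_le[OF assms B] by blast+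
qed

lemma norm_theta_term_le:
  assumes "Im \<tau> > 0" "\<bar>u\<bar> \<le> R" "\<And>n. norm (m n) \<le> B"
  shows "norm (theta_term m \<tau> u n) \<le> B * gdec (pi * Im \<tau> * exp (- 2 * R) * \<kappa>) n"
proof -
  have B0: "B \<ge> 0" using assms(3)[of n] norm_ge_zero[of "m n"] by linarith
  have "norm (theta_term m \<tau> u n) = norm (m n) * exp (- (pi * Im \<tau> * majorant (av n) (bv n) u))"
    by (simp add: theta_term_def hyp_gauss_majorant norm_mult)
  also have "\<dots> \<le> B * gdec (pi * Im \<tau> * exp (- 2 * R) * \<kappa>) n"
    by (intro mult_mono assms(3) exp_majorant_le assms(1,2) B0) simp
  finally show ?thesis .
qed

lemma theta_int_has_sum:
  assumes "good m" "Im \<tau> > 0"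
  shows "((\<lambda>n. m n * ec (Re \<tau> * (av n * bv n)) * of_real (sgn (t2 - t1) *
      integral {min t1 t2..max t1 t2} (\<lambda>u. exp (- (pi * Im \<tau> * majorant (av n) (bv n) u))))) has_sum theta_int m \<tau> t1 t2) UNIV"
proof -
  obtain B where B: "\<And>n. norm (m n) \<le> B" using assms(1) by (auto simp: good_def)
  define R where "R = \<bar>t1\<bar> + \<bar>t2\<bar>"
  have "((\<lambda>n. integral {min t1 t2..max t1 t2} (\<lambda>u. theta_term m \<tau> u n)) has_sum
      integral {min t1 t2..max t1 t2} (\<lambda>u. \<Sum>\<^sub>\<infinity>n. theta_term m \<tau> u n)) UNIV"
  proof (rule has_sum_integral_uniform)
    show "continuous_on {min t1 t2..max t1 t2} (\<lambda>u. theta_term m \<tau> u n)" for n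
      unfolding theta_term_def hyp_gauss_majorant
      by (intro continuous_intros continuous_on_majorant)
    show "norm (theta_term m \<tau> u n) \<le> B * gdec (pi * Im \<tau> * exp (- 2 * R) * \<kappa>) n" if "u \<in> {min t1 t2..max t1 t2}" for u n
      using that by (intro norm_theta_term_le[OF assms(2) _ B]) (auto simp: R_def)
    show "(\<lambda>n. B * gdec (pi * Im \<tau> * exp (- 2 * R) * \<kappa>) n) summable_on UNIV"
      by (intro summable_on_cmult_right summable_gdec gdec_exponent_pos assms)
  qed
  from has_sum_cmult_right[OF this, of "of_real (sgn (t2 - t1))"]
  have "((\<lambda>n. of_real (sgn (t2 - t1)) * integral {min t1 t2..max t1 t2} (\<lambda>u. theta_term m \<tau> u n)) has_sum theta_int m \<tau> t1 t2) UNIV"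
    by (simp add: theta_int_def)
  moreover have "integral {min t1 t2..max t1 t2} (\<lambda>u. theta_term m \<tau> u n) =
     m n * ec (Re \<tau> * (av n * bv n)) * of_real (integral {min t1 t2..max t1 t2} (\<lambda>u. exp (- (pi * Im \<tau> * majorant (av n) (bv n) u))))" for n
  proof -
    let ?I = "{min t1 t2..max t1 t2}" and ?g = "\<lambda>u. exp (- (pi * Im \<tau> * majorant (av n) (bv n) u))"
    have "(?g has_integral integral ?I ?g) ?I"
      by (intro integrable_integral integrable_continuous_real continuous_intros continuous_on_majorant)
    hence "((\<lambda>u. complex_of_real (?g u)) has_integral of_real (integral ?I ?g)) ?I" by (rule has_integral_of_real)
    hence "((\<lambda>u. m n * ec (Re \<tau> * (av n * bv n)) * complex_of_real (?g u)) has_integral m n * ec (Re \<tau> * (av n * bv n)) * of_real (integral ?I ?g)) ?I"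
      by (rule has_integral_mult_right)
    thus ?thesis by (simp only: theta_term_def hyp_gauss_majorant mult.assoc[symmetric] integral_unique)
  qed
  ultimately show ?thesis by (simp only: of_real_mult mult_ac)
qed

lemma psi_term_decomposition:
  assumes "good m" "Im \<tau> > 0"
  shows "psi_term m \<tau> t1 t2 n = err_term m \<tau> t2 n - err_term m \<tau> t1 n +
    m n * ec (Re \<tau> * (av n * bv n)) * of_real (sgn (t2 - t1) *
      integral {min t1 t2..max t1 t2} (\<lambda>u. exp (- (pi * Im \<tau> * majorant (av n) (bv n) u))))"
proof (cases "m n = 0")
  case False
  with assms(1) have ab: "av n * bv n \<noteq> 0" by (rule good_nz)
  show ?thesis
    unfolding psi_term_def sgn_weight_def K0_weight_decomposition[OF ab assms(2)] err_term_def
    by (simp only: of_real_add of_real_diff ring_distribs)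
qed (simp add: psi_term_def err_term_def)

text \<open>Convergence is obtained together with the value, from the Gaussian bounds for the two
  errors and the theta part; no estimate of the weighted Bessel terms is made.\<close>

lemma psi_has_sum:
  assumes "good m" "Im \<tau> > 0"
  shows "(psi_term m \<tau> t1 t2 has_sum
     (infsum (err_term m \<tau> t2) UNIV - infsum (err_term m \<tau> t1) UNIV + theta_int m \<tau> t1 t2)) UNIV"
proof -
  have "((\<lambda>n. err_term m \<tau> t2 n - err_term m \<tau> t1 n + m n * ec (Re \<tau> * (av n * bv n)) * of_real (sgn (t2 - t1) *
      integral {min t1 t2..max t1 t2} (\<lambda>u. exp (- (pi * Im \<tau> * majorant (av n) (bv n) u))))) has_sum
     (infsum (err_term m \<tau> t2) UNIV - infsum (err_term m \<tau> t1) UNIV + theta_int m \<tau> t1 t2)) UNIV"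
    by (intro has_sum_add[OF has_sum_diff] has_sum_infsum summable_err_term theta_int_has_sum assms)
  moreover have "psi_term m \<tau> t1 t2 = (\<lambda>n. err_term m \<tau> t2 n - err_term m \<tau> t1 n + m n * ec (Re \<tau> * (av n * bv n)) * of_real (sgn (t2 - t1) *
      integral {min t1 t2..max t1 t2} (\<lambda>u. exp (- (pi * Im \<tau> * majorant (av n) (bv n) u)))))"
    by (rule ext) (rule psi_term_decomposition[OF assms])
  ultimately show ?thesis by (simp only:)
qed

lemma psi_summable: "good m \<Longrightarrow> Im \<tau> > 0 \<Longrightarrow> psi_term m \<tau> t1 t2 summable_on UNIV"
  using psi_has_sum has_sum_imp_summable by blast

lemma psi_eq: "good m \<Longrightarrow> Im \<tau> > 0 \<Longrightarrow>
    psi m \<tau> t1 t2 = infsum (err_term m \<tau> t2) UNIV - infsum (err_term m \<tau> t1) UNIV + theta_int m \<tau> t1 t2"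
  unfolding psi_def using psi_has_sum infsumI by blast

lemma psi_additive:
  assumes "good m" "Im \<tau> > 0"
  shows "psi m \<tau> t1 t2 + psi m \<tau> t2 t3 = psi m \<tau> t1 t3"
proof -
  have "psi_term m \<tau> t1 t3 = (\<lambda>n. psi_term m \<tau> t1 t2 n + psi_term m \<tau> t2 t3 n)"
    by (rule ext) (simp add: psi_term_def sgn_weight_def ring_distribs[symmetric] add_divide_distrib[symmetric] flip: of_real_add)
  thus ?thesis unfolding psi_def using psi_summable[OF assms] by (simp add: infsum_add)
qed

text \<open>What an automorphism does to integer coordinates: it preserves \<open>Q\<close> and
  moves \<open>hyp_param\<close> by \<open>s\<close> wherever \<open>Q\<close> is nonzero.\<close>

definition hyp_shift :: "(int \<times> int \<Rightarrow> int \<times> int) \<Rightarrow> real \<Rightarrow> bool" where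
  "hyp_shift g s \<longleftrightarrow> bij g \<and> (\<forall>n. av (g n) = exp s * av n \<and> bv (g n) = exp (- s) * bv n)"

lemma hyp_shiftD:
  assumes "hyp_shift g s"
  shows "av (g n) = exp s * av n" "bv (g n) = exp (- s) * bv n"
  using assms unfolding hyp_shift_def by blast+

lemma hyp_shift_prod: "hyp_shift g s \<Longrightarrow> av (g n) * bv (g n) = av n * bv n"
  by (simp add: hyp_shiftD exp_minus field_simps)

lemma good_compose: "hyp_shift g s \<Longrightarrow> good m \<Longrightarrow> good (m \<circ> g)"
  unfolding good_def o_def by (metis hyp_shift_prod)

lemma infsum_err_shift:
  assumes g: "hyp_shift g s" and m: "good m"
  shows "infsum (err_term m \<tau> (t + s)) UNIV = infsum (err_term (m \<circ> g) \<tau> t) UNIV"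
proof -
  have bij: "bij_betw g UNIV UNIV" using g by (simp add: hyp_shift_def)
  have "infsum (err_term m \<tau> (t + s)) UNIV = (\<Sum>\<^sub>\<infinity>n. err_term m \<tau> (t + s) (g n))"
    by (rule infsum_reindex_bij_betw[OF bij, symmetric])
  also have "\<dots> = infsum (err_term (m \<circ> g) \<tau> t) UNIV"
  proof (rule infsum_cong)
    fix n
    show "err_term m \<tau> (t + s) (g n) = err_term (m \<circ> g) \<tau> t n"
    proof (cases "m (g n) = 0")
      case False
      hence "av n * bv n \<noteq> 0" using m hyp_shift_prod[OF g] unfolding good_def by metis
      from err_int_scale[OF this, of "Im \<tau>" s t] show ?thesis
        by (simp add: err_term_def hyp_shift_prod[OF g]) (simp add: hyp_shiftD[OF g])
    qed (simp add: err_term_def)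
  qed
  finally show ?thesis .
qed

lemma psi_shift:
  assumes g: "hyp_shift g s" and m: "good m"
  shows "psi m \<tau> (t1 + s) (t2 + s) = psi (m \<circ> g) \<tau> t1 t2"
proof -
  have bij: "bij_betw g UNIV UNIV" using g by (simp add: hyp_shift_def)
  have "psi m \<tau> (t1 + s) (t2 + s) = (\<Sum>\<^sub>\<infinity>n. psi_term m \<tau> (t1 + s) (t2 + s) (g n))"
    unfolding psi_def by (rule infsum_reindex_bij_betw[OF bij, symmetric])
  also have "\<dots> = psi (m \<circ> g) \<tau> t1 t2"
    unfolding psi_def
  proof (rule infsum_cong)
    fix n
    show "psi_term m \<tau> (t1 + s) (t2 + s) (g n) = psi_term (m \<circ> g) \<tau> t1 t2 n"
    proof (cases "m (g n) = 0")
      case False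
      hence ab: "av n * bv n \<noteq> 0" using m hyp_shift_prod[OF g] unfolding good_def by metis
      have "hyp_param (av (g n)) (bv (g n)) = hyp_param (av n) (bv n) + s"
        using hyp_param_scale[OF ab, of s] by (simp only: hyp_shiftD[OF g])
      thus ?thesis
        by (simp add: psi_term_def sgn_weight_def hyp_shift_prod[OF g])
    qed (simp add: psi_term_def)
  qed
  finally show ?thesis .
qed

text \<open>The relation between the coefficient functions may be paired with any fixed
  \<open>f\<close> for which all series converge. It is applied once with the error at
  \<open>t\<close> and once with the Bessel terms between two parameters.\<close>

lemma sum_linear_cancel:
  assumes J: "finite J" and zero: "\<And>n. (\<Sum>j\<in>J. m j n - m j (g j n)) = 0"
    and s1: "\<And>j. j \<in> J \<Longrightarrow> (\<lambda>n. m j n * f n) summable_on UNIV"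
    and s2: "\<And>j. j \<in> J \<Longrightarrow> (\<lambda>n. m j (g j n) * (f n :: complex)) summable_on UNIV"
  shows "(\<Sum>j\<in>J. (\<Sum>\<^sub>\<infinity>n. m j n * f n)) = (\<Sum>j\<in>J. (\<Sum>\<^sub>\<infinity>n. m j (g j n) * f n))"
proof -
  have "((\<lambda>n. \<Sum>j\<in>J. m j n * f n) has_sum (\<Sum>j\<in>J. (\<Sum>\<^sub>\<infinity>n. m j n * f n))) UNIV"
    by (intro has_sum_finite_sum J has_sum_infsum s1)
  moreover have "((\<lambda>n. \<Sum>j\<in>J. m j (g j n) * f n) has_sum (\<Sum>j\<in>J. (\<Sum>\<^sub>\<infinity>n. m j (g j n) * f n))) UNIV"
    by (intro has_sum_finite_sum J has_sum_infsum s2)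
  moreover have "(\<Sum>j\<in>J. m j n * f n) = (\<Sum>j\<in>J. m j (g j n) * f n)" for n
    using zero[of n] by (simp add: sum_distrib_right[symmetric] sum_subtractf)
  ultimately show ?thesis using has_sum_unique by fastforce
qed

text \<open>By equivariance the error of \<open>m j\<close> at \<open>t + s j\<close> is the error
  of \<open>m j \<circ> g j\<close> at \<open>t\<close>. All errors are thereby taken at the same
  parameter, where the linear relation applies.\<close>

lemma sum_psi_eq_theta_int:
  assumes J: "finite J" and good: "\<And>j. j \<in> J \<Longrightarrow> good (m j)" and g: "\<And>j. j \<in> J \<Longrightarrow> hyp_shift (g j) (s j)"
    and zero: "\<And>n. (\<Sum>j\<in>J. m j n - m j (g j n)) = 0" and \<tau>: "Im \<tau> > 0"
  shows "(\<Sum>j\<in>J. psi (m j) \<tau> t (t + s j)) = (\<Sum>j\<in>J. theta_int (m j) \<tau> t (t + s j))"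
proof -
  let ?f = "\<lambda>n. ec (Re \<tau> * (av n * bv n)) * of_real (err_int (Im \<tau>) (av n) (bv n) t)"
  have "(\<Sum>j\<in>J. infsum (err_term (m j) \<tau> t) UNIV) = (\<Sum>j\<in>J. infsum (err_term (m j) \<tau> (t + s j)) UNIV)"
  proof -
    have e1: "err_term (m j) \<tau> t = (\<lambda>n. m j n * ?f n)" "err_term (m j \<circ> g j) \<tau> t = (\<lambda>n. m j (g j n) * ?f n)" for j
      by (simp_all add: err_term_def mult.assoc fun_eq_iff)
    have "(\<Sum>j\<in>J. infsum (err_term (m j) \<tau> t) UNIV) = (\<Sum>j\<in>J. infsum (err_term (m j \<circ> g j) \<tau> t) UNIV)"
      unfolding e1
      by (rule sum_linear_cancel[OF J zero])
         (use summable_err_term(1)[OF good \<tau>, of _ t, unfolded e1] summable_err_term(1)[OF good_compose[OF g good] \<tau>, of j j t for j, unfolded e1] in blast)+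
    also have "\<dots> = (\<Sum>j\<in>J. infsum (err_term (m j) \<tau> (t + s j)) UNIV)"
      using infsum_err_shift[OF g good] by (intro sum.cong) auto
    finally show ?thesis .
  qed
  moreover have "(\<Sum>j\<in>J. psi (m j) \<tau> t (t + s j)) = (\<Sum>j\<in>J. infsum (err_term (m j) \<tau> (t + s j)) UNIV - infsum (err_term (m j) \<tau> t) UNIV + theta_int (m j) \<tau> t (t + s j))"
    using psi_eq[OF good \<tau>] by (intro sum.cong) auto
  ultimately show ?thesis by (simp add: sum.distrib sum_subtractf)
qed

text \<open>Going from \<open>t\<close> to \<open>t' + s j\<close> through \<open>t + s j\<close> or
  through \<open>t'\<close> gives the same total. The two remaining sides are translates of one
  another, and the linear relation equates their sums.\<close>

lemma sum_psi_independent: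
  assumes J: "finite J" and good: "\<And>j. j \<in> J \<Longrightarrow> good (m j)" and g: "\<And>j. j \<in> J \<Longrightarrow> hyp_shift (g j) (s j)"
    and zero: "\<And>n. (\<Sum>j\<in>J. m j n - m j (g j n)) = 0" and \<tau>: "Im \<tau> > 0"
  shows "(\<Sum>j\<in>J. psi (m j) \<tau> t (t + s j)) = (\<Sum>j\<in>J. psi (m j) \<tau> t' (t' + s j))"
proof -
  let ?f = "\<lambda>n. ec (Re \<tau> * (av n * bv n)) * of_real (sgn_weight t t' n * K0_full (2 * pi * \<bar>av n * bv n\<bar> * Im \<tau>))"
  have e1: "psi_term (m j) \<tau> t t' = (\<lambda>n. m j n * ?f n)" "psi_term (m j \<circ> g j) \<tau> t t' = (\<lambda>n. m j (g j n) * ?f n)" for j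
    by (simp_all add: psi_term_def mult.assoc fun_eq_iff)
  have "(\<Sum>j\<in>J. psi (m j) \<tau> t t') = (\<Sum>j\<in>J. psi (m j \<circ> g j) \<tau> t t')"
    unfolding psi_def e1
    by (rule sum_linear_cancel[OF J zero])
       (use psi_summable[OF good \<tau>, of _ t t', unfolded e1] psi_summable[OF good_compose[OF g good] \<tau>, of j j t t' for j, unfolded e1] in blast)+
  also have "\<dots> = (\<Sum>j\<in>J. psi (m j) \<tau> (t + s j) (t' + s j))"
    using psi_shift[OF g good] by (intro sum.cong) auto
  finally have *: "(\<Sum>j\<in>J. psi (m j) \<tau> t t') = (\<Sum>j\<in>J. psi (m j) \<tau> (t + s j) (t' + s j))" .
  have "(\<Sum>j\<in>J. psi (m j) \<tau> t (t + s j)) + (\<Sum>j\<in>J. psi (m j) \<tau> (t + s j) (t' + s j))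
     = (\<Sum>j\<in>J. psi (m j) \<tau> t t') + (\<Sum>j\<in>J. psi (m j) \<tau> t' (t' + s j))"
    unfolding sum.distrib[symmetric] using psi_additive[OF good \<tau>] by (intro sum.cong) auto
  thus ?thesis using * by simp
qed

lemma exp_cancel: "a * exp (- u) * (b * exp u) = a * (b::real)"
  by (simp add: exp_minus field_simps)

lemma rescaled_form: "hyp_binary_form p q r (a1 * exp (- u)) (a2 * exp (- u)) (b1 * exp u) (b2 * exp u)"
proof
  show "2 * (a1 * exp (- u)) * (b1 * exp u) = of_int p" "2 * (a2 * exp (- u)) * (b2 * exp u) = of_int r"
    using pq exp_cancel[of a1 u b1] exp_cancel[of a2 u b2] by (simp_all only: mult.assoc)
  show "a1 * exp (- u) * (b2 * exp u) + a2 * exp (- u) * (b1 * exp u) = of_int q"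
    using pq by (simp only: exp_cancel)
  show "a1 * exp (- u) * (b2 * exp u) - a2 * exp (- u) * (b1 * exp u) \<noteq> 0"
    using det_nz by (simp only: exp_cancel not_False_eq_True)
qed

text \<open>The series at \<open>u\<close> is the theta series formed with rescaled linear factors.
  As the multiplier is the same for every \<open>u\<close>, it can later be taken out of the
  integral over the curve.\<close>

lemma theta_term_modular:
  assumes L: "L > 0" and m: "per2 L (\<lambda>x y. m (x, y))" and N: "N = 4 * L * L * dsc"
    and det: "a * d - b * c = 1" and cong: "N dvd a - 1" "N dvd b" "N dvd c" "N dvd d - 1"
    and \<tau>: "Im \<tau> > 0"
  shows "infsum (theta_term m ((of_int a * \<tau> + of_int b) / (of_int c * \<tau> + of_int d)) u) UNIV =
    theta_mult L a c * of_real (norm (of_int c * \<tau> + of_int d)) * infsum (theta_term m \<tau> u) UNIV"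
proof -
  interpret U: hyp_binary_form p q r "a1 * exp (- u)" "a2 * exp (- u)" "b1 * exp u" "b2 * exp u"
    by (rule rescaled_form)
  have th: "U.theta (\<lambda>x y. m (x, y)) \<tau> = infsum (theta_term m \<tau> u) UNIV" for \<tau>
    unfolding U.theta_def theta_term_def
    by (intro infsum_cong) (auto simp: av_def bv_def al_def be_def U.al_def U.be_def algebra_simps)
  have "U.\<Delta> = \<Delta>" unfolding U.\<Delta>_def \<Delta>_def exp_cancel ..
  hence "U.theta_mult L a c = theta_mult L a c" by (simp add: U.theta_mult_def theta_mult_def)
  thus ?thesis using U.theta_modular[OF L m N det cong \<tau>] by (simp add: th)
qed

lemma theta_int_modular:
  assumes L: "L > 0" and m: "per2 L (\<lambda>x y. m (x, y))" and N: "N = 4 * L * L * dsc"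
    and det: "a * d - b * c = 1" and cong: "N dvd a - 1" "N dvd b" "N dvd c" "N dvd d - 1"
    and \<tau>: "Im \<tau> > 0"
  shows "theta_int m ((of_int a * \<tau> + of_int b) / (of_int c * \<tau> + of_int d)) t1 t2 =
    theta_mult L a c * of_real (norm (of_int c * \<tau> + of_int d)) * theta_int m \<tau> t1 t2"
  unfolding theta_int_def theta_term_modular[OF assms] by simp

end

subsection \<open>Eigenfunctions of the Laplacian\<close>

lemma integral_count_space_infsum:
  fixes f :: "'a \<Rightarrow> complex"
  assumes "(\<lambda>n. norm (f n)) summable_on UNIV"
  shows "integrable (count_space UNIV) f" "(LINT n|count_space UNIV. f n) = infsum f UNIV"
proof -
  have a: "Infinite_Set_Sum.abs_summable_on f UNIV" using assms abs_summable_equivalent by blast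
  thus "integrable (count_space UNIV) f" by (simp add: abs_summable_on_def)
  show "(LINT n|count_space UNIV. f n) = infsum f UNIV"
    using infsetsum_infsum[OF a] by (simp add: infsetsum_def)
qed

lemma upper_half_plane_open: "open upper_half_plane"
  unfolding upper_half_plane_def by (rule open_halfspace_Im_gt)

lemma partials_of_has_derivative:
  assumes "(F has_derivative (\<lambda>h. of_real (Re h) * a + of_real (Im h) * b)) (at \<tau>)"
  shows "partial_x F \<tau> = a" "partial_y F \<tau> = b"
proof -
  have F: "(F has_derivative (\<lambda>h. of_real (Re h) * a + of_real (Im h) * b)) (at (\<tau> + of_real 0))"
    "(F has_derivative (\<lambda>h. of_real (Re h) * a + of_real (Im h) * b)) (at (\<tau> + \<i> * of_real 0))"
    using assms by simp_all
  have "((\<lambda>s. \<tau> + of_real s) has_derivative (\<lambda>s. of_real s)) (at (0::real))"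
    by (auto intro!: derivative_eq_intros)
  from has_derivative_compose[OF this F(1)]
  have "((\<lambda>s. F (\<tau> + of_real s)) has_vector_derivative a) (at 0)"
    by (simp add: has_vector_derivative_def scaleR_conv_of_real)
  thus "partial_x F \<tau> = a" unfolding partial_x_def by (rule vector_derivative_at)
  have "((\<lambda>s. \<tau> + \<i> * of_real s) has_derivative (\<lambda>s. \<i> * of_real s)) (at (0::real))"
    by (auto intro!: derivative_eq_intros)
  from has_derivative_compose[OF this F(2)]
  have "((\<lambda>s. F (\<tau> + \<i> * of_real s)) has_vector_derivative b) (at 0)"
    by (simp add: has_vector_derivative_def scaleR_conv_of_real)
  thus "partial_y F \<tau> = b" unfolding partial_y_def by (rule vector_derivative_at)
qed

text \<open>A total derivative with its two components named. Keeping the components as functions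
  makes the next differentiation possible, although \<open>partial_x\<close> and
  \<open>partial_y\<close> are identified with them only on the open half-plane.\<close>

definition has_partials :: "(complex \<Rightarrow> complex) \<Rightarrow> (complex \<Rightarrow> complex) \<Rightarrow> (complex \<Rightarrow> complex) \<Rightarrow> bool" where
  "has_partials F Fx Fy \<longleftrightarrow> (\<forall>\<tau>\<in>upper_half_plane.
     (F has_derivative (\<lambda>h. of_real (Re h) * Fx \<tau> + of_real (Im h) * Fy \<tau>)) (at \<tau>))"

lemma has_partials_cong:
  assumes "has_partials F Fx Fy" "\<And>\<tau>. \<tau> \<in> upper_half_plane \<Longrightarrow> F \<tau> = G \<tau>"
  shows "has_partials G Fx Fy"
  unfolding has_partials_def
proof
  fix \<tau> assume \<tau>: "\<tau> \<in> upper_half_plane"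
  have "(F has_derivative (\<lambda>h. of_real (Re h) * Fx \<tau> + of_real (Im h) * Fy \<tau>)) (at \<tau>)"
    using assms(1) \<tau> unfolding has_partials_def by blast
  thus "(G has_derivative (\<lambda>h. of_real (Re h) * Fx \<tau> + of_real (Im h) * Fy \<tau>)) (at \<tau>)"
    by (rule has_derivative_transform_within_open[OF _ upper_half_plane_open \<tau>]) (rule assms(2))
qed

lemma has_partials_differentiable: "has_partials F Fx Fy \<Longrightarrow> F differentiable_on upper_half_plane"
  unfolding has_partials_def differentiable_on_def differentiable_def
  using has_derivative_at_withinI by blast

lemma has_partialsD:
  assumes "has_partials F Fx Fy" "\<tau> \<in> upper_half_plane"
  shows "partial_x F \<tau> = Fx \<tau>" "partial_y F \<tau> = Fy \<tau>"
  using partials_of_has_derivative assms unfolding has_partials_def by blast+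

lemma second_partials:
  assumes F: "has_partials F Fx Fy" and Fx: "has_partials Fx Fxx Fxy" and Fy: "has_partials Fy Fyx Fyy"
  shows "\<And>\<tau>. \<tau> \<in> upper_half_plane \<Longrightarrow> partial_x (partial_x F) \<tau> = Fxx \<tau>"
    "\<And>\<tau>. \<tau> \<in> upper_half_plane \<Longrightarrow> partial_y (partial_y F) \<tau> = Fyy \<tau>"
    and Ck_upper_2I: "continuous_on upper_half_plane Fxx \<Longrightarrow> continuous_on upper_half_plane Fxy \<Longrightarrow>
      continuous_on upper_half_plane Fyx \<Longrightarrow> continuous_on upper_half_plane Fyy \<Longrightarrow> Ck_upper 2 F"
proof -
  have x: "has_partials (partial_x F) Fxx Fxy" by (rule has_partials_cong[OF Fx]) (simp add: has_partialsD[OF F])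
  have y: "has_partials (partial_y F) Fyx Fyy" by (rule has_partials_cong[OF Fy]) (simp add: has_partialsD[OF F])
  show "\<And>\<tau>. \<tau> \<in> upper_half_plane \<Longrightarrow> partial_x (partial_x F) \<tau> = Fxx \<tau>"
    "\<And>\<tau>. \<tau> \<in> upper_half_plane \<Longrightarrow> partial_y (partial_y F) \<tau> = Fyy \<tau>"
    using has_partialsD[OF x] has_partialsD[OF y] by auto
  assume c: "continuous_on upper_half_plane Fxx" "continuous_on upper_half_plane Fxy"
      "continuous_on upper_half_plane Fyx" "continuous_on upper_half_plane Fyy"
  have "continuous_on upper_half_plane (partial_x (partial_x F))" "continuous_on upper_half_plane (partial_y (partial_x F))"
    "continuous_on upper_half_plane (partial_x (partial_y F))" "continuous_on upper_half_plane (partial_y (partial_y F))"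
    using c by (auto simp: has_partialsD[OF x] has_partialsD[OF y] cong: continuous_on_cong)
  thus "Ck_upper 2 F"
    using has_partials_differentiable[OF F] has_partials_differentiable[OF x] has_partials_differentiable[OF y]
    by (simp add: numeral_2_eq_2)
qed

lemma has_partials_continuous: "has_partials F Fx Fy \<Longrightarrow> continuous_on upper_half_plane F"
  by (rule differentiable_imp_continuous_on) (rule has_partials_differentiable)

lemma has_partials_add:
  assumes "has_partials F Fx Fy" "has_partials G Gx Gy"
  shows "has_partials (\<lambda>\<tau>. F \<tau> + G \<tau>) (\<lambda>\<tau>. Fx \<tau> + Gx \<tau>) (\<lambda>\<tau>. Fy \<tau> + Gy \<tau>)"
  unfolding has_partials_def
proof
  fix \<tau> assume "\<tau> \<in> upper_half_plane"
  hence "((\<lambda>\<tau>. F \<tau> + G \<tau>) has_derivative (\<lambda>h. (of_real (Re h) * Fx \<tau> + of_real (Im h) * Fy \<tau>) + (of_real (Re h) * Gx \<tau> + of_real (Im h) * Gy \<tau>))) (at \<tau>)"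
    using assms unfolding has_partials_def by (intro has_derivative_add) auto
  thus "((\<lambda>\<tau>. F \<tau> + G \<tau>) has_derivative (\<lambda>h. of_real (Re h) * (Fx \<tau> + Gx \<tau>) + of_real (Im h) * (Fy \<tau> + Gy \<tau>))) (at \<tau>)"
    by (simp add: algebra_simps)
qed

lemma has_partials_cmult:
  assumes "has_partials F Fx Fy"
  shows "has_partials (\<lambda>\<tau>. k * F \<tau>) (\<lambda>\<tau>. k * Fx \<tau>) (\<lambda>\<tau>. k * Fy \<tau>)"
  unfolding has_partials_def
proof
  fix \<tau> assume "\<tau> \<in> upper_half_plane"
  hence "((\<lambda>\<tau>. k * F \<tau>) has_derivative (\<lambda>h. k * (of_real (Re h) * Fx \<tau> + of_real (Im h) * Fy \<tau>))) (at \<tau>)"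
    using assms unfolding has_partials_def by (intro has_derivative_mult_right) auto
  thus "((\<lambda>\<tau>. k * F \<tau>) has_derivative (\<lambda>h. of_real (Re h) * (k * Fx \<tau>) + of_real (Im h) * (k * Fy \<tau>))) (at \<tau>)"
    by (simp add: algebra_simps)
qed

section \<open>The Laplacian of powers of y times oscillating integrals\<close>

context osc_laplace_exponents
begin

text \<open>The linear span of these functions is closed under both partial derivatives;
  differentiating the power lowers \<open>e\<close> by one.\<close>

definition PL :: "real \<Rightarrow> ('a \<Rightarrow> complex) \<Rightarrow> complex \<Rightarrow> complex" where
  "PL e w \<tau> = of_real (Im \<tau> powr e) * osc_laplace M a c w \<tau>"

abbreviation wx where "wx w \<equiv> (\<lambda>u. \<i> * of_real (a u) * w u)"
abbreviation wy where "wy w \<equiv> (\<lambda>u. - of_real (c u) * w u)"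

lemma has_partials_PL:
  assumes w: "admissible w"
  shows "has_partials (PL e w) (PL e (wx w)) (\<lambda>\<tau>. of_real e * PL (e - 1) w \<tau> + PL e (wy w) \<tau>)"
  unfolding has_partials_def
proof
  fix \<tau> assume "\<tau> \<in> upper_half_plane"
  hence \<tau>: "Im \<tau> > 0" by (simp add: upper_half_plane_def)
  have "((\<lambda>y. y powr e) has_real_derivative e * Im \<tau> powr (e - 1)) (at (Im \<tau>))"
    using \<tau> by (rule has_real_derivative_powr)
  hence "((\<lambda>y. y powr e) has_derivative (\<lambda>h. e * Im \<tau> powr (e - 1) * h)) (at (Im \<tau>))"
    by (simp add: has_field_derivative_def)
  from has_derivative_compose[OF has_derivative_Im[OF has_derivative_ident] this]
  have "((\<lambda>\<tau>. Im \<tau> powr e) has_derivative (\<lambda>h. e * Im \<tau> powr (e - 1) * Im h)) (at \<tau>)" by simp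
  hence "((\<lambda>\<tau>. complex_of_real (Im \<tau> powr e)) has_derivative (\<lambda>h. of_real (e * Im \<tau> powr (e - 1) * Im h))) (at \<tau>)"
    by (rule has_derivative_of_real)
  from has_derivative_mult[OF this osc_laplace_has_derivative[OF w \<tau>]]
  show "(PL e w has_derivative (\<lambda>h. of_real (Re h) * PL e (wx w) \<tau> + of_real (Im h) * (of_real e * PL (e - 1) w \<tau> + PL e (wy w) \<tau>))) (at \<tau>)"
    unfolding PL_def[abs_def] by (simp add: algebra_simps)
qed

text \<open>For \<open>G = osc_laplace M a c w\<close> the operator sends
  \<open>y\<^sup>1\<^sup>/\<^sup>2 G\<close> to \<open>y\<^sup>1\<^sup>/\<^sup>2 G / 4 -
  y\<^sup>3\<^sup>/\<^sup>2 (G\<^sub>y + y (G\<^sub>x\<^sub>x + G\<^sub>y\<^sub>y))\<close>. The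
  eigenvalue comes from the power of \<open>y\<close> alone, and the assumption \<open>eq\<close>
  removes the rest.\<close>

lemma PL_half_maass:
  assumes w: "admissible w"
    and eq: "\<And>\<tau>. Im \<tau> > 0 \<Longrightarrow> osc_laplace M a c (wy w) \<tau> +
       of_real (Im \<tau>) * (osc_laplace M a c (wx (wx w)) \<tau> + osc_laplace M a c (wy (wy w)) \<tau>) = 0"
    and F: "\<And>\<tau>. \<tau> \<in> upper_half_plane \<Longrightarrow> F \<tau> = PL (1/2) w \<tau>"
  shows "Ck_upper 2 F" and "\<And>\<tau>. \<tau> \<in> upper_half_plane \<Longrightarrow> laplace0 F \<tau> = 1/4 * F \<tau>"
proof -
  note ad = w admissible_a admissible_c
  have P: "has_partials F (PL (1/2) (wx w)) (\<lambda>\<tau>. of_real (1/2) * PL (1/2 - 1) w \<tau> + PL (1/2) (wy w) \<tau>)"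
    by (rule has_partials_cong[OF has_partials_PL[OF w]]) (simp add: F)
  have Px: "has_partials (PL (1/2) (wx w)) (PL (1/2) (wx (wx w))) (\<lambda>\<tau>. of_real (1/2) * PL (1/2 - 1) (wx w) \<tau> + PL (1/2) (wy (wx w)) \<tau>)"
    by (intro has_partials_PL ad)
  have Py: "has_partials (\<lambda>\<tau>. of_real (1/2) * PL (1/2 - 1) w \<tau> + PL (1/2) (wy w) \<tau>)
     (\<lambda>\<tau>. of_real (1/2) * PL (1/2 - 1) (wx w) \<tau> + PL (1/2) (wx (wy w)) \<tau>)
     (\<lambda>\<tau>. of_real (1/2) * (of_real (1/2 - 1) * PL (1/2 - 1 - 1) w \<tau> + PL (1/2 - 1) (wy w) \<tau>)
        + (of_real (1/2) * PL (1/2 - 1) (wy w) \<tau> + PL (1/2) (wy (wy w)) \<tau>))"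
    by (intro has_partials_add has_partials_cmult has_partials_PL ad)
  have cont: "continuous_on upper_half_plane (PL e v)" if "admissible v" for e v
    using has_partials_PL[OF that] by (rule has_partials_continuous)
  show "Ck_upper 2 F"
    by (rule Ck_upper_2I[OF P Px Py]) (intro continuous_intros cont ad)+
  fix \<tau> assume \<tau>: "\<tau> \<in> upper_half_plane"
  define y where "y = Im \<tau>"
  have y: "y > 0" using \<tau> by (simp add: y_def upper_half_plane_def)
  define O0 where "O0 = osc_laplace M a c w \<tau>"
  define Oy where "Oy = osc_laplace M a c (wy w) \<tau>"
  define Oxx where "Oxx = osc_laplace M a c (wx (wx w)) \<tau>"
  define Oyy where "Oyy = osc_laplace M a c (wy (wy w)) \<tau>"
  have e: "Oy + of_real y * (Oxx + Oyy) = 0" using eq[of \<tau>] y by (simp add: y_def Oy_def Oxx_def Oyy_def)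
  have p1: "y powr (1/2) = y\<^sup>2 * y powr (1/2 - 1 - 1)" "y powr (1/2 - 1) = y * y powr (1/2 - 1 - 1)"
  proof -
    have "y powr (2 + (1/2 - 1 - 1)) = y powr 2 * y powr (1/2 - 1 - 1)" "y powr (1 + (1/2 - 1 - 1)) = y powr 1 * y powr (1/2 - 1 - 1)"
      by (rule powr_add)+
    moreover have "y powr 2 = y\<^sup>2" "y powr 1 = y" "2 + (1/2 - 1 - 1) = (1/2 :: real)" "1 + (1/2 - 1 - 1) = (1/2 - 1 :: real)"
      using y by simp_all
    ultimately show "y powr (1/2) = y\<^sup>2 * y powr (1/2 - 1 - 1)" "y powr (1/2 - 1) = y * y powr (1/2 - 1 - 1)"
      by (simp_all only:)
  qed
  define q where "q = complex_of_real (y powr (1/2 - 1 - 1))"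
  have "laplace0 F \<tau> = - of_real (y\<^sup>2) * (of_real (y powr (1/2)) * Oxx +
     (of_real (1/2) * (of_real (1/2 - 1) * (of_real (y powr (1/2 - 1 - 1)) * O0) + of_real (y powr (1/2 - 1)) * Oy)
        + (of_real (1/2) * (of_real (y powr (1/2 - 1)) * Oy) + of_real (y powr (1/2)) * Oyy)))"
    unfolding laplace0_def second_partials(1)[OF P Px Py \<tau>] second_partials(2)[OF P Px Py \<tau>]
    by (simp only: PL_def O0_def Oy_def Oxx_def Oyy_def y_def)
  also have "\<dots> = 1/4 * ((of_real (y\<^sup>2) * q) * O0) - of_real (y\<^sup>2) * (of_real y * q) * (Oy + of_real y * (Oxx + Oyy))"
    unfolding p1 of_real_mult q_def by (simp add: power2_eq_square algebra_simps)
  also have "\<dots> = 1/4 * F \<tau>"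
    unfolding e F[OF \<tau>] PL_def y_def[symmetric] p1(1) by (simp add: q_def O0_def)
  finally show "laplace0 F \<tau> = 1/4 * F \<tau>" .
qed

end

text \<open>Bessel's equation for \<open>K\<^sub>0(X y)\<close> in integral form. The integrand is
  the derivative of \<open>- (X / 2) * sinh (2 * s) * exp (- (X * cosh (2 * s)) * y)\<close>, which
  tends to 0 at both ends.\<close>

lemma bessel_integration_by_parts:
  fixes X y :: real
  assumes X: "X > 0" and y: "y > 0"
    and int: "integrable lborel (\<lambda>s. complex_of_real ((- (X * cosh (2 * s)) + y * ((X * cosh (2 * s))\<^sup>2 - X\<^sup>2)) * exp (- (X * cosh (2 * s)) * y)))"
  shows "(LINT s|lborel. complex_of_real ((- (X * cosh (2 * s)) + y * ((X * cosh (2 * s))\<^sup>2 - X\<^sup>2)) * exp (- (X * cosh (2 * s)) * y))) = 0"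
proof -
  define h where "h = (\<lambda>s. (- (X * cosh (2 * s)) + y * ((X * cosh (2 * s))\<^sup>2 - X\<^sup>2)) * exp (- (X * cosh (2 * s)) * y))"
  define H where "H = (\<lambda>s. - (X / 2) * sinh (2 * s) * exp (- (X * cosh (2 * s)) * y))"
  have D: "(H has_real_derivative h s) (at s)" for s
  proof -
    have "(H has_real_derivative (- (X / 2) * (cosh (2 * s) * 2)) * exp (- (X * cosh (2 * s)) * y)
       + (- (X / 2) * sinh (2 * s)) * (exp (- (X * cosh (2 * s)) * y) * (- (X * (sinh (2 * s) * 2)) * y))) (at s)"
      unfolding H_def by (auto intro!: derivative_eq_intros simp: field_simps)
    moreover have "(- (X / 2) * (cosh (2 * s) * 2)) * exp (- (X * cosh (2 * s)) * y)
       + (- (X / 2) * sinh (2 * s)) * (exp (- (X * cosh (2 * s)) * y) * (- (X * (sinh (2 * s) * 2)) * y)) = h s"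
    proof -
      have "(- (X / 2) * (cosh (2 * s) * 2)) * exp (- (X * cosh (2 * s)) * y)
       + (- (X / 2) * sinh (2 * s)) * (exp (- (X * cosh (2 * s)) * y) * (- (X * (sinh (2 * s) * 2)) * y))
       = (- (X * cosh (2 * s)) + y * (X\<^sup>2 * (sinh (2 * s))\<^sup>2)) * exp (- (X * cosh (2 * s)) * y)"
        by (simp add: power2_eq_square algebra_simps)
      also have "\<dots> = h s" unfolding h_def sinh_square_eq by (simp add: power_mult_distrib algebra_simps)
      finally show ?thesis .
    qed
    ultimately show ?thesis by simp
  qed
  have intg: "integral {- real N..real N} (\<lambda>s. complex_of_real (h s)) = of_real (2 * H (real N))" for N
  proof -
    have "(h has_integral H (real N) - H (- real N)) {- real N..real N}"
      using D by (intro fundamental_theorem_of_calculus)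
         (auto simp: has_real_derivative_iff_has_vector_derivative[symmetric] intro: has_field_derivative_at_within)
    hence "((\<lambda>s. complex_of_real (h s)) has_integral of_real (H (real N) - H (- real N))) {- real N..real N}"
      by (rule has_integral_of_real)
    moreover have "H (- real N) = - H (real N)" by (simp add: H_def)
    ultimately show ?thesis by (simp add: integral_unique)
  qed
  have lim: "(\<lambda>N. H (real N)) \<longlonglongrightarrow> 0"
  proof (rule Lim_null_comparison)
    define k where "k = X * y"
    have k: "k > 0" using X y by (simp add: k_def)
    show "\<forall>\<^sub>F N in sequentially. norm (H (real N)) \<le> X / k\<^sup>2 * inverse (real N)"
      using eventually_gt_at_top[of 0]
    proof eventually_elim
      case (elim N)
      define z where "z = cosh (2 * real N)"
      have zN: "real N \<le> z"
      proof -
        have "1 + (2 * real N)\<^sup>2 / 4 \<le> z" unfolding z_def by (rule cosh_ge_quadratic)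
        moreover have "real N \<le> (real N)\<^sup>2" using elim by (simp add: power2_eq_square)
        moreover have "(2 * real N)\<^sup>2 / 4 = (real N)\<^sup>2" by (simp add: power_mult_distrib)
        ultimately show ?thesis by linarith
      qed
      have z0: "z > 0" by (simp add: z_def)
      have "1 + k * z + (k * z)\<^sup>2 / 2 \<le> exp (k * z)" using k z0 by (intro exp_lower_Taylor_quadratic) simp
      moreover have "k * z > 0" using k z0 by simp
      ultimately have "(k * z)\<^sup>2 / 2 \<le> exp (k * z)" by linarith
      hence e: "exp (- (k * z)) \<le> 2 / (k * z)\<^sup>2"
        using k z0 by (simp add: exp_minus field_simps)
      have "\<bar>sinh (2 * real N)\<bar> \<le> z"
        using cosh_plus_sinh[of "2 * real N"] sinh_le_cosh_real[of "2 * real N"] sinh_le_cosh_real[of "- (2 * real N)"]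
        by (simp add: z_def abs_le_iff)
      have "norm (H (real N)) = X / 2 * \<bar>sinh (2 * real N)\<bar> * exp (- (k * z))"
        using X by (simp add: H_def abs_mult k_def z_def mult_ac)
      also have "\<dots> \<le> X / 2 * z * (2 / (k * z)\<^sup>2)"
        using X e z0 \<open>\<bar>sinh (2 * real N)\<bar> \<le> z\<close> by (intro mult_mono) auto
      also have "\<dots> = X / k\<^sup>2 * inverse z" using z0 by (simp add: power2_eq_square field_simps)
      also have "\<dots> \<le> X / k\<^sup>2 * inverse (real N)"
        using zN elim X by (intro mult_left_mono le_imp_inverse_le) auto
      finally show ?case .
    qed
    show "(\<lambda>N. X / k\<^sup>2 * inverse (real N)) \<longlonglongrightarrow> 0"
      by (rule tendsto_mult_right_zero[OF lim_inverse_n])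
  qed
  have "(\<lambda>N. integral {- real N..real N} (\<lambda>s. complex_of_real (h s))) \<longlonglongrightarrow> (LINT s|lborel. complex_of_real (h s))"
    using int unfolding h_def by (rule integral_symmetric_tendsto_lborel)
  moreover have "(\<lambda>N. integral {- real N..real N} (\<lambda>s. complex_of_real (h s))) \<longlonglongrightarrow> of_real (2 * 0)"
    unfolding intg by (intro tendsto_intros lim)
  ultimately show ?thesis unfolding h_def using LIMSEQ_unique by fastforce
qed

text \<open>Series and Bessel integral form one integral over a product space, so a single
  differentiation lemma covers both; countability of the index type makes the counting measure
  sigma-finite for Fubini. Absolute integrability reduces to \<open>summ\<close> since the Bessel
  factors are nonnegative. The differential equation is then verified for each \<open>n\<close> by
  integration by parts in \<open>s\<close>.\<close>

theorem bessel_series_maass: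
  fixes C :: "'n::countable \<Rightarrow> complex" and Q :: "'n \<Rightarrow> real"
  assumes summ: "\<And>y. y > 0 \<Longrightarrow> (\<lambda>n. norm (C n) * K0_full (2 * pi * \<bar>Q n\<bar> * y)) summable_on UNIV"
    and nz: "\<And>n. C n \<noteq> 0 \<Longrightarrow> Q n \<noteq> 0"
    and F: "\<And>\<tau>. \<tau> \<in> upper_half_plane \<Longrightarrow> F \<tau> = of_real (sqrt (Im \<tau>)) *
       (\<Sum>\<^sub>\<infinity>n. C n * ec (Re \<tau> * Q n) * of_real (K0_full (2 * pi * \<bar>Q n\<bar> * Im \<tau>)))"
  shows "Ck_upper 2 F" and "\<And>\<tau>. \<tau> \<in> upper_half_plane \<Longrightarrow> laplace0 F \<tau> = 1/4 * F \<tau>"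
proof -
  define M where "M = count_space (UNIV :: 'n set) \<Otimes>\<^sub>M (lborel :: real measure)"
  define a where "a = (\<lambda>(n::'n, s::real). 2 * pi * Q n)"
  define c where "c = (\<lambda>(n::'n, s::real). 2 * pi * \<bar>Q n\<bar> * cosh (2 * s))"
  define w where "w = (\<lambda>(n::'n, s::real). C n)"
  interpret P: pair_sigma_finite "count_space (UNIV :: 'n set)" "lborel :: real measure"
    by (intro pair_sigma_finite.intro sigma_finite_measure_count_space_countable lborel.sigma_finite_measure_axioms) simp
  have cosh_meas: "(\<lambda>s. k * cosh (2 * s)) \<in> borel_measurable borel" for k :: real
    by (intro borel_measurable_continuous_onI continuous_intros)
  have meas: "f \<in> borel_measurable M" if "\<And>n. (\<lambda>s. f (n, s)) \<in> borel_measurable lborel" for f :: "'n \<times> real \<Rightarrow> 'b::topological_space"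
    unfolding M_def using that by (intro measurable_pair_measure_countable1) auto
  interpret osc_laplace_exponents M a c
  proof
    show "a \<in> borel_measurable M" by (rule meas) (simp add: a_def)
    show "c \<in> borel_measurable M" by (rule meas) (simp add: c_def cosh_meas)
    fix u :: "'n \<times> real"
    obtain n s where u: "u = (n, s)" by (cases u)
    have "2 * pi * \<bar>Q n\<bar> * 1 \<le> 2 * pi * \<bar>Q n\<bar> * cosh (2 * s)"
      by (intro mult_left_mono cosh_real_ge_1) auto
    thus "\<bar>a u\<bar> \<le> c u" by (simp add: a_def c_def u abs_mult)
  qed
  have integ: "integrable lborel (\<lambda>s. C n * of_real (exp (- (2 * pi * \<bar>Q n\<bar> * cosh (2 * s)) * y)))" if "y > 0" for n y
  proof (cases "C n = 0")
    case False
    hence "2 * pi * \<bar>Q n\<bar> * y > 0" using nz that by simp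
    from integrable_exp_cosh[OF this] have "integrable lborel (\<lambda>s. complex_of_real (exp (- (2 * pi * \<bar>Q n\<bar> * cosh (2 * s)) * y)))"
      by (simp add: mult_ac)
    thus ?thesis by (rule integrable_mult_right)
  qed simp
  have ad: "admissible w"
    unfolding admissible_def
  proof (intro conjI allI impI)
    show "w \<in> borel_measurable M" by (rule meas) (simp add: w_def)
    fix y :: real assume y: "y > 0"
    let ?f = "\<lambda>u. w u * of_real (exp (- c u * y))"
    show "integrable M ?f"
      unfolding M_def
    proof (rule P.Fubini_integrable)
      show "?f \<in> borel_measurable (count_space UNIV \<Otimes>\<^sub>M lborel)"
        using \<open>w \<in> borel_measurable M\<close> c_meas unfolding M_def by measurable
      have "(LINT s|lborel. norm (?f (n, s))) = norm (C n) * K0_full (2 * pi * \<bar>Q n\<bar> * y)" for n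
        by (simp add: w_def c_def norm_mult K0_full_def mult_ac)
      moreover have "integrable (count_space UNIV) (\<lambda>n. norm (C n) * K0_full (2 * pi * \<bar>Q n\<bar> * y))"
      proof -
        have "(\<lambda>n. norm (complex_of_real (norm (C n) * K0_full (2 * pi * \<bar>Q n\<bar> * y)))) summable_on UNIV"
          using summ[OF y] K0_full_nonneg by (simp add: norm_mult del: of_real_mult)
        from integral_count_space_infsum(1)[OF this] show ?thesis
          by (simp only: complex_of_real_integrable_eq)
      qed
      ultimately show "integrable (count_space UNIV) (\<lambda>n. LINT s|lborel. norm (?f (n, s)))" by simp
      show "AE n in count_space UNIV. integrable lborel (\<lambda>s. ?f (n, s))"
        using integ[OF y] by (simp add: AE_count_space w_def c_def)
    qed
  qed
  have "Im \<tau> > 0 \<Longrightarrow> osc_laplace M a c w \<tau> = (\<Sum>\<^sub>\<infinity>n. C n * ec (Re \<tau> * Q n) * of_real (K0_full (2 * pi * \<bar>Q n\<bar> * Im \<tau>)))" for \<tau>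
  proof -
    assume \<tau>: "Im \<tau> > 0"
    let ?f = "\<lambda>u. w u * exp (\<i> * of_real (a u * Re \<tau>) - of_real (c u * Im \<tau>))"
    have inner: "(LINT s|lborel. ?f (n, s)) = C n * ec (Re \<tau> * Q n) * of_real (K0_full (2 * pi * \<bar>Q n\<bar> * Im \<tau>))" for n
    proof -
      have "?f (n, s) = (C n * ec (Re \<tau> * Q n)) * of_real (exp (- (2 * pi * \<bar>Q n\<bar> * Im \<tau>) * cosh (2 * s)))" for s
      proof -
        have "exp (\<i> * of_real (a (n, s) * Re \<tau>) - of_real (c (n, s) * Im \<tau>)) =
          exp (\<i> * of_real (2 * pi * (Re \<tau> * Q n))) * exp (of_real (- (2 * pi * \<bar>Q n\<bar> * Im \<tau>) * cosh (2 * s)))"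
          unfolding exp_add[symmetric] by (simp add: a_def c_def mult_ac)
        thus ?thesis by (simp add: w_def ec_def cis_conv_exp exp_of_real[symmetric] mult.assoc)
      qed
      thus ?thesis unfolding K0_full_def by (simp only: integral_mult_right_zero integral_complex_of_real)
    qed
    have "osc_laplace M a c w \<tau> = (LINT n|count_space UNIV. LINT s|lborel. ?f (n, s))"
      unfolding osc_laplace_def using P.integral_fst'[of ?f] admissible_integrable[OF ad \<tau>] by (simp add: M_def)
    also have "\<dots> = (LINT n|count_space UNIV. C n * ec (Re \<tau> * Q n) * of_real (K0_full (2 * pi * \<bar>Q n\<bar> * Im \<tau>)))"
      unfolding inner ..
    also have "\<dots> = (\<Sum>\<^sub>\<infinity>n. C n * ec (Re \<tau> * Q n) * of_real (K0_full (2 * pi * \<bar>Q n\<bar> * Im \<tau>)))"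
      by (rule integral_count_space_infsum(2))
         (use summ[OF \<tau>] K0_full_nonneg in \<open>simp add: norm_mult ec_def\<close>)
    finally show ?thesis .
  qed
  hence F': "F \<tau> = PL (1/2) w \<tau>" if "\<tau> \<in> upper_half_plane" for \<tau>
    using F[OF that] that by (simp add: PL_def upper_half_plane_def powr_half_sqrt)
  have eq: "osc_laplace M a c (wy w) \<tau> + of_real (Im \<tau>) * (osc_laplace M a c (wx (wx w)) \<tau> + osc_laplace M a c (wy (wy w)) \<tau>) = 0"
    if \<tau>: "Im \<tau> > 0" for \<tau>
  proof -
    define y where "y = Im \<tau>"
    have y: "y > 0" using \<tau> by (simp add: y_def)
    define E where "E = (\<lambda>u. exp (\<i> * of_real (a u * Re \<tau>) - of_real (c u * Im \<tau>)))"
    have i1: "integrable M (\<lambda>u. wy w u * E u)" and i2: "integrable M (\<lambda>u. wx (wx w) u * E u)" and i3: "integrable M (\<lambda>u. wy (wy w) u * E u)"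
      unfolding E_def by (intro admissible_integrable admissible_a admissible_c ad \<tau>)+
    let ?h = "\<lambda>u. wy w u * E u + of_real y * (wx (wx w) u * E u + wy (wy w) u * E u)"
    have ih: "integrable M ?h"
      by (intro Bochner_Integration.integrable_add integrable_mult_right i1 i2 i3)
    have OL: "osc_laplace M a c v \<tau> = (LINT u|M. v u * E u)" for v
      by (simp add: osc_laplace_def E_def)
    have "osc_laplace M a c (wy w) \<tau> + of_real (Im \<tau>) * (osc_laplace M a c (wx (wx w)) \<tau> + osc_laplace M a c (wy (wy w)) \<tau>)
       = (LINT u|M. ?h u)"
      unfolding OL y_def[symmetric]
      using i1 i2 i3 by simp
    also have "\<dots> = (LINT n|count_space UNIV. LINT s|lborel. ?h (n, s))"
      using P.integral_fst'[of ?h] ih by (simp add: M_def)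
    also have "\<dots> = (LINT n|count_space (UNIV :: 'n set). 0)"
    proof (rule Bochner_Integration.integral_cong[OF refl])
      fix n
      show "(LINT s|lborel. ?h (n, s)) = 0"
      proof (cases "C n = 0")
        case True
        thus ?thesis by (simp add: w_def)
      next
        case False
        define X where "X = 2 * pi * \<bar>Q n\<bar>"
        have X: "X > 0" using nz[OF False] by (simp add: X_def)
        let ?k = "\<lambda>s. complex_of_real ((- (X * cosh (2 * s)) + y * ((X * cosh (2 * s))\<^sup>2 - X\<^sup>2)) * exp (- (X * cosh (2 * s)) * y))"
        have k: "?h (n, s) = (C n * ec (Re \<tau> * Q n)) * ?k s" for s
        proof -
          have E1: "E (n, s) = ec (Re \<tau> * Q n) * of_real (exp (- (X * cosh (2 * s)) * y))"
          proof -
            have "E (n, s) = exp (\<i> * of_real (2 * pi * (Re \<tau> * Q n))) * exp (of_real (- (X * cosh (2 * s)) * y))"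
              unfolding E_def exp_add[symmetric] by (simp add: a_def c_def mult_ac y_def X_def)
            thus ?thesis by (simp add: ec_def cis_conv_exp exp_of_real[symmetric])
          qed
          have a2: "of_real (a (n, s)) * of_real (a (n, s)) = complex_of_real (X\<^sup>2)"
          proof -
            have "(a (n, s))\<^sup>2 = X\<^sup>2" by (simp add: a_def X_def power_mult_distrib)
            thus ?thesis unfolding power2_eq_square by (simp only: of_real_mult[symmetric])
          qed
          have cc: "c (n, s) = X * cosh (2 * s)" by (simp add: c_def X_def)
          have "?h (n, s) = (- of_real (c (n, s)) + of_real y * (- (of_real (a (n, s)) * of_real (a (n, s))) + of_real (c (n, s)) * of_real (c (n, s)))) * (C n * E (n, s))"
            by (simp add: w_def algebra_simps)
          also have "\<dots> = of_real (- (X * cosh (2 * s)) + y * ((X * cosh (2 * s))\<^sup>2 - X\<^sup>2)) * (C n * E (n, s))"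
            unfolding a2 cc by (simp add: power2_eq_square)
          finally show ?thesis unfolding E1 of_real_mult by (simp only: mult_ac)
        qed
        \<comment> \<open>The counting measure has no nonempty null sets, so Fubini gives
          integrability for every single \<open>n\<close>.\<close>
        have "AE n in count_space UNIV. integrable lborel (\<lambda>s. ?h (n, s))"
          using P.AE_integrable_fst'[of ?h] ih by (simp add: M_def)
        hence "integrable lborel (\<lambda>s. ?h (n, s))" by (simp add: AE_count_space)
        define Z where "Z = C n * ec (Re \<tau> * Q n)"
        have Z: "Z \<noteq> 0" using False by (simp add: ec_def Z_def)
        from \<open>integrable lborel (\<lambda>s. ?h (n, s))\<close>
        have "integrable lborel (\<lambda>s. inverse Z * (Z * ?k s))"
          unfolding k Z_def[symmetric] by (rule integrable_mult_right)
        moreover have "inverse Z * (Z * x) = x" for x using Z by simp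
        ultimately have "integrable lborel ?k" by (simp only:)
        from bessel_integration_by_parts[OF X y this]
        show ?thesis unfolding k by (simp only: integral_mult_right_zero mult_zero_right)
      qed
    qed
    finally show ?thesis by simp
  qed
  show "Ck_upper 2 F" by (rule PL_half_maass(1)[OF ad eq F'])
  show "\<And>\<tau>. \<tau> \<in> upper_half_plane \<Longrightarrow> laplace0 F \<tau> = 1/4 * F \<tau>" by (rule PL_half_maass(2)[OF ad eq F'])
qed

subsection \<open>Principal congruence subgroups\<close>

definition principal_congruence :: "int \<Rightarrow> (int^2^2) set" where
  "principal_congruence N = {M. det M = 1 \<and> N dvd M$1$1 - 1 \<and> N dvd M$1$2 \<and> N dvd M$2$1 \<and> N dvd M$2$2 - 1}"

definition adj2 :: "int^2^2 \<Rightarrow> int^2^2" where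
  "adj2 M = vector [vector [M$2$2, - M$1$2], vector [- M$2$1, M$1$1]]"

lemma adj2_entries [simp]:
  "adj2 M $ 1 $ 1 = M$2$2" "adj2 M $ 1 $ 2 = - M$1$2" "adj2 M $ 2 $ 1 = - M$2$1" "adj2 M $ 2 $ 2 = M$1$1"
  by (simp_all add: adj2_def)

lemma mult2_entries:
  fixes M M' :: "int^2^2"
  shows "(M ** M') $ i $ j = M$i$1 * M'$1$j + M$i$2 * M'$2$j"
  by (simp add: matrix_matrix_mult_def sum_2)

lemma adj2_mult:
  assumes "det M = 1"
  shows "adj2 M ** M = mat 1" "M ** adj2 M = mat 1" "det (adj2 M) = 1"
  using assms by (simp_all add: vec_eq_iff forall_2 mult2_entries det_2 mat_def algebra_simps)

lemma inv_SL2Z: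
  assumes "M \<in> carrier SL2Z"
  shows "inv\<^bsub>SL2Z\<^esub> M = adj2 M"
proof -
  interpret group SL2Z by (rule group_SL2Z)
  show ?thesis using assms adj2_mult[of M] by (intro inv_equality) (auto simp: SL2Z_def)
qed

lemma subgroup_principal_congruence: "subgroup (principal_congruence N) SL2Z"
proof
  show "principal_congruence N \<subseteq> carrier SL2Z" by (auto simp: principal_congruence_def SL2Z_def)
  show "\<one>\<^bsub>SL2Z\<^esub> \<in> principal_congruence N" by (simp add: principal_congruence_def SL2Z_def det_2 mat_def)
next
  fix x y assume x: "x \<in> principal_congruence N" and y: "y \<in> principal_congruence N"
  have dx: "N dvd x$1$1 - 1" "N dvd x$1$2" "N dvd x$2$1" "N dvd x$2$2 - 1"
    and dy: "N dvd y$1$1 - 1" "N dvd y$1$2" "N dvd y$2$1" "N dvd y$2$2 - 1"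
    using x y by (simp_all add: principal_congruence_def)
  from dx obtain x1 x2 x3 x4 where xs: "x$1$1 - 1 = N * x1" "x$1$2 = N * x2" "x$2$1 = N * x3" "x$2$2 - 1 = N * x4"
    unfolding dvd_def by blast
  from dy obtain y1 y2 y3 y4 where ys: "y$1$1 - 1 = N * y1" "y$1$2 = N * y2" "y$2$1 = N * y3" "y$2$2 - 1 = N * y4"
    unfolding dvd_def by blast
  have e: "x$1$1 = 1 + N * x1" "x$2$2 = 1 + N * x4" "y$1$1 = 1 + N * y1" "y$2$2 = 1 + N * y4"
    using xs ys by simp_all
  have "det (x ** y) = 1" using x y by (simp add: principal_congruence_def det_mul)
  moreover have "(x ** y)$1$1 - 1 = N * (x1 + y1 + N * x1 * y1 + N * x2 * y3)" "(x ** y)$1$2 = N * (y2 + N * x1 * y2 + x2 + N * x2 * y4)"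
    "(x ** y)$2$1 = N * (x3 + N * x3 * y1 + y3 + N * x4 * y3)" "(x ** y)$2$2 - 1 = N * (x4 + y4 + N * x4 * y4 + N * x3 * y2)"
    unfolding mult2_entries e xs(2,3) ys(2,3) by algebra+
  ultimately show "x \<otimes>\<^bsub>SL2Z\<^esub> y \<in> principal_congruence N"
    unfolding principal_congruence_def SL2Z_def by (simp only: monoid.simps mem_Collect_eq dvd_triv_left simp_thms)
next
  fix x assume x: "x \<in> principal_congruence N"
  hence "inv\<^bsub>SL2Z\<^esub> x = adj2 x" by (intro inv_SL2Z) (auto simp: principal_congruence_def SL2Z_def)
  thus "inv\<^bsub>SL2Z\<^esub> x \<in> principal_congruence N"
    using x adj2_mult(3)[of x] by (auto simp: principal_congruence_def)
qed

text \<open>If two matrices have the same entries modulo \<open>N\<close>, then \<open>y\<close>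
  times the inverse of \<open>x\<close> is congruent to the identity, so a coset is determined by
  four residues.\<close>

lemma finite_rcosets_principal_congruence:
  assumes N: "N \<noteq> 0"
  shows "finite (rcosets\<^bsub>SL2Z\<^esub> (principal_congruence N))"
proof -
  interpret group SL2Z by (rule group_SL2Z)
  let ?H = "principal_congruence N"
  define \<rho> where "\<rho> = (\<lambda>M::int^2^2. ((M$1$1 mod \<bar>N\<bar>, M$1$2 mod \<bar>N\<bar>), (M$2$1 mod \<bar>N\<bar>, M$2$2 mod \<bar>N\<bar>)))"
  have coset: "?H #>\<^bsub>SL2Z\<^esub> x = ?H #>\<^bsub>SL2Z\<^esub> y" if x: "x \<in> carrier SL2Z" and y: "y \<in> carrier SL2Z" and e: "\<rho> x = \<rho> y" for x y
  proof -
    have dvd: "N dvd y$i$j - x$i$j" for i j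
    proof -
      have "x$i$j mod \<bar>N\<bar> = y$i$j mod \<bar>N\<bar>" using e exhaust_2[of i] exhaust_2[of j] by (auto simp: \<rho>_def)
      hence "\<bar>N\<bar> dvd y$i$j - x$i$j" using mod_eq_dvd_iff[of "y$i$j" "\<bar>N\<bar>" "x$i$j"] by simp
      thus ?thesis by simp
    qed
    define k where "k = (\<lambda>i j. (y$i$j - x$i$j) div N)"
    have y': "y$i$j = x$i$j + N * k i j" for i j
      using dvd_mult_div_cancel[OF dvd[of i j]] by (simp add: k_def)
    define h where "h = y ** adj2 x"
    have dx: "x$1$1 * x$2$2 - x$1$2 * x$2$1 = 1" using x by (simp add: SL2Z_def det_2)
    have dx': "det x = 1" and dy: "det y = 1" using x y by (simp_all add: SL2Z_def)
    have "h$1$1 - 1 = (x$1$1 * x$2$2 - x$1$2 * x$2$1 - 1) + N * (k 1 1 * x$2$2 - k 1 2 * x$2$1)"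
      "h$1$2 = N * (k 1 2 * x$1$1 - k 1 1 * x$1$2)"
      "h$2$1 = N * (k 2 1 * x$2$2 - k 2 2 * x$2$1)"
      "h$2$2 - 1 = (x$1$1 * x$2$2 - x$1$2 * x$2$1 - 1) + N * (k 2 2 * x$1$1 - k 2 1 * x$1$2)"
      unfolding h_def mult2_entries y' adj2_entries by algebra+
    hence "h \<in> ?H" using dx adj2_mult(3)[OF dx'] dy
      by (simp add: principal_congruence_def h_def det_mul)
    moreover have "h ** x = y"
      unfolding h_def matrix_mul_assoc[symmetric] adj2_mult(1)[OF dx'] by simp
    hence "y = h \<otimes>\<^bsub>SL2Z\<^esub> x" by (simp add: SL2Z_def)
    ultimately have "y \<in> ?H #>\<^bsub>SL2Z\<^esub> x" by (auto simp: r_coset_def)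
    thus ?thesis using x by (intro repr_independence subgroup_principal_congruence) auto
  qed
  have "finite (\<rho> ` carrier SL2Z)"
  proof (rule finite_subset)
    show "\<rho> ` carrier SL2Z \<subseteq> ({0..<\<bar>N\<bar>} \<times> {0..<\<bar>N\<bar>}) \<times> ({0..<\<bar>N\<bar>} \<times> {0..<\<bar>N\<bar>})"
      using N by (auto simp: \<rho>_def)
  qed simp
  moreover have "rcosets\<^bsub>SL2Z\<^esub> ?H \<subseteq> (\<lambda>v. ?H #>\<^bsub>SL2Z\<^esub> inv_into (carrier SL2Z) \<rho> v) ` (\<rho> ` carrier SL2Z)"
  proof
    fix X assume "X \<in> rcosets\<^bsub>SL2Z\<^esub> ?H"
    then obtain x where x: "x \<in> carrier SL2Z" "X = ?H #>\<^bsub>SL2Z\<^esub> x" by (auto simp: RCOSETS_def)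
    have "\<rho> x \<in> \<rho> ` carrier SL2Z" using x by simp
    hence "X = ?H #>\<^bsub>SL2Z\<^esub> inv_into (carrier SL2Z) \<rho> (\<rho> x)"
      using x coset[of x "inv_into (carrier SL2Z) \<rho> (\<rho> x)"] by (simp add: inv_into_into f_inv_into_f)
    thus "X \<in> (\<lambda>v. ?H #>\<^bsub>SL2Z\<^esub> inv_into (carrier SL2Z) \<rho> v) ` (\<rho> ` carrier SL2Z)" using x by blast
  qed
  ultimately show ?thesis using finite_surj by blast
qed

lemma Im_moebius:
  fixes a b c d :: int
  assumes "a * d - b * c = 1" "Im \<tau> > 0"
  shows "Im ((of_int a * \<tau> + of_int b) / (of_int c * \<tau> + of_int d)) = Im \<tau> / (norm (of_int c * \<tau> + of_int d))\<^sup>2"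
proof -
  have "real_of_int (a * d - b * c) = 1" using assms by simp
  hence det: "real_of_int a * of_int d - of_int b * of_int c = 1" by simp
  have "Im (of_int a * \<tau> + of_int b) * Re (of_int c * \<tau> + of_int d) - Re (of_int a * \<tau> + of_int b) * Im (of_int c * \<tau> + of_int d)
     = (real_of_int a * of_int d - of_int b * of_int c) * Im \<tau>"
    by (simp add: algebra_simps)
  thus ?thesis unfolding Im_divide cmod_power2 det by simp
qed

lemma moebius_denominator_nz:
  fixes c d :: int
  assumes "a * d - b * c = 1" "Im \<tau> > 0"
  shows "of_int c * \<tau> + of_int d \<noteq> 0"
proof
  assume h: "of_int c * \<tau> + of_int d = 0"
  hence "Im (of_int c * \<tau> + of_int d) = 0" "Re (of_int c * \<tau> + of_int d) = 0" by simp_all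
  hence "c = 0" "d = 0" using assms(2) by auto
  thus False using assms(1) by simp
qed

subsection \<open>The hyperbola and its automorphisms\<close>

lemma matrix2_vector: "(M *v v) $ i = M$i$1 * v$1 + M$i$2 * (v::real^2)$2"
  by (simp add: matrix_vector_mult_def sum_2)

lemma inner2: "(u::real^2) \<bullet> v = u$1 * v$1 + u$2 * v$2"
  by (simp add: inner_vec_def sum_2)

lemma matrix_inv_right: "invertible (M::real^'n^'n) \<Longrightarrow> M ** matrix_inv M = mat 1"
  and matrix_inv_left: "invertible (M::real^'n^'n) \<Longrightarrow> matrix_inv M ** M = mat 1"
  unfolding invertible_def matrix_inv_def by (metis (mono_tags, lifting) someI_ex)+

definition iota :: "int \<times> int \<Rightarrow> real^2" where
  "iota n = vector [of_int (fst n), of_int (snd n)]"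

lemma iota_nth [simp]: "iota n $ 1 = of_int (fst n)" "iota n $ 2 = of_int (snd n)"
  by (simp_all add: iota_def)

lemma bij_iota: "bij_betw iota UNIV lattice_Z2"
proof (rule bij_betw_imageI)
  show "inj iota"
  proof (rule injI)
    fix x y assume "iota x = iota y"
    hence "iota x $ 1 = iota y $ 1" "iota x $ 2 = iota y $ 2" by simp_all
    thus "x = y" by (simp add: prod_eq_iff)
  qed
  show "range iota = lattice_Z2"
  proof (intro equalityI subsetI)
    fix v assume "v \<in> range iota"
    thus "v \<in> lattice_Z2" by (auto simp: lattice_Z2_def forall_2)
  next
    fix v assume "v \<in> lattice_Z2"
    then obtain x y where "v$1 = of_int x" "v$2 = of_int y"
      unfolding lattice_Z2_def by (auto elim!: Ints_cases simp: forall_2)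
    hence "v = iota (x, y)" by (simp add: vec_eq_iff forall_2)
    thus "v \<in> range iota" by blast
  qed
qed

lemma iota_lattice: "iota n \<in> lattice_Z2"
  using bij_iota by (auto simp: bij_betw_def)

text \<open>After taking out \<open>b * exp (- t)\<close>, which has the sign of \<open>b\<close>,
  either the difference or the sum of \<open>exp (2 * t)\<close> and
  \<open>exp (2 * hyp_param a b)\<close> remains. Only the difference changes sign, and the sign of
  \<open>a * b\<close> decides which of the two occurs.\<close>

lemma sgn_quadratic_factor:
  fixes a b :: real
  assumes "a * b \<noteq> 0"
  shows "a * b > 0 \<Longrightarrow> sgn (b * exp t - a * exp (- t)) = sgn b * sgn (t - hyp_param a b)"
    and "a * b < 0 \<Longrightarrow> sgn (b * exp t - a * exp (- t)) = sgn b"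
    and "a * b < 0 \<Longrightarrow> sgn (a * exp (- t) + b * exp t) = sgn b * sgn (t - hyp_param a b)"
    and "a * b > 0 \<Longrightarrow> sgn (a * exp (- t) + b * exp t) = sgn b"
proof -
  define h where "h = hyp_param a b"
  have ab: "\<bar>a\<bar> > 0" "\<bar>b\<bar> > 0" using assms by auto
  have e: "exp (2 * h) = \<bar>a\<bar> / \<bar>b\<bar>" using ab by (simp add: h_def hyp_param_def)
  have ex: "exp t = exp (- t) * exp (2 * t)" by (simp add: exp_add[symmetric])
  have s: "sgn (exp (2 * t) - exp (2 * h)) = sgn (t - h)" by (auto simp: sgn_real_def)
  have "exp (2 * t) + exp (2 * h) > 0" by (intro add_pos_pos) auto
  hence s': "sgn (exp (2 * t) + exp (2 * h)) = 1" by (simp only: sgn_pos)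
  have a: "a = sgn (a * b) * (b * exp (2 * h))"
    using ab unfolding e by (auto simp: sgn_real_def zero_less_mult_iff abs_if split: if_splits)
  show "a * b > 0 \<Longrightarrow> sgn (b * exp t - a * exp (- t)) = sgn b * sgn (t - hyp_param a b)"
  proof -
    assume "a * b > 0"
    hence "a = b * exp (2 * h)" using a by simp
    hence "b * exp t - a * exp (- t) = b * (exp (- t) * (exp (2 * t) - exp (2 * h)))" by (subst ex) (simp add: algebra_simps)
    thus ?thesis by (simp add: sgn_mult s h_def[symmetric])
  qed
  show "a * b > 0 \<Longrightarrow> sgn (a * exp (- t) + b * exp t) = sgn b"
  proof -
    assume "a * b > 0"
    hence "a = b * exp (2 * h)" using a by simp
    hence "a * exp (- t) + b * exp t = b * (exp (- t) * (exp (2 * t) + exp (2 * h)))" by (subst ex) (simp add: algebra_simps)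
    thus ?thesis by (simp add: sgn_mult s')
  qed
  show "a * b < 0 \<Longrightarrow> sgn (b * exp t - a * exp (- t)) = sgn b"
  proof -
    assume "a * b < 0"
    hence "a = - (b * exp (2 * h))" using a by simp
    hence "b * exp t - a * exp (- t) = b * (exp (- t) * (exp (2 * t) + exp (2 * h)))" by (subst ex) (simp add: algebra_simps)
    thus ?thesis by (simp add: sgn_mult s')
  qed
  show "a * b < 0 \<Longrightarrow> sgn (a * exp (- t) + b * exp t) = sgn b * sgn (t - hyp_param a b)"
  proof -
    assume "a * b < 0"
    hence "a = - (b * exp (2 * h))" using a by simp
    hence "a * exp (- t) + b * exp t = b * (exp (- t) * (exp (2 * t) - exp (2 * h)))" by (subst ex) (simp add: algebra_simps)
    thus ?thesis by (simp add: sgn_mult s h_def[symmetric])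
  qed
qed

text \<open>The convention \<open>sgn 0 = 0\<close> makes this exact at the end points too: a
  lattice vector whose parameter is \<open>t1\<close> or \<open>t2\<close> counts with weight one
  half, and for \<open>t1 = t2\<close> both sides are 0.\<close>

lemma sgn_jump:
  fixes t1 t2 h :: real
  shows "sgn (t2 - t1) * (1/2 * (1 - sgn (t1 - h) * sgn (t2 - h))) = (sgn (t2 - h) - sgn (t1 - h)) / 2"
  by (auto simp: sgn_real_def)

section \<open>From the matrices A and P to the integral form and its linear factors\<close>

locale hyp_lattice =
  fixes A P :: "real^2^2" and C :: "(real^2) set" and p q r :: int
  assumes P_inv: "invertible P" and P_A: "A = transpose P ** hyp_J ** P"
    and C_comp: "C \<in> components {u. quad A u = -1}" and P_C: "matrix_inv P *v vector [1, -1] \<in> C"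
    and A_entries: "A$1$1 = of_int p" "A$1$2 = of_int q" "A$2$2 = of_int r"
begin

lemma A_from_P: "A$1$1 = 2 * P$1$1 * P$2$1" "A$1$2 = P$1$1 * P$2$2 + P$1$2 * P$2$1"
  "A$2$1 = P$1$1 * P$2$2 + P$1$2 * P$2$1" "A$2$2 = 2 * P$1$2 * P$2$2"
  unfolding P_A by (simp_all add: matrix_matrix_mult_def sum_2 transpose_def hyp_J_def)

sublocale hyp_binary_form p q r "P$1$1" "P$1$2" "P$2$1" "P$2$2"
proof
  show "2 * P$1$1 * P$2$1 = of_int p" "P$1$1 * P$2$2 + P$1$2 * P$2$1 = of_int q" "2 * P$1$2 * P$2$2 = of_int r"
    using A_from_P A_entries by simp_all
  have "det P \<noteq> 0" using P_inv by (simp add: invertible_det_nz)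
  thus "P$1$1 * P$2$2 - P$1$2 * P$2$1 \<noteq> 0" by (simp add: det_2)
qed

abbreviation a' :: "real^2 \<Rightarrow> real" where "a' v \<equiv> (P *v v) $ 1"
abbreviation b' :: "real^2 \<Rightarrow> real" where "b' v \<equiv> (P *v v) $ 2"

lemma quad_eq: "quad A v = a' v * b' v"
  unfolding quad_def inner2 matrix2_vector A_from_P by (simp add: algebra_simps)

lemma bil_eq: "bil A u v = a' u * b' v + b' u * a' v"
  unfolding bil_def inner2 matrix2_vector A_from_P by (simp add: algebra_simps)

lemma av_iota: "a' (iota n) = av n" "b' (iota n) = bv n"
  by (simp_all add: matrix2_vector av_def bv_def al_def be_def)

lemma quad_iota: "quad A (iota n) = av n * bv n"
  by (simp add: quad_eq av_iota)

lemma P_matrix_inv: "P *v (matrix_inv P *v v) = v" "matrix_inv P *v (P *v v) = v"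
  using P_inv by (simp_all add: matrix_vector_mul_assoc matrix_inv_right matrix_inv_left)

lemma P_inj: "P *v u = P *v v \<Longrightarrow> u = v"
  by (metis P_matrix_inv(2))

lemma c_curve_coords: "a' (c_curve P t) = exp t" "b' (c_curve P t) = - exp (- t)"
  "a' (c_perp_curve P t) = exp t" "b' (c_perp_curve P t) = exp (- t)"
  by (simp_all add: c_curve_def c_perp_curve_def P_matrix_inv(1))

lemma t_param_c_curve: "t_param P (c_curve P t) = t"
proof -
  show ?thesis unfolding t_param_def
  proof (rule the_equality)
    fix s assume s: "c_curve P s = c_curve P t"
    have "exp s = a' (c_curve P s)" by (rule c_curve_coords(1)[symmetric])
    also have "\<dots> = exp t" unfolding s by (rule c_curve_coords(1))
    finally show "s = t" by simp
  qed (rule refl)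
qed

lemma perp_c_curve: "perp P (c_curve P t) = c_perp_curve P t"
  by (simp add: perp_def t_param_c_curve)

lemma bil_c_curve: "bil A v (c_curve P t) = b' v * exp t - a' v * exp (- t)"
  "bil A v (c_perp_curve P t) = a' v * exp (- t) + b' v * exp t"
  by (simp_all add: bil_eq c_curve_coords)

text \<open>On \<open>Q = -1\<close> the first coordinate does not vanish, so on a connected set
  through the base point it stays positive and its logarithm is the parameter. Conversely the curve
  is connected and meets \<open>C\<close>, hence lies in that component.\<close>

lemma C_eq: "C = range (c_curve P)"
proof
  let ?S = "{u. quad A u = -1}"
  have sub: "C \<subseteq> ?S" and con: "connected C" using C_comp in_components_subset in_components_connected by auto
  have c0: "matrix_inv P *v vector [1, -1] = c_curve P 0" by (simp add: c_curve_def)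
  show "C \<subseteq> range (c_curve P)"
  proof
    fix v assume v: "v \<in> C"
    have cont: "continuous_on C a'" unfolding matrix2_vector by (intro continuous_intros)
    have nz: "a' u \<noteq> 0" if "u \<in> C" for u using sub that by (auto simp: quad_eq)
    have pos: "a' v > 0"
    proof (rule ccontr)
      assume "\<not> a' v > 0"
      hence "a' v \<le> 0" by simp
      moreover have "0 \<le> a' (c_curve P 0)" by (simp add: c_curve_coords)
      moreover have "c_curve P 0 \<in> C" using P_C c0 by simp
      moreover have "connected (a' ` C)" using cont con by (rule connected_continuous_image)
      ultimately have "0 \<in> a' ` C"
        using v by (meson connectedD_interval imageI)
      thus False using nz by auto
    qed
    have "a' v * b' v = -1" using sub v by (auto simp: quad_eq)
    hence "b' v = - inverse (a' v)" using pos by (simp add: field_simps)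
    hence "P *v v = P *v c_curve P (ln (a' v))"
      using pos by (simp add: vec_eq_iff forall_2 c_curve_coords exp_minus)
    hence "v = c_curve P (ln (a' v))" by (rule P_inj)
    thus "v \<in> range (c_curve P)" by blast
  qed
  show "range (c_curve P) \<subseteq> C"
  proof (rule components_maximal[OF C_comp])
    have "c_curve P = (\<lambda>t. exp t *\<^sub>R (matrix_inv P *v vector [1, 0]) - exp (- t) *\<^sub>R (matrix_inv P *v vector [0, 1]))"
      by (simp add: c_curve_def fun_eq_iff vec_eq_iff forall_2 matrix2_vector)
    moreover have "continuous_on UNIV (\<lambda>t::real. exp t *\<^sub>R (matrix_inv P *v vector [1, 0]) - exp (- t) *\<^sub>R (matrix_inv P *v vector [0, 1]))"
      by (intro continuous_intros)
    ultimately have "continuous_on UNIV (c_curve P)" by simp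
    thus "connected (range (c_curve P))" by (intro connected_continuous_image) auto
    show "range (c_curve P) \<subseteq> ?S" by (auto simp: quad_eq c_curve_coords exp_minus)
    show "C \<inter> range (c_curve P) \<noteq> {}" using P_C c0 by auto
  qed
qed

text \<open>In the coordinates of \<open>P\<close> the form is a product, so an isometry is diagonal
  or antidiagonal. Determinant 1 excludes the antidiagonal case, and the invariance of
  \<open>C\<close> makes the diagonal entries positive.\<close>

lemma Aut_plus_hyperbolic:
  assumes "\<gamma> \<in> Aut_plus A C"
  obtains s where "\<And>v. a' (\<gamma> *v v) = exp s * a' v" "\<And>v. b' (\<gamma> *v v) = exp (- s) * b' v"
proof -
  have Q: "\<And>v. quad A (\<gamma> *v v) = quad A v" and im: "(\<lambda>v. \<gamma> *v v) ` C = C" and det: "det \<gamma> = 1"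
    using assms by (auto simp: Aut_plus_def)
  define N where "N = P ** \<gamma> ** matrix_inv P"
  have N: "P *v (\<gamma> *v v) = N *v (P *v v)" for v
    unfolding N_def by (simp add: matrix_vector_mul_assoc[symmetric] P_matrix_inv)
  have "det N = det \<gamma> * (det P * det (matrix_inv P))" by (simp add: N_def det_mul)
  also have "det P * det (matrix_inv P) = det (P ** matrix_inv P)" by (simp add: det_mul)
  also have "P ** matrix_inv P = mat 1" using P_inv by (rule matrix_inv_right)
  finally have "det N = 1" using det by simp
  hence dN: "N$1$1 * N$2$2 - N$1$2 * N$2$1 = 1" by (simp add: det_2)
  have form: "(N$1$1 * x + N$1$2 * y) * (N$2$1 * x + N$2$2 * y) = x * y" for x y
  proof -
    let ?v = "matrix_inv P *v vector [x, y]"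
    have "quad A (\<gamma> *v ?v) = quad A ?v" by (rule Q)
    thus ?thesis unfolding quad_eq N P_matrix_inv(1) by (simp add: matrix2_vector)
  qed
  have 1: "N$1$1 * N$2$1 = 0" using form[of 1 0] by simp
  have 2: "N$1$2 * N$2$2 = 0" using form[of 0 1] by simp
  \<comment> \<open>Together with \<open>dN\<close> this gives the two products separately: the
    diagonal one is 1 and the antidiagonal one is 0.\<close>
  have 3: "N$1$1 * N$2$2 + N$1$2 * N$2$1 = 1" using form[of 1 1] 1 2 by (simp add: algebra_simps)
  have 4: "N$1$1 * N$2$2 = 1" using 3 dN by linarith
  hence nz: "N$1$1 \<noteq> 0" "N$2$2 \<noteq> 0" by auto
  have 5: "N$2$1 = 0" "N$1$2 = 0" using 1 2 nz by auto
  have "\<gamma> *v c_curve P 0 \<in> C" using im C_eq by blast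
  then obtain t where "\<gamma> *v c_curve P 0 = c_curve P t" using C_eq by blast
  hence "(N *v (P *v c_curve P 0)) $ 1 = exp t" using c_curve_coords(1)[of t] by (simp add: N[symmetric])
  hence "N$1$1 = exp t" by (simp add: matrix2_vector[of N] c_curve_coords 5)
  moreover hence "N$2$2 = exp (- t)" using 4 by (simp add: exp_minus field_simps)
  ultimately have "a' (\<gamma> *v v) = exp t * a' v" "b' (\<gamma> *v v) = exp (- t) * b' v" for v
    unfolding N by (simp_all add: matrix2_vector[of N] 5)
  thus ?thesis using that by blast
qed

lemma hyperbolic_c_curve:
  assumes "\<And>v. a' (\<gamma> *v v) = exp s * a' v" "\<And>v. b' (\<gamma> *v v) = exp (- s) * b' v"
  shows "\<gamma> *v c_curve P t = c_curve P (t + s)"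
proof (rule P_inj)
  show "P *v (\<gamma> *v c_curve P t) = P *v c_curve P (t + s)"
    unfolding vec_eq_iff forall_2 assms c_curve_coords by (simp add: exp_add[symmetric] add.commute)
qed

definition lattice_map :: "real^2^2 \<Rightarrow> int \<times> int \<Rightarrow> int \<times> int" where
  "lattice_map \<gamma> n = inv_into UNIV iota (\<gamma> *v iota n)"

lemma iota_lattice_map:
  assumes "\<gamma> \<in> Aut_plus A C"
  shows "iota (lattice_map \<gamma> n) = \<gamma> *v iota n"
proof -
  have "(\<lambda>v. \<gamma> *v v) ` lattice_Z2 = lattice_Z2" using assms by (auto simp: Aut_plus_def)
  hence "\<gamma> *v iota n \<in> lattice_Z2" using iota_lattice by blast
  hence "\<gamma> *v iota n \<in> range iota" using bij_iota by (simp add: bij_betw_def)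
  thus ?thesis unfolding lattice_map_def by (rule f_inv_into_f)
qed

lemma bij_lattice_map:
  assumes \<gamma>: "\<gamma> \<in> Aut_plus A C"
  shows "bij (lattice_map \<gamma>)"
proof -
  have "inj ((*v) \<gamma>)" using \<gamma> by (auto simp: Aut_plus_def inj_matrix_vector_mult)
  moreover have "(\<lambda>v. \<gamma> *v v) ` lattice_Z2 = lattice_Z2" using \<gamma> by (auto simp: Aut_plus_def)
  ultimately have g: "bij_betw ((*v) \<gamma>) lattice_Z2 lattice_Z2" by (auto simp: bij_betw_def inj_on_def)
  have "bij_betw (inv_into UNIV iota \<circ> ((*v) \<gamma> \<circ> iota)) UNIV UNIV"
    by (intro bij_betw_trans[OF bij_betw_trans[OF bij_iota g]] bij_betw_inv_into bij_iota)
  thus ?thesis by (simp add: lattice_map_def[abs_def] o_def)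
qed

lemma hyp_shift_lattice_map:
  assumes \<gamma>: "\<gamma> \<in> Aut_plus A C"
    and "\<And>v. a' (\<gamma> *v v) = exp s * a' v" "\<And>v. b' (\<gamma> *v v) = exp (- s) * b' v"
  shows "hyp_shift (lattice_map \<gamma>) s"
  unfolding hyp_shift_def using bij_lattice_map[OF \<gamma>] assms(2,3)
  by (auto simp: av_iota[symmetric] iota_lattice_map[OF \<gamma>])

text \<open>\<open>m\<close> is split by the sign of \<open>Q\<close>. Where \<open>Q < 0\<close>
  the first sign factor is 0, since \<open>B(\<nu>, c(t))\<close> keeps its sign along the curve;
  where \<open>Q > 0\<close> the same happens to the second. In the terms that remain the Bessel
  argument is positive, so \<open>bessel_K0\<close> may be replaced by
  \<open>K0_full\<close>.\<close>

lemma Phi_eq_psi: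
  assumes m: "good (m \<circ> iota)" and \<tau>: "Im \<tau> > 0"
  shows "Phi A P m (c_curve P t1) (c_curve P t2) \<tau> = of_real (sqrt (Im \<tau>)) * psi (m \<circ> iota) \<tau> t1 t2"
proof -
  define \<sigma> where "\<sigma> = sgn (t2 - t1)"
  define mp where "mp = (\<lambda>n. if av n * bv n > 0 then m (iota n) else 0)"
  define mn where "mn = (\<lambda>n. if av n * bv n < 0 then m (iota n) else 0)"
  have nz: "av n * bv n \<noteq> 0" if "m (iota n) \<noteq> 0" for n
    using good_nz[OF m, of n] that by simp
  obtain B where B: "\<And>n. norm (m (iota n)) \<le> B" using m unfolding good_def by auto
  have B0: "B \<ge> 0" using B[of undefined] norm_ge_zero order_trans by blast
  have gp: "good mp" and gn: "good mn"
    unfolding good_def mp_def mn_def using B B0 nz by (auto intro!: exI[of _ B])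
  define T1 where "T1 = (\<lambda>v. of_real ((1/2) * (1 - sgn (bil A v (c_curve P t1) * bil A v (c_curve P t2)))) * m v *
          exp (2 * of_real pi * \<i> * of_real (quad A v) * of_real (Re \<tau>)) *
          of_real (bessel_K0 (2 * pi * quad A v * Im \<tau>)))"
  define T2 where "T2 = (\<lambda>v. of_real ((1/2) * (1 - sgn (bil A v (perp P (c_curve P t1)) * bil A v (perp P (c_curve P t2))))) * m v *
          exp (2 * of_real pi * \<i> * of_real (quad A v) * of_real (Re \<tau>)) *
          of_real (bessel_K0 (- 2 * pi * quad A v * Im \<tau>)))"
  have ecq: "exp (2 * of_real pi * \<i> * of_real (av n * bv n) * of_real (Re \<tau>)) = ec (Re \<tau> * (av n * bv n))" for n
    unfolding ec_def cis_conv_exp by (rule arg_cong[where f = exp]) (simp add: mult_ac)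
  have b2: "sgn b * (sgn b * x) = x" if "b \<noteq> 0" for b x :: real using that by (simp add: sgn_real_def)
  have t1: "of_real \<sigma> * T1 (iota n) = psi_term mp \<tau> t1 t2 n" for n
  proof (cases "m (iota n) = 0")
    case True
    thus ?thesis by (simp add: T1_def psi_term_def mp_def)
  next
    case False
    note ab = nz[OF False]
    have bnz: "bv n \<noteq> 0" using ab by auto
    show ?thesis
    proof (cases "av n * bv n > 0")
      case True
      have "sgn (bil A (iota n) (c_curve P t1) * bil A (iota n) (c_curve P t2)) = sgn (t1 - hyp_param (av n) (bv n)) * sgn (t2 - hyp_param (av n) (bv n))"
        unfolding bil_c_curve av_iota sgn_mult sgn_quadratic_factor(1)[OF ab True] using b2[OF bnz] by (simp add: mult_ac)
      hence w: "\<sigma> * ((1/2) * (1 - sgn (bil A (iota n) (c_curve P t1) * bil A (iota n) (c_curve P t2)))) = sgn_weight t1 t2 n"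
        unfolding \<sigma>_def sgn_weight_def by (simp only: sgn_jump)
      have "2 * pi * (av n * bv n) * Im \<tau> > 0" using True \<tau> by simp
      hence K: "bessel_K0 (2 * pi * (av n * bv n) * Im \<tau>) = K0_full (2 * pi * \<bar>av n * bv n\<bar> * Im \<tau>)"
        using True by (simp add: bessel_K0_eq_full)
      have "of_real \<sigma> * T1 (iota n) = of_real (\<sigma> * ((1/2) * (1 - sgn (bil A (iota n) (c_curve P t1) * bil A (iota n) (c_curve P t2))))) * m (iota n) *
          ec (Re \<tau> * (av n * bv n)) * of_real (K0_full (2 * pi * \<bar>av n * bv n\<bar> * Im \<tau>))"
        unfolding T1_def quad_iota ecq K by (simp only: of_real_mult mult.assoc)
      thus ?thesis unfolding w psi_term_def mp_def using True by (simp add: mult_ac)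
    next
      case neg: False
      hence neg: "av n * bv n < 0" using ab by linarith
      have "sgn (bil A (iota n) (c_curve P t1) * bil A (iota n) (c_curve P t2)) = 1"
        unfolding bil_c_curve av_iota sgn_mult sgn_quadratic_factor(2)[OF ab neg] using b2[OF bnz, of 1] by simp
      thus ?thesis using neg by (simp add: T1_def psi_term_def mp_def)
    qed
  qed
  have t2: "of_real \<sigma> * T2 (iota n) = psi_term mn \<tau> t1 t2 n" for n
  proof (cases "m (iota n) = 0")
    case True
    thus ?thesis by (simp add: T2_def psi_term_def mn_def)
  next
    case False
    note ab = nz[OF False]
    have bnz: "bv n \<noteq> 0" using ab by auto
    show ?thesis
    proof (cases "av n * bv n < 0")
      case True
      have "sgn (bil A (iota n) (perp P (c_curve P t1)) * bil A (iota n) (perp P (c_curve P t2))) = sgn (t1 - hyp_param (av n) (bv n)) * sgn (t2 - hyp_param (av n) (bv n))"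
        unfolding perp_c_curve bil_c_curve av_iota sgn_mult sgn_quadratic_factor(3)[OF ab True] using b2[OF bnz] by (simp add: mult_ac)
      hence w: "\<sigma> * ((1/2) * (1 - sgn (bil A (iota n) (perp P (c_curve P t1)) * bil A (iota n) (perp P (c_curve P t2))))) = sgn_weight t1 t2 n"
        unfolding \<sigma>_def sgn_weight_def by (simp only: sgn_jump)
      have e: "- 2 * pi * (av n * bv n) * Im \<tau> = 2 * pi * \<bar>av n * bv n\<bar> * Im \<tau>" using True by simp
      have "2 * pi * \<bar>av n * bv n\<bar> * Im \<tau> > 0" using ab \<tau> by (intro mult_pos_pos) auto
      hence K: "bessel_K0 (- 2 * pi * (av n * bv n) * Im \<tau>) = K0_full (2 * pi * \<bar>av n * bv n\<bar> * Im \<tau>)"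
        unfolding e by (rule bessel_K0_eq_full)
      have "of_real \<sigma> * T2 (iota n) = of_real (\<sigma> * ((1/2) * (1 - sgn (bil A (iota n) (perp P (c_curve P t1)) * bil A (iota n) (perp P (c_curve P t2)))))) * m (iota n) *
          ec (Re \<tau> * (av n * bv n)) * of_real (K0_full (2 * pi * \<bar>av n * bv n\<bar> * Im \<tau>))"
        unfolding T2_def quad_iota ecq K by (simp only: of_real_mult mult.assoc)
      thus ?thesis unfolding w psi_term_def mn_def using True by (simp add: mult_ac)
    next
      case pos: False
      hence pos: "av n * bv n > 0" using ab by linarith
      have "sgn (bil A (iota n) (perp P (c_curve P t1)) * bil A (iota n) (perp P (c_curve P t2))) = 1"
        unfolding perp_c_curve bil_c_curve av_iota sgn_mult sgn_quadratic_factor(4)[OF ab pos] using b2[OF bnz, of 1] by simp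
      thus ?thesis using pos by (simp add: T2_def psi_term_def mn_def)
    qed
  qed
  have s1: "of_real \<sigma> * (\<Sum>\<^sub>\<infinity>v\<in>lattice_Z2. T1 v) = psi mp \<tau> t1 t2"
    unfolding infsum_reindex_bij_betw[OF bij_iota, of T1, symmetric] infsum_cmult_right'[symmetric] t1 psi_def by simp
  have s2: "of_real \<sigma> * (\<Sum>\<^sub>\<infinity>v\<in>lattice_Z2. T2 v) = psi mn \<tau> t1 t2"
    unfolding infsum_reindex_bij_betw[OF bij_iota, of T2, symmetric] infsum_cmult_right'[symmetric] t2 psi_def by simp
  have "psi mp \<tau> t1 t2 + psi mn \<tau> t1 t2 = (\<Sum>\<^sub>\<infinity>n. psi_term mp \<tau> t1 t2 n + psi_term mn \<tau> t1 t2 n)"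
    unfolding psi_def by (rule infsum_add[symmetric]) (intro psi_summable gp gn \<tau>)+
  also have "\<dots> = psi (m \<circ> iota) \<tau> t1 t2"
    unfolding psi_def
  proof (rule infsum_cong)
    fix n
    have "mp n + mn n = m (iota n)" using nz[of n] by (auto simp: mp_def mn_def)
    thus "psi_term mp \<tau> t1 t2 n + psi_term mn \<tau> t1 t2 n = psi_term (m \<circ> iota) \<tau> t1 t2 n"
      unfolding psi_term_def by (simp add: distrib_right[symmetric])
  qed
  finally have sum: "psi mp \<tau> t1 t2 + psi mn \<tau> t1 t2 = psi (m \<circ> iota) \<tau> t1 t2" .
  have "Phi A P m (c_curve P t1) (c_curve P t2) \<tau> = of_real (\<sigma> * sqrt (Im \<tau>)) * (\<Sum>\<^sub>\<infinity>v\<in>lattice_Z2. T1 v)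
     + of_real (\<sigma> * sqrt (Im \<tau>)) * (\<Sum>\<^sub>\<infinity>v\<in>lattice_Z2. T2 v)"
    unfolding Phi_def t_param_c_curve T1_def T2_def \<sigma>_def ..
  also have "\<dots> = of_real (sqrt (Im \<tau>)) * (of_real \<sigma> * (\<Sum>\<^sub>\<infinity>v\<in>lattice_Z2. T1 v) + of_real \<sigma> * (\<Sum>\<^sub>\<infinity>v\<in>lattice_Z2. T2 v))"
    by (simp add: algebra_simps)
  finally show ?thesis unfolding s1 s2 sum .
qed

end

section \<open>A common period and the proof of the modularity theorem\<close>

lemma common_period:
  assumes J: "finite J" and per: "\<forall>j\<in>J. periodic_Z2 (m j)"
  obtains L where "L > 0" "\<And>j. j \<in> J \<Longrightarrow> per2 L (\<lambda>x y. m j (iota (x, y)))"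
proof -
  from per obtain l :: "'a \<Rightarrow> int" where l: "\<And>j. j \<in> J \<Longrightarrow> l j \<noteq> 0"
    "\<And>j v u. j \<in> J \<Longrightarrow> v \<in> lattice_Z2 \<Longrightarrow> u \<in> lattice_Z2 \<Longrightarrow> m j (v + of_int (l j) *\<^sub>R u) = m j v"
    unfolding periodic_Z2_def by metis
  define L where "L = (\<Prod>j\<in>J. \<bar>l j\<bar>)"
  have "L > 0" unfolding L_def using l(1) by (intro prod_pos) auto
  moreover have "per2 L (\<lambda>x y. m j (iota (x, y)))" if j: "j \<in> J" for j
    unfolding per2_def
  proof (intro allI)
    fix x y i k
    have "\<bar>l j\<bar> dvd L" unfolding L_def using J j by (rule dvd_prodI)
    hence "l j dvd L" by simp
    then obtain e where e: "L = l j * e" by blast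
    have "iota (x + L * i, y + L * k) = iota (x, y) + of_int (l j) *\<^sub>R iota (e * i, e * k)"
      by (simp add: vec_eq_iff forall_2 e)
    thus "m j (iota (x + L * i, y + L * k)) = m j (iota (x, y))"
      using l(2)[OF j iota_lattice iota_lattice] by simp
  qed
  ultimately show ?thesis using that by blast
qed

theorem theorem4:
  fixes A P :: "real^2^2" and C :: "(real^2) set" and c :: "real^2"
    and J :: "'j set" and m :: "'j \<Rightarrow> real^2 \<Rightarrow> complex" and \<gamma> :: "'j \<Rightarrow> real^2^2"
  assumes A_int: "\<forall>i j. A $ i $ j \<in> \<int>"
    and A_sym: "transpose A = A"
    and A_sig: "has_signature A 1 1"
    and C_comp: "C \<in> components {u. quad A u = -1}"
    and P_inv: "invertible P"
    and P_A: "A = transpose P ** hyp_J ** P"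
    and P_C: "matrix_inv P *v vector [1, -1] \<in> C"
    and c_C: "c \<in> C"
    and J_fin: "finite J"
    and m_per: "\<forall>j\<in>J. periodic_Z2 (m j)"
    and m_supp: "\<forall>j\<in>J. \<forall>\<nu>\<in>lattice_Z2. m j \<nu> \<noteq> 0 \<longrightarrow> quad A \<nu> \<noteq> 0"
    and \<gamma>_Aut: "\<forall>j\<in>J. \<gamma> j \<in> Aut_plus A C"
    and m_sum: "\<forall>\<nu>\<in>lattice_Z2. (\<Sum>j\<in>J. m j \<nu> - m j (\<gamma> j *v \<nu>)) = 0"
  shows "(\<exists>\<Gamma> v. subgroup \<Gamma> SL2Z \<and> finite (rcosets\<^bsub>SL2Z\<^esub> \<Gamma>) \<and>
            maass_form_wt0 \<Gamma> v (1/4) (\<lambda>\<tau>. \<Sum>j\<in>J. Phi A P (m j) c (\<gamma> j *v c) \<tau>)) \<and>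
         (\<forall>c'\<in>C. \<forall>\<tau>\<in>upper_half_plane.
            (\<Sum>j\<in>J. Phi A P (m j) c (\<gamma> j *v c) \<tau>) = (\<Sum>j\<in>J. Phi A P (m j) c' (\<gamma> j *v c') \<tau>))"
proof -
  obtain p q r where pqr: "A$1$1 = of_int p" "A$1$2 = of_int q" "A$2$2 = of_int r"
    using A_int by (metis Ints_cases)
  interpret hyp_lattice A P C p q r
    using P_inv P_A C_comp P_C pqr by unfold_locales
  obtain L where L: "L > 0" and per: "\<And>j. j \<in> J \<Longrightarrow> per2 L (\<lambda>x y. m j (iota (x, y)))"
    using common_period[OF J_fin m_per] by blast
  define M where "M = (\<lambda>j. m j \<circ> iota)"
  have perM: "per2 L (\<lambda>x y. M j (x, y))" if "j \<in> J" for j using per[OF that] by (simp add: M_def)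
  have good: "good (M j)" if j: "j \<in> J" for j
  proof -
    obtain B where B: "\<And>x y. norm (m j (iota (x, y))) \<le> B" using per2_bounded[OF L per[OF j]] by blast
    have "av n * bv n \<noteq> 0" if "M j n \<noteq> 0" for n
      using m_supp j iota_lattice[of n] that unfolding M_def quad_iota[symmetric] by auto
    thus ?thesis unfolding good_def using B by (auto simp: M_def)
  qed
  have "\<forall>j\<in>J. \<exists>s. (\<forall>v. a' (\<gamma> j *v v) = exp s * a' v) \<and> (\<forall>v. b' (\<gamma> j *v v) = exp (- s) * b' v)"
    using \<gamma>_Aut Aut_plus_hyperbolic by metis
  then obtain s where s: "\<And>j v. j \<in> J \<Longrightarrow> a' (\<gamma> j *v v) = exp (s j) * a' v" "\<And>j v. j \<in> J \<Longrightarrow> b' (\<gamma> j *v v) = exp (- s j) * b' v"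
    by metis
  define g where "g = (\<lambda>j. lattice_map (\<gamma> j))"
  have g: "hyp_shift (g j) (s j)" if j: "j \<in> J" for j
    unfolding g_def using \<gamma>_Aut s j by (intro hyp_shift_lattice_map) auto
  have zero: "(\<Sum>j\<in>J. M j n - M j (g j n)) = 0" for n
  proof -
    have "(\<Sum>j\<in>J. M j n - M j (g j n)) = (\<Sum>j\<in>J. m j (iota n) - m j (\<gamma> j *v iota n))"
      using \<gamma>_Aut by (intro sum.cong) (auto simp: M_def g_def iota_lattice_map)
    thus ?thesis using m_sum iota_lattice by simp
  qed
  have F: "(\<Sum>j\<in>J. Phi A P (m j) (c_curve P t) (\<gamma> j *v c_curve P t) \<tau>) = of_real (sqrt (Im \<tau>)) * (\<Sum>j\<in>J. psi (M j) \<tau> t (t + s j))"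
    if "\<tau> \<in> upper_half_plane" for \<tau> t
  proof -
    have \<tau>: "Im \<tau> > 0" using that by (simp add: upper_half_plane_def)
    have "Phi A P (m j) (c_curve P t) (\<gamma> j *v c_curve P t) \<tau> = of_real (sqrt (Im \<tau>)) * psi (M j) \<tau> t (t + s j)" if j: "j \<in> J" for j
      unfolding hyperbolic_c_curve[OF s(1)[OF j] s(2)[OF j]] M_def
      using good[OF j] unfolding M_def by (rule Phi_eq_psi[OF _ \<tau>])
    thus ?thesis by (simp add: sum_distrib_left)
  qed
  have psi_theta: "(\<Sum>j\<in>J. psi (M j) \<tau> t (t + s j)) = (\<Sum>j\<in>J. theta_int (M j) \<tau> t (t + s j))" if "Im \<tau> > 0" for \<tau> t
    using J_fin good g zero that by (rule sum_psi_eq_theta_int)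
  have psi_indep: "(\<Sum>j\<in>J. psi (M j) \<tau> t (t + s j)) = (\<Sum>j\<in>J. psi (M j) \<tau> t' (t' + s j))" if "Im \<tau> > 0" for \<tau> t t'
    using J_fin good g zero that by (rule sum_psi_independent)
  obtain t where t: "c = c_curve P t" using c_C C_eq by blast
  \<comment> \<open>\<open>dsc\<close> is the determinant of \<open>A\<close> and negative, hence so
    is \<open>N\<close>; it enters only through divisibility.\<close>
  define N where "N = 4 * L * L * dsc"
  have N0: "N \<noteq> 0" using L dsc_nz by (simp add: N_def)
  define \<Phi> where "\<Phi> = (\<lambda>\<tau>. \<Sum>j\<in>J. Phi A P (m j) c (\<gamma> j *v c) \<tau>)"
  have \<Phi>: "\<Phi> \<tau> = of_real (sqrt (Im \<tau>)) * (\<Sum>j\<in>J. psi (M j) \<tau> t (t + s j))" if "\<tau> \<in> upper_half_plane" for \<tau>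
    using F[OF that] by (simp add: \<Phi>_def t)
  have modular: "\<Phi> (moebius X \<tau>) = theta_mult L (X$1$1) (X$2$1) * \<Phi> \<tau>"
    if X: "X \<in> principal_congruence N" and \<tau>: "\<tau> \<in> upper_half_plane" for X \<tau>
  proof -
    have im: "Im \<tau> > 0" using \<tau> by (simp add: upper_half_plane_def)
    have det: "X$1$1 * X$2$2 - X$1$2 * X$2$1 = 1"
      and cong: "N dvd X$1$1 - 1" "N dvd X$1$2" "N dvd X$2$1" "N dvd X$2$2 - 1"
      using X by (auto simp: principal_congruence_def det_2)
    define j where "j = of_int (X$2$1) * \<tau> + of_int (X$2$2)"
    have j0: "j \<noteq> 0" unfolding j_def by (rule moebius_denominator_nz[OF det im])
    have imM: "Im (moebius X \<tau>) = Im \<tau> / (norm j)\<^sup>2"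
      unfolding moebius_def j_def by (rule Im_moebius[OF det im])
    hence imM0: "Im (moebius X \<tau>) > 0" using im j0 by simp
    hence MH: "moebius X \<tau> \<in> upper_half_plane" by (simp add: upper_half_plane_def)
    \<comment> \<open>Here the weight becomes 0: the square root of the imaginary part loses exactly
      the factor \<open>norm j\<close> that the theta integrals gain.\<close>
    have sq: "sqrt (Im (moebius X \<tau>)) * norm j = sqrt (Im \<tau>)"
      using j0 by (simp add: imM real_sqrt_divide)
    have "\<Phi> (moebius X \<tau>) = of_real (sqrt (Im (moebius X \<tau>))) * (\<Sum>k\<in>J. theta_int (M k) (moebius X \<tau>) t (t + s k))"
      unfolding \<Phi>[OF MH] psi_theta[OF imM0] ..
    also have "(\<Sum>k\<in>J. theta_int (M k) (moebius X \<tau>) t (t + s k)) =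
       (\<Sum>k\<in>J. theta_mult L (X$1$1) (X$2$1) * of_real (norm j) * theta_int (M k) \<tau> t (t + s k))"
      unfolding moebius_def j_def
      by (intro sum.cong refl theta_int_modular[OF L perM N_def det cong im])
    also have "of_real (sqrt (Im (moebius X \<tau>))) * \<dots> = theta_mult L (X$1$1) (X$2$1) *
        (of_real (sqrt (Im (moebius X \<tau>)) * norm j) * (\<Sum>k\<in>J. theta_int (M k) \<tau> t (t + s k)))"
      unfolding sum_distrib_left[symmetric] by (simp only: of_real_mult mult_ac)
    also have "\<dots> = theta_mult L (X$1$1) (X$2$1) * \<Phi> \<tau>"
      unfolding sq \<Phi>[OF \<tau>] psi_theta[OF im] ..
    finally show ?thesis .
  qed
  \<comment> \<open>The sum over \<open>j\<close> is collected into one coefficient per lattice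
    point, so that the eigenvalue equation is needed for a single Bessel series only.\<close>
  define C' where "C' = (\<lambda>n. \<Sum>j\<in>J. M j n * of_real (sgn_weight t (t + s j) n))"
  have series: "((\<lambda>n. C' n * ec (Re \<tau> * (av n * bv n)) * of_real (K0_full (2 * pi * \<bar>av n * bv n\<bar> * Im \<tau>))) has_sum
      (\<Sum>j\<in>J. psi (M j) \<tau> t (t + s j))) UNIV" if \<tau>: "Im \<tau> > 0" for \<tau>
  proof -
    have "((\<lambda>n. \<Sum>j\<in>J. psi_term (M j) \<tau> t (t + s j) n) has_sum (\<Sum>j\<in>J. psi (M j) \<tau> t (t + s j))) UNIV"
      unfolding psi_def by (intro has_sum_finite_sum J_fin has_sum_infsum psi_summable good \<tau>)
    moreover have "(\<Sum>j\<in>J. psi_term (M j) \<tau> t (t + s j) n) =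
        C' n * ec (Re \<tau> * (av n * bv n)) * of_real (K0_full (2 * pi * \<bar>av n * bv n\<bar> * Im \<tau>))" for n
      unfolding C'_def sum_distrib_right by (intro sum.cong refl) (simp add: psi_term_def mult_ac)
    ultimately show ?thesis by (simp only:)
  qed
  have summ: "(\<lambda>n. norm (C' n) * K0_full (2 * pi * \<bar>av n * bv n\<bar> * y)) summable_on UNIV" if y: "y > 0" for y
  proof -
    \<comment> \<open>An unordered complex sum converges absolutely; the series at the point
      \<open>\<i> * y\<close> therefore yields the summability of the norms at height
      \<open>y\<close>.\<close>
    have "Im (\<i> * of_real y) > 0" using y by simp
    from has_sum_imp_summable[OF series[OF this]]
    have "(\<lambda>n. norm (C' n * ec (Re (\<i> * of_real y) * (av n * bv n)) * of_real (K0_full (2 * pi * \<bar>av n * bv n\<bar> * Im (\<i> * of_real y))))) summable_on UNIV"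
      by (simp only: summable_on_iff_abs_summable_on_complex)
    thus ?thesis using K0_full_nonneg by (simp add: norm_mult)
  qed
  have nz: "av n * bv n \<noteq> 0" if "C' n \<noteq> 0" for n
  proof -
    have "\<exists>j\<in>J. M j n \<noteq> 0"
    proof (rule ccontr)
      assume "\<not> (\<exists>j\<in>J. M j n \<noteq> 0)"
      hence "C' n = 0" by (simp add: C'_def)
      thus False using that by simp
    qed
    thus ?thesis using good_nz[OF good] by blast
  qed
  have ser: "\<Phi> \<tau> = of_real (sqrt (Im \<tau>)) *
      (\<Sum>\<^sub>\<infinity>n. C' n * ec (Re \<tau> * (av n * bv n)) * of_real (K0_full (2 * pi * \<bar>av n * bv n\<bar> * Im \<tau>)))" if "\<tau> \<in> upper_half_plane" for \<tau>
    unfolding \<Phi>[OF that] using infsumI[OF series, of \<tau>] that by (simp add: upper_half_plane_def)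
  have "maass_form_wt0 (principal_congruence N) (\<lambda>X. theta_mult L (X$1$1) (X$2$1)) (1/4) \<Phi>"
    unfolding maass_form_wt0_def
    using bessel_series_maass[OF summ nz ser] modular by blast
  hence "\<exists>\<Gamma> v. subgroup \<Gamma> SL2Z \<and> finite (rcosets\<^bsub>SL2Z\<^esub> \<Gamma>) \<and> maass_form_wt0 \<Gamma> v (1/4) \<Phi>"
    using subgroup_principal_congruence finite_rcosets_principal_congruence[OF N0] by blast
  moreover have "\<Phi> \<tau> = (\<Sum>j\<in>J. Phi A P (m j) c' (\<gamma> j *v c') \<tau>)" if c': "c' \<in> C" and \<tau>: "\<tau> \<in> upper_half_plane" for c' \<tau>
  proof -
    obtain t' where t': "c' = c_curve P t'" using c' C_eq by blast
    have im: "Im \<tau> > 0" using \<tau> by (simp add: upper_half_plane_def)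
    show ?thesis unfolding \<Phi>[OF \<tau>] t' F[OF \<tau>] psi_indep[OF im, of t t'] ..
  qed
  ultimately show ?thesis unfolding \<Phi>_def by blast
qed

end
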